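(* Let $t\ge 1$ and let $F=\mathbb{Q}(\sqrt{\Delta})$ with $\Delta=-p_1\cdots p_t$, where $p_1,\dots,p_t$ are distinct primes such that $p_i\equiv 1\pmod 4$ for $i=1,\dots,t-1$ and $p_t\equiv 3\pmod 4$. Let $V_0$ be the $\mathbb{F}_2$-vector space defined in the context, let $Q_{\mathfrak{B}}$ be the quadratic form on $V_0$ defined by $Q_{\mathfrak{B}}(D)=\xi\left(\left(\frac{\Delta/D}{D}\right)_4\right)$, and let $\rho(Q_{\mathfrak{B}})$ be its isotropy index. Let $r_8$ be the $8$-rank of the class group of $F$. Then $$r_8\le\rho(Q_{\mathfrak{B}}).$$
   Context: Let $\mathcal{C}$ be the ideal class group of $F$, written additively, so $2^k\mathcal{C}$ is the subgroup of $2^k$-th powers of ideal classes and $\mathcal{C}[2]$ the subgroup of classes killed by $2$. The $8$-rank is $r_8=\dim_{\mathbb{F}_2}4\mathcal{C}/8\mathcal{C}$. Let $\xi\colon\{\pm1\}\to\mathbb{F}_2$ be the group isomorphism with $\xi(1)=0$, $\xi(-1)=1$. For $i=1,\dots,t$ let $\mathfrak{p}_i$ be the prime ideal of $F$ with $\mathfrak{p}_i^2=(p_i)$. Let $V'$ be the set of positive divisors of $p_1\cdots p_{t-1}$, an $\mathbb{F}_2$-vector space with addition $q_1\cdot q_2=q_1q_2/\gcd(q_1,q_2)^2$. The map $p_i\mapsto$ class of $\mathfrak{p}_i$ ($1\le i\le t-1$) extends to an isomorphism of $\mathbb{F}_2$-vector spaces $V'\to\mathcal{C}[2]$, sending $D$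 to the class of $\prod_{p_i\mid D}\mathfrak{p}_i$. Let $V_0\subset V'$ be the subspace of those $D$ for which the class of $\prod_{p_i\mid D}\mathfrak{p}_i$ lies in $2\mathcal{C}$; it is identified with $\mathcal{C}[2]\cap 2\mathcal{C}$. Quartic symbol: for a prime $p\equiv1\pmod 4$ and an integer $a$ coprime to $p$ that is a quadratic residue mod $p$, $\left(\frac{a}{p}\right)_4=\pm1$ is defined by $\left(\frac{a}{p}\right)_4\equiv a^{(p-1)/4}\pmod p$. For $D$ a product of distinct primes $q_1,\dots,q_s\equiv1\pmod 4$ and $a\in\mathbb{Z}$ coprime to $D$ and a quadratic residue mod every $q_i$, $\left(\frac{a}{D}\right)_4=\prod_{i=1}^s\left(\frac{a}{q_i}\right)_4$ (equal to $1$ if $D=1$). For $D\in V_0$, the integer $\Delta/D$ is a quadratic residue modulo every prime dividing $D$, so $Q_{\mathfrak{B}}$ is well defined. Quadratic forms: for a vector space $W$ over a field $k$, a map $Q\colon W\to k$ is a quadratic form if there is a (not necessarily symmetric) bilinear form $B$ on $W$ with $Q(x)=B(x,x)$ for all $x$. The isotropy index $\rho(Q)$ is the maximal dimension of a subspace $W'\subset W$ with $Q|_{W'}=0$. *)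

theory Defs
  imports
    Complex_Main
    "HOL-Computational_Algebra.Polynomial"
    "HOL-Number_Theory.Residues"
    "HOL-Algebra.Ideal_Product"
    "Jordan_Normal_Form.Missing_VectorSpace"
begin

section \<open>Vector spaces over the field with two elements\<close>

abbreviation F2 :: "int ring" where
  "F2 \<equiv> residue_ring 2"

text \<open>
  An abelian group of exponent dividing 2, written multiplicatively, as a vector space over
  \<^term>\<open>F2\<close>: vector addition is the group operation and \<open>k \<odot> x = x [^] k\<close>. The ring-multiplication
  fields of the \<open>module\<close> record play no role for modules and are left undefined.
\<close>
definition F2_space :: "('a, 'm) monoid_scheme \<Rightarrow> (int, 'a) module" where
  "F2_space G = \<lparr>carrier = carrier G, monoid.mult = undefined, one = undefined,
     zero = \<one>\<^bsub>G\<^esub>, add = (\<lambda>x y. x \<otimes>\<^bsub>G\<^esub> y), smult = (\<lambda>k x. x [^]\<^bsub>G\<^esub> k)\<rparr>"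

lemma field_F2: "field F2"
proof -
  interpret residues_prime 2 F2 by unfold_locales auto
  show ?thesis by (rule is_field)
qed

lemma vectorspace_F2_space:
  assumes "comm_group G" and sq: "\<And>x. x \<in> carrier G \<Longrightarrow> x \<otimes>\<^bsub>G\<^esub> x = \<one>\<^bsub>G\<^esub>"
  shows "vectorspace F2 (F2_space G)"
proof -
  interpret G: comm_group G by fact
  interpret F: field F2 by (rule field_F2)
  have c: "carrier F2 = {0, 1}" by (auto simp: residue_ring_def)
  have "abelian_group (F2_space G)"
    by (rule abelian_groupI) (auto simp: F2_space_def G.m_ac intro: sq)
  moreover have "module_axioms F2 (F2_space G)"
    unfolding module_axioms_def c
    by (auto simp: F2_space_def residue_ring_def G.int_pow_distrib sq G.int_pow_one)
  ultimately show ?thesis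
    by (simp add: vectorspace_def module_def field_F2 F.is_cring)
qed

text \<open>
  The maximum is meaningful for finite-dimensional \<open>V\<close>. The definition does not need \<open>Q\<close> to be
  a quadratic form.
\<close>
definition isotropy_index ::
  "('k, 'l) ring_scheme \<Rightarrow> ('k, 'v, 'm) module_scheme \<Rightarrow> ('v \<Rightarrow> 'k) \<Rightarrow> nat" where
  "isotropy_index K V Q =
     Max {vectorspace.dim K (V\<lparr>carrier := W\<rparr>) | W.
            VectorSpace.subspace K W V \<and> (\<forall>x\<in>W. Q x = \<zero>\<^bsub>K\<^esub>)}"


section \<open>Ideal class groups\<close>

definition nonzero_ideals :: "('a, 'b) ring_scheme \<Rightarrow> 'a set set" where
  "nonzero_ideals R = {I. ideal I R \<and> I \<noteq> {\<zero>\<^bsub>R\<^esub>}}"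

text \<open>
  Ideal classes are represented by integral ideals: \<open>I\<close> and \<open>J\<close> are equivalent iff
  \<open>(a) I = (b) J\<close> for some nonzero \<open>a\<close> and \<open>b\<close>.
\<close>
definition ideal_class_rel :: "('a, 'b) ring_scheme \<Rightarrow> ('a set \<times> 'a set) set" where
  "ideal_class_rel R =
     {(I, J). I \<in> nonzero_ideals R \<and> J \<in> nonzero_ideals R \<and>
        (\<exists>a \<in> carrier R - {\<zero>\<^bsub>R\<^esub>}. \<exists>b \<in> carrier R - {\<zero>\<^bsub>R\<^esub>}.
           ideal_prod R (PIdl\<^bsub>R\<^esub> a) I = ideal_prod R (PIdl\<^bsub>R\<^esub> b) J)}"

definition ideal_class :: "('a, 'b) ring_scheme \<Rightarrow> 'a set \<Rightarrow> 'a set set" where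
  "ideal_class R I = ideal_class_rel R `` {I}"

definition class_group :: "('a, 'b) ring_scheme \<Rightarrow> 'a set set monoid" where
  "class_group R =
     \<lparr>carrier = nonzero_ideals R // ideal_class_rel R,
      monoid.mult = (\<lambda>A B. \<Union>I\<in>A. \<Union>J\<in>B. ideal_class R (ideal_prod R I J)),
      one = ideal_class R (carrier R)\<rparr>"

text \<open>The subgroup of \<open>n\<close>-th powers; \<open>n C\<close> in additive notation.\<close>
definition powers :: "('a, 'm) monoid_scheme \<Rightarrow> nat \<Rightarrow> 'a set" where
  "powers G n = (\<lambda>x. x [^]\<^bsub>G\<^esub> n) ` carrier G"

definition eight_rank :: "('a, 'm) monoid_scheme \<Rightarrow> nat" where
  "eight_rank G =
     vectorspace.dim F2 (F2_space ((G\<lparr>carrier := powers G 4\<rparr>) Mod (powers G 8)))"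


section \<open>Quadratic fields\<close>

definition quadratic_field :: "int \<Rightarrow> complex set" where
  "quadratic_field d = {of_rat a + of_rat b * csqrt (of_int d) | a b. True}"

definition ring_of_integers :: "complex set \<Rightarrow> complex ring" where
  "ring_of_integers F =
     \<lparr>carrier = {x \<in> F. algebraic_int x}, monoid.mult = (*), one = 1, zero = 0, add = (+)\<rparr>"

abbreviation quad_ints :: "int \<Rightarrow> complex ring" where
  "quad_ints d \<equiv> ring_of_integers (quadratic_field d)"

text \<open>The prime ideal whose square is \<open>(q)\<close>, for a ramified prime \<open>q\<close>.\<close>
definition ramified_prime :: "int \<Rightarrow> nat \<Rightarrow> complex set" where
  "ramified_prime d q =
     (THE P. primeideal P (quad_ints d) \<and> ideal_prod (quad_ints d) P P = PIdl\<^bsub>quad_ints d\<^esub> (of_nat q))"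


section \<open>Quartic symbols\<close>

text \<open>
  Only meaningful for a prime \<open>q \<equiv> 1 (mod 4)\<close> and a quadratic residue \<open>a\<close> coprime to \<open>q\<close>;
  otherwise the value is unspecified.
\<close>
definition quartic_symbol_prime :: "int \<Rightarrow> nat \<Rightarrow> int" where
  "quartic_symbol_prime a q =
     (THE s. s \<in> {1, -1} \<and> [s = a ^ ((q - 1) div 4)] (mod int q))"

definition quartic_symbol :: "int \<Rightarrow> nat \<Rightarrow> int" where
  "quartic_symbol a D = (\<Prod>q\<in>prime_factors D. quartic_symbol_prime a q)"

definition xi :: "int \<Rightarrow> int" where
  "xi s = (if s = 1 then \<zero>\<^bsub>F2\<^esub> else \<one>\<^bsub>F2\<^esub>)"


section \<open>The space of divisors and its quadratic form\<close>

definition divisor_group :: "nat \<Rightarrow> nat monoid" where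
  "divisor_group n =
     \<lparr>carrier = {D. D dvd n}, monoid.mult = (\<lambda>a b. a * b div (gcd a b)\<^sup>2), one = 1\<rparr>"

definition V' :: "(nat \<Rightarrow> nat) \<Rightarrow> nat \<Rightarrow> nat monoid" where
  "V' p t = divisor_group (\<Prod>i=1..t - 1. p i)"

definition divisor_ideal :: "int \<Rightarrow> (nat \<Rightarrow> nat) \<Rightarrow> nat \<Rightarrow> nat \<Rightarrow> complex set" where
  "divisor_ideal d p t D =
     finprod (ideals_set (quad_ints d)) (\<lambda>i. ramified_prime d (p i)) {i \<in> {1..t - 1}. p i dvd D}"

definition V0 :: "int \<Rightarrow> (nat \<Rightarrow> nat) \<Rightarrow> nat \<Rightarrow> (int, nat) module" where
  "V0 d p t =
     F2_space ((V' p t)\<lparr>carrier :=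
       {D \<in> carrier (V' p t).
          ideal_class (quad_ints d) (divisor_ideal d p t D) \<in> powers (class_group (quad_ints d)) 2}\<rparr>)"

definition Q_B :: "int \<Rightarrow> nat \<Rightarrow> int" where
  "Q_B d D = xi (quartic_symbol (d div int D) D)"

end

theory Submission
  imports Defs "HOL-Number_Theory.Number_Theory" "HOL-Computational_Algebra.Squarefree"
begin

text \<open>
  Write \<open>C\<close> for the class group. The divisors \<open>D\<close> of \<open>p 1 \<cdots> p (t - 1)\<close> whose ideal class lies in
  \<open>4C\<close> form a subspace \<open>W\<close> of \<open>V\<^sub>0\<close>. The inequality holds because \<open>W\<close> is totally isotropic and has
  dimension at least \<open>r\<^sub>8\<close>.

  Dimension. In a finite abelian group, \<open>4C/8C\<close> has as many elements as the kernel of doubling on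
  \<open>4C\<close> (\<open>two_power_eight_rank\<close>). By genus theory every class killed by \<open>2\<close> is the class of a
  product of ramified primes (\<open>two_torsion_representative\<close>), and the prime above \<open>p t\<close> can be
  avoided because \<open>\<surd>\<Delta>\<close> generates the product of all of them (\<open>cl_J_complement\<close>). Hence \<open>W\<close> maps
  onto that kernel.

  Isotropy. Let the ideal attached to \<open>D\<close> have class \<open>4x\<close>. The class \<open>-x\<close> contains a primitive
  ideal whose norm \<open>a\<close> is prime to \<open>2\<Delta>\<close>; its fourth power times the ideal of \<open>D\<close> is principal, and
  the norm of a generator gives
  \<open>D X\<^sup>2 - (\<Delta>/D) Y\<^sup>2 = 4 a\<^sup>4\<close> with \<open>Y\<close> prime to \<open>a\<close> (\<open>fourth_power_class_representation\<close>).
  For a prime \<open>q\<close> dividing \<open>D\<close> this reads \<open>\<Delta>/D \<equiv> -4 a\<^sup>4 / Y\<^sup>2\<close>, and \<open>-4 \<equiv> (1 + i)\<^sup>4\<close> where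
  \<open>i\<^sup>2 \<equiv> -1\<close>, so the quartic symbol of \<open>\<Delta>/D\<close> at \<open>q\<close> is the Legendre symbol of \<open>Y\<close>. Altogether the
  value of the form at \<open>D\<close> is given by the Jacobi symbol of \<open>Y\<close> over \<open>D\<close>. It equals \<open>1\<close>: modulo an
  odd prime \<open>l\<close> dividing \<open>Y\<close> the equation makes \<open>D\<close> a square, which is enough by quadratic
  reciprocity since \<open>D\<close> is a product of primes congruent to \<open>1\<close> modulo \<open>4\<close>; the prime \<open>2\<close> requires
  a \<open>2\<close>-adic look at the equation (\<open>quartic_symbol_eq_1\<close>).

  The ideal theory needed for this is explicit. With \<open>\<omega> = (1 + \<surd>\<Delta>)/2\<close>, every nonzero ideal is an
  integer multiple of some \<open>\<int>a + \<int>(r + \<omega>)\<close>, and such an ideal times its conjugate is \<open>(a)\<close>. This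
  yields inverses in \<open>C\<close>, and the reduction of binary quadratic forms yields both the finiteness of
  \<open>C\<close> and the representatives of norm prime to \<open>2\<Delta>\<close>.
\<close>

section \<open>Quadratic and quartic symbols\<close>

lemma prime_1_mod_4_gt_2:
  assumes "prime q" "[q = 1] (mod 4)" shows "2 < (q::nat)"
  using assms prime_gt_1_nat[of q] by (cases "q = 2") (auto simp: cong_def)

lemma four_dvd_pred_prime:
  assumes "prime q" "[q = 1] (mod 4)" shows "4 dvd q - (1::nat)"
  using assms(2) prime_gt_1_nat[OF assms(1)] cong_to_1_nat by blast

lemma Legendre_unit:
  assumes "prime q" "2 < q" "\<not> int q dvd y"
  shows "Legendre y (int q) \<in> {1, -1}"
  using assms by (auto simp: Legendre_def cong_0_iff)

lemma sign_cong_imp_eq: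
  fixes r s :: int
  assumes "r \<in> {1, -1}" "s \<in> {1, -1}" "[r = s] (mod m)" "m > 2"
  shows "r = s"
proof -
  have "m dvd r - s" using assms(3) by (simp add: cong_iff_dvd_diff)
  moreover have "\<bar>r - s\<bar> < m" using assms by auto
  ultimately have "r - s = 0" using zdvd_not_zless[of "\<bar>r - s\<bar>" m] by auto
  then show ?thesis by simp
qed

lemma fermat_theorem_int:
  assumes "prime q" "2 < q" "\<not> int q dvd a"
  shows "[a ^ (q - 1) = 1] (mod int q)"
proof -
  have "even (q - 1)" using prime_odd_nat[of q] assms by simp
  then have "(a ^ ((q - 1) div 2))\<^sup>2 = a ^ (q - 1)"
    by (auto simp flip: power_mult elim!: dvdE)
  moreover have "[(Legendre a (int q))\<^sup>2 = (a ^ ((q - 1) div 2))\<^sup>2] (mod int q)"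
    by (intro cong_pow euler_criterion assms)
  moreover have "(Legendre a (int q))\<^sup>2 = 1"
    using Legendre_unit[OF assms] by auto
  ultimately show ?thesis by (simp add: cong_sym)
qed

text \<open>
  Modulo \<open>q\<close> there is \<open>i\<close> with \<open>i\<^sup>2 = -1\<close>, and then \<open>-4 = (1 + i)\<^sup>4\<close> is a fourth power.
\<close>
lemma fourth_root_of_minus_four:
  assumes "prime q" "[q = 1] (mod 4)"
  shows "[(-4) ^ ((q - 1) div 4) = (1::int)] (mod int q)"
proof -
  have q2: "q > 2" by (rule prime_1_mod_4_gt_2) (use assms in auto)
  have dv: "4 dvd q - 1" by (rule four_dvd_pred_prime) (use assms in auto)
  have ev: "even ((q - 1) div 2)" using dv by (auto elim!: dvdE)
  have "[Legendre (-1) (int q) = (-1) ^ ((q - 1) div 2)] (mod int q)"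
    by (rule euler_criterion) (use assms q2 in auto)
  then have "[Legendre (-1) (int q) = 1] (mod int q)" using ev by simp
  moreover have "Legendre (-1) (int q) \<in> {1, -1}"
    using Legendre_unit[of q "-1"] assms q2 by auto
  ultimately have "Legendre (-1) (int q) = 1"
    using sign_cong_imp_eq[of _ 1 "int q"] q2 by auto
  then obtain i where i: "[i ^ 2 = -1] (mod int q)"
    by (auto simp: Legendre_def QuadRes_def split: if_splits)
  \<comment> \<open>Division with remainder of \<open>(1 + i) ^ 4\<close> by \<open>i\<^sup>2 + 1\<close>.\<close>
  have *: "(1 + i) ^ 4 = -4 + (i\<^sup>2 + 1) * (i\<^sup>2 + 4 * i + 5)" for i :: int
    by (simp add: power4_eq_xxxx power2_eq_square algebra_simps)
  have "int q dvd i\<^sup>2 + 1" using i by (simp add: cong_iff_dvd_diff)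
  then have four: "[(1 + i) ^ 4 = -4] (mod int q)"
    unfolding * by (simp add: cong_iff_dvd_diff)
  have nd: "\<not> int q dvd 1 + i"
  proof
    assume "int q dvd 1 + i"
    then have "int q dvd (1 + i) ^ 4" by (meson dvd_power dvd_trans zero_less_numeral)
    then have "int q dvd -4" using four by (metis cong_0_iff cong_sym cong_trans)
    then have "int q dvd 2 ^ 2" by simp
    then have "int q dvd 2" using assms(1) prime_dvd_power by (metis prime_nat_int_transfer)
    then show False using q2 by (auto dest: zdvd_imp_le)
  qed
  have "[((1 + i) ^ 4) ^ ((q - 1) div 4) = (-4) ^ ((q - 1) div 4)] (mod int q)"
    using four by (rule cong_pow)
  moreover have "((1 + i) ^ 4) ^ ((q - 1) div 4) = (1 + i) ^ (q - 1)"
    using dv by (simp flip: power_mult)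
  moreover have "[(1 + i) ^ (q - 1) = 1] (mod int q)"
    by (rule fermat_theorem_int) (use assms q2 nd in auto)
  ultimately show ?thesis by (metis cong_sym cong_trans)
qed

lemma Legendre_mult:
  assumes "prime q" "2 < q"
  shows "Legendre (a * b) (int q) = Legendre a (int q) * Legendre b (int q)"
proof (cases "int q dvd a * b")
  case True
  then show ?thesis using assms(1)
    by (auto simp: Legendre_def cong_0_iff prime_dvd_mult_iff)
next
  case False
  then have nd: "\<not> int q dvd a" "\<not> int q dvd b" by auto
  have "[Legendre (a * b) (int q) = (a * b) ^ ((q - 1) div 2)] (mod int q)"
    by (rule euler_criterion) (use assms in auto)
  also have "(a * b) ^ ((q - 1) div 2) = a ^ ((q - 1) div 2) * b ^ ((q - 1) div 2)"
    by (rule power_mult_distrib)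
  also have "[a ^ ((q - 1) div 2) * b ^ ((q - 1) div 2) = Legendre a (int q) * Legendre b (int q)] (mod int q)"
    by (intro cong_mult; rule cong_sym; rule euler_criterion) (use assms in auto)
  finally show ?thesis
    using Legendre_unit[OF assms False] Legendre_unit[OF assms nd(1)] Legendre_unit[OF assms nd(2)]
    by (intro sign_cong_imp_eq[of _ _ "int q"]) (use assms in auto)
qed

lemma Legendre_square:
  assumes "prime q" "2 < q" "\<not> int q dvd a"
  shows "Legendre (a\<^sup>2) (int q) = 1"
  using Legendre_mult[OF assms(1,2), of a a] Legendre_unit[OF assms] by (auto simp: power2_eq_square)

text \<open>
  Follows from \<open>2 ^ ((q - 1) div 2) = 4 ^ ((q - 1) div 4) = (-1) ^ ((q - 1) div 4) * (-4) ^ ((q - 1) div 4)\<close>,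
  whose last factor is \<open>1\<close>.
\<close>
lemma Legendre_two:
  assumes "prime q" "[q = 1] (mod 4)"
  shows "Legendre 2 (int q) = (-1) ^ ((q - 1) div 4)"
proof -
  have q2: "q > 2" by (rule prime_1_mod_4_gt_2) (use assms in auto)
  have dv: "4 dvd q - 1" by (rule four_dvd_pred_prime) (use assms in auto)
  have "[Legendre 2 (int q) = 2 ^ ((q - 1) div 2)] (mod int q)"
    by (rule euler_criterion) (use assms q2 in auto)
  also have "(2::int) ^ ((q - 1) div 2) = 4 ^ ((q - 1) div 4)"
  proof -
    have "(q - 1) div 2 = 2 * ((q - 1) div 4)" using dv by (auto elim!: dvdE)
    then show ?thesis by (simp add: power_mult)
  qed
  also have "\<dots> = (-1) ^ ((q - 1) div 4) * (-4) ^ ((q - 1) div 4)"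
    by (simp flip: power_mult_distrib)
  also have "[\<dots> = (-1) ^ ((q - 1) div 4) * 1] (mod int q)"
    by (intro cong_mult fourth_root_of_minus_four assms) auto
  finally have "[Legendre 2 (int q) = (-1) ^ ((q - 1) div 4)] (mod int q)" by simp
  moreover have "\<not> int q dvd 2" using q2 by (auto dest: zdvd_imp_le)
  ultimately show ?thesis using q2 assms
    by (intro sign_cong_imp_eq[of _ _ "int q"] Legendre_unit)
       (auto simp: minus_one_power_iff)
qed

text \<open>
  The congruence is raised to the power \<open>(q - 1) div 4\<close>: the fourth powers \<open>-4\<close> and \<open>a ^ 4\<close> disappear
  and \<open>y\<^sup>2\<close> turns into the Legendre symbol of \<open>y\<close>.
\<close>
lemma quartic_symbol_prime_eq_Legendre:
  assumes "prime q" "[q = 1] (mod 4)" "\<not> int q dvd y" "\<not> int q dvd a"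
    and "[A * y\<^sup>2 = -4 * a ^ 4] (mod int q)"
  shows "quartic_symbol_prime A q = Legendre y (int q)"
proof -
  have q2: "q > 2" by (rule prime_1_mod_4_gt_2) (use assms in auto)
  have dv: "4 dvd q - 1" by (rule four_dvd_pred_prime) (use assms in auto)
  let ?k = "(q - 1) div 4" and ?L = "Legendre y (int q)"
  have k2: "(q - 1) div 2 = 2 * ?k" and k4: "q - 1 = 4 * ?k" using dv by (auto elim!: dvdE)
  have fermat: "[a ^ (q - 1) = 1] (mod int q)"
    by (rule fermat_theorem_int) (use assms q2 in auto)
  have L: "?L \<in> {1, -1}" by (rule Legendre_unit) (use assms q2 in auto)
  have "[?L = y ^ (2 * ?k)] (mod int q)"
    unfolding k2[symmetric] by (rule euler_criterion) (use assms q2 in auto)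
  then have "[A ^ ?k * ?L = A ^ ?k * y ^ (2 * ?k)] (mod int q)"
    by (rule cong_scalar_left)
  also have "A ^ ?k * y ^ (2 * ?k) = (A * y\<^sup>2) ^ ?k"
    by (simp add: power_mult_distrib power_mult)
  also have "[(A * y\<^sup>2) ^ ?k = (-4 * a ^ 4) ^ ?k] (mod int q)"
    by (rule cong_pow) fact
  also have "(-4 * a ^ 4) ^ ?k = (-4) ^ ?k * a ^ (q - 1)"
    by (subst (3) k4) (simp only: power_mult_distrib power_mult)
  also have "[\<dots> = 1 * 1] (mod int q)"
    by (intro cong_mult fermat fourth_root_of_minus_four assms)
  finally have "[A ^ ?k * ?L * ?L = 1 * ?L] (mod int q)" by (intro cong_scalar_right) simp
  then have *: "[?L = A ^ ?k] (mod int q)" using L by (auto simp: cong_sym)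
  show ?thesis unfolding quartic_symbol_prime_def
  proof (rule the_equality)
    show "?L \<in> {1, -1} \<and> [?L = A ^ ?k] (mod int q)" using L * by simp
    fix s assume "s \<in> {1, -1} \<and> [s = A ^ ?k] (mod int q)"
    then show "s = ?L" using L * q2
      by (intro sign_cong_imp_eq[of _ _ "int q"]) (auto intro: cong_trans cong_sym)
  qed
qed

text \<open>
  The Jacobi symbol when \<open>D\<close> is odd and squarefree.
\<close>
definition Jacobi :: "int \<Rightarrow> nat \<Rightarrow> int" where
  "Jacobi y D = (\<Prod>q\<in>prime_factors D. Legendre y (int q))"

lemma prod_prime_factors_squarefree:
  assumes "squarefree (D::nat)"
  shows "\<Prod>(prime_factors D) = D"
proof -
  have D0: "D \<noteq> 0" using assms by (intro notI) simp
  have "D = (\<Prod>q\<in>prime_factors D. q ^ multiplicity q D)"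
    using prime_factorization_nat[of D] D0 by simp
  also have "\<dots> = (\<Prod>q\<in>prime_factors D. q)"
    using squarefree_factorial_semiring'[OF D0] assms by (intro prod.cong) auto
  finally show ?thesis by simp
qed

lemma odd_square_form:
  assumes "odd (z::int)" obtains k where "z\<^sup>2 = 8 * k + 1"
proof -
  obtain j where j: "z = 2 * j + 1" using assms by (rule oddE)
  have "even (j * (j + 1))" by simp
  then obtain k where "j * (j + 1) = 2 * k" by (rule evenE)
  then have "z\<^sup>2 = 8 * k + 1" using j by (simp add: power2_eq_square algebra_simps)
  then show ?thesis by (rule that)
qed

text \<open>
  The \<open>2\<close>-adic part of the argument. An even \<open>y\<close> forces \<open>x\<close> to be even, and after division by \<open>4\<close>
  the right-hand side is \<open>1\<close> modulo \<open>8\<close>; since \<open>A\<close> and \<open>D\<close> are both \<open>1\<close> modulo \<open>4\<close>, also \<open>y div 2\<close> is even.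
  If moreover \<open>8\<close> divides \<open>y\<close>, then reduction modulo \<open>8\<close> leaves \<open>D \<equiv> 1\<close>.
\<close>
lemma two_adic_cases:
  fixes D x A y a :: int
  assumes eq: "D * x\<^sup>2 - A * y\<^sup>2 = 4 * a ^ 4"
    and D: "D mod 4 = 1" and A: "A mod 4 = 1" and "odd a"
  shows "odd y \<or> (\<exists>y'. y = 4 * y' \<and> odd y') \<or> D mod 8 = 1"
proof (rule ccontr)
  assume neg: "\<not> ?thesis"
  obtain d e where d: "D = 4 * d + 1" and e: "A = 4 * e + 1" using D A by (metis mult_div_mod_eq)
  obtain y1 where y1: "y = 2 * y1" using neg by auto
  have "even (D * x\<^sup>2)" using eq y1 by (auto simp: power_mult_distrib algebra_simps)
  then obtain x1 where x1: "x = 2 * x1" using d by auto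
  have eq1: "D * x1\<^sup>2 - A * y1\<^sup>2 = a ^ 4" using eq x1 y1 by (simp add: power_mult_distrib)
  obtain f where f: "a ^ 4 = 8 * f + 1" using odd_square_form[of "a\<^sup>2"] \<open>odd a\<close> by auto
  show False
  proof (cases "odd y1")
    case True
    then obtain k where k: "y1\<^sup>2 = 8 * k + 1" by (rule odd_square_form)
    have "x1\<^sup>2 mod 4 = 0 \<or> x1\<^sup>2 mod 4 = 1"
    proof (cases "odd x1")
      case True
      then obtain k where "x1\<^sup>2 = 8 * k + 1" by (rule odd_square_form)
      then show ?thesis by presburger
    qed (auto elim!: evenE simp: power_mult_distrib)
    moreover have "x1\<^sup>2 = 4 * (2 * f + e * y1\<^sup>2 + 2 * k - d * x1\<^sup>2) + 2"
      using eq1 k unfolding d e f by (simp add: algebra_simps)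
    then obtain w where "x1\<^sup>2 = 4 * w + 2" by metis
    then have "x1\<^sup>2 mod 4 = 2" by presburger
    ultimately show False by simp
  next
    case False
    then obtain y2 where y2: "y1 = 2 * y2" by (auto elim: evenE)
    then have "even y2" using neg y1 by auto
    then obtain y3 where y3: "y2 = 2 * y3" by (rule evenE)
    have "odd (x1\<^sup>2)"
    proof
      assume "even (x1\<^sup>2)"
      then have "even (D * x1\<^sup>2 - A * y1\<^sup>2)" using y2 by simp
      then show False using eq1 \<open>odd a\<close> by simp
    qed
    then obtain k where k: "x1\<^sup>2 = 8 * k + 1" using odd_square_form[of x1] by auto
    have "D * x1\<^sup>2 = 32 * (d * k) + 8 * k + 4 * d + 1" unfolding d k by (simp add: algebra_simps)
    moreover have "A * y1\<^sup>2 = 16 * (A * y3\<^sup>2)" unfolding y2 y3 by (simp add: power_mult_distrib)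
    ultimately have "4 * d + 1 = 8 * (f - k - 4 * (d * k) + 2 * (A * y3\<^sup>2)) + 1"
      using eq1 f by (simp add: algebra_simps)
    then obtain w where "D = 8 * w + 1" using d by metis
    then have "D mod 8 = 1" by presburger
    then show False using neg by blast
  qed
qed

context
  fixes D :: nat
  assumes sqf: "squarefree D"
    and one4: "\<And>q. prime q \<Longrightarrow> q dvd D \<Longrightarrow> [q = 1] (mod 4)"
begin

lemma prime_factors_gt_2: "q \<in> prime_factors D \<Longrightarrow> prime q \<and> [q = 1] (mod 4) \<and> 2 < q"
  using one4 prime_1_mod_4_gt_2 by (auto simp: in_prime_factors_iff)

lemma Jacobi_mult: "Jacobi (y * z) D = Jacobi y D * Jacobi z D"
  unfolding Jacobi_def prod.distrib[symmetric]
  by (intro prod.cong refl Legendre_mult) (use prime_factors_gt_2 in auto)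

lemma Jacobi_minus: "Jacobi (- y) D = Jacobi y D"
proof -
  have "Legendre (-1) (int q) = 1" if "q \<in> prime_factors D" for q
  proof -
    note q = prime_factors_gt_2[OF that]
    have "4 dvd q - 1" using q four_dvd_pred_prime by blast
    then have "even ((q - 1) div 2)" by (auto elim!: dvdE)
    moreover have "[Legendre (-1) (int q) = (-1) ^ ((q - 1) div 2)] (mod int q)"
      using q by (intro euler_criterion) auto
    moreover have "Legendre (-1) (int q) \<in> {1, -1}"
      using q by (intro Legendre_unit) auto
    ultimately show ?thesis using sign_cong_imp_eq[of _ 1 "int q"] q by auto
  qed
  then have "Jacobi (-1) D = 1" by (simp add: Jacobi_def)
  then show ?thesis using Jacobi_mult[of "-1" y] by simp
qed

text \<open>
  Quadratic reciprocity at every prime factor of \<open>D\<close>; there are no signs, as these primes are \<open>1\<close>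
  modulo \<open>4\<close>.
\<close>
lemma Jacobi_eq_Legendre:
  assumes "prime l" "2 < l" "\<not> l dvd D"
  shows "Jacobi (int l) D = Legendre (int D) (int l)"
proof -
  have eq: "Legendre (int l) (int q) = Legendre (int q) (int l)" if "q \<in> prime_factors D" for q
  proof -
    note q = prime_factors_gt_2[OF that]
    have ne: "l \<noteq> q" using that assms by auto
    have "4 dvd q - 1" using q four_dvd_pred_prime by blast
    then have ev: "even ((q - 1) div 2)" by (auto elim!: dvdE)
    have "Legendre (int l) (int q) * Legendre (int q) (int l) = 1"
      using Quadratic_Reciprocity[of l q] assms q ne ev by simp
    moreover have "Legendre (int l) (int q) \<in> {1, -1}" "Legendre (int q) (int l) \<in> {1, -1}"
      using assms q ne Legendre_unit[of q "int l"] Legendre_unit[of l "int q"]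
      by (auto dest: primes_dvd_imp_eq)
    ultimately show ?thesis by auto
  qed
  have "Legendre (int (\<Prod>Q)) (int l) = (\<Prod>q\<in>Q. Legendre (int q) (int l))" if "finite Q" for Q
    using that
  proof (induction Q)
    case empty
    then show ?case using Legendre_square[OF assms(1,2), of 1] assms by (auto simp: prime_gt_1_nat)
  next
    case (insert q Q)
    then show ?case using Legendre_mult[OF assms(1,2), of "int q" "int (\<Prod>Q)"] by simp
  qed
  from this[of "prime_factors D"] show ?thesis
    using eq by (simp add: Jacobi_def prod_prime_factors_squarefree sqf)
qed

text \<open>
  Each prime factor \<open>q\<close> contributes \<open>1\<close> or \<open>-1\<close> according to whether it is \<open>1\<close> or \<open>5\<close> modulo \<open>8\<close>.
\<close>
lemma Jacobi_two:
  assumes "[D = 1] (mod 8)"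
  shows "Jacobi 2 D = 1"
proof -
  have "(\<Prod>q\<in>Q. (-1) ^ ((q - 1) div 4)) = (if \<Prod>Q mod 8 = 1 then 1 else -1 :: int) \<and> \<Prod>Q mod 4 = 1"
    if "finite Q" "\<And>q. q \<in> Q \<Longrightarrow> [q = 1] (mod 4)" for Q :: "nat set"
    using that
  proof (induction Q)
    case (insert q Q)
    have "q mod 4 = 1" using insert.prems[of q] by (simp add: cong_def)
    then have "q mod 8 = 1 \<or> q mod 8 = 5" by presburger
    then consider k where "q = 8 * k + 1" | k where "q = 8 * k + 5"
      by (metis mult_div_mod_eq)
    moreover have m: "(8 * u + v) mod 8 = v mod 8" "(8 * u + v) mod 4 = v mod 4" for u v :: nat
    proof -
      show "(8 * u + v) mod 8 = v mod 8" by simp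
      have "8 * u + v = 4 * (2 * u) + v" by simp
      then show "(8 * u + v) mod 4 = v mod 4" by (metis mod_mult_self4)
    qed
    moreover have m5: "(8 * u + 5 * v) mod 8 = 1 \<longleftrightarrow> v mod 8 \<noteq> 1" "(8 * u + 5 * v) mod 4 = 1"
      if "v mod 4 = 1" for u v :: nat
    proof -
      have "v mod 8 = 1 \<or> v mod 8 = 5" using that by presburger
      moreover have "(8 * u + 5 * v) mod 8 = (5 * (v mod 8)) mod 8" by (simp add: m mod_mult_right_eq)
      moreover have "(8 * u + 5 * v) mod 4 = (5 * (v mod 4)) mod 4" by (simp add: m mod_mult_right_eq)
      ultimately show "(8 * u + 5 * v) mod 8 = 1 \<longleftrightarrow> v mod 8 \<noteq> 1" "(8 * u + 5 * v) mod 4 = 1"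
        using that by auto
    qed
    moreover have P4: "\<Prod>Q mod 4 = 1" using insert by auto
    ultimately show ?case
    proof cases
      case 1
      then have *: "q * \<Prod>Q = 8 * (k * \<Prod>Q) + \<Prod>Q" by (simp add: algebra_simps)
      have "(q * \<Prod>Q) mod 8 = \<Prod>Q mod 8" "(q * \<Prod>Q) mod 4 = \<Prod>Q mod 4"
        unfolding * by (rule m)+
      then show ?thesis using insert 1 by auto
    next
      case 2
      then have *: "q * \<Prod>Q = 8 * (k * \<Prod>Q) + 5 * \<Prod>Q" by (simp add: algebra_simps)
      have "(q * \<Prod>Q) mod 8 = 1 \<longleftrightarrow> \<Prod>Q mod 8 \<noteq> 1" "(q * \<Prod>Q) mod 4 = 1"
        unfolding * by (intro m5 P4)+
      moreover have "odd ((q - 1) div 4)" using 2 by simp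
      ultimately show ?thesis using insert by auto
    qed
  qed simp
  from this[of "prime_factors D"]
  have "(\<Prod>q\<in>prime_factors D. (-1) ^ ((q - 1) div 4)) = (1::int)"
    using assms prime_factors_gt_2 by (simp add: cong_def prod_prime_factors_squarefree sqf)
  moreover have "Jacobi 2 D = (\<Prod>q\<in>prime_factors D. (-1) ^ ((q - 1) div 4))"
    unfolding Jacobi_def by (intro prod.cong refl Legendre_two) (use prime_factors_gt_2 in auto)
  ultimately show ?thesis by simp
qed

lemma Jacobi_eq_1:
  assumes "y \<noteq> 0" "\<And>l. prime l \<Longrightarrow> int l dvd y \<Longrightarrow> Jacobi (int l) D = 1"
  shows "Jacobi y D = 1"
proof -
  have one: "Jacobi 1 D = 1"
    unfolding Jacobi_def using prime_factors_gt_2 Legendre_square[of _ 1]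
    by (intro prod.neutral) force
  have "n \<noteq> 0 \<Longrightarrow> (\<And>l. prime l \<Longrightarrow> l dvd n \<Longrightarrow> Jacobi (int l) D = 1) \<Longrightarrow> Jacobi (int n) D = 1" for n :: nat
  proof (induction n rule: prime_divisors_induct)
    case (unit x)
    then show ?case using one by simp
  next
    case (factor l x)
    then show ?case using Jacobi_mult[of "int l" "int x"] by auto
  qed simp
  from this[of "nat \<bar>y\<bar>"] have "Jacobi \<bar>y\<bar> D = 1" using assms by auto
  then show ?thesis using Jacobi_minus[of y] by (cases "y \<ge> 0") auto
qed

text \<open>
  The arithmetic core. The symbol becomes the Jacobi symbol of \<open>y\<close>, which is evaluated prime by
  prime on \<open>y\<close>. At an odd prime \<open>l\<close> dividing \<open>y\<close>, \<open>D * x\<^sup>2\<close> is congruent to the square \<open>(2 * a\<^sup>2)\<^sup>2\<close>, and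
  coprimality of \<open>y\<close> and \<open>a\<close> keeps this square nonzero. The prime \<open>2\<close> contributes an even number of
  factors or satisfies \<open>Jacobi 2 D = 1\<close>.
\<close>
lemma quartic_symbol_eq_1:
  fixes A x y a :: int
  assumes eq: "int D * x\<^sup>2 - A * y\<^sup>2 = 4 * a ^ 4"
    and A: "[A = 1] (mod 4)" and "odd a" and cop: "coprime y a" "coprime (int D) a"
  shows "quartic_symbol A D = 1"
proof -
  have nda: "\<not> int q dvd a" if "q \<in> prime_factors D" for q
    using that cop(2) prime_factors_gt_2[OF that]
    by (metis coprime_common_divisor in_prime_factors_iff int_dvd_int_iff not_prime_unit prime_nat_int_transfer)
  have ndy: "\<not> int q dvd y" if "q \<in> prime_factors D" for q
  proof
    assume "int q dvd y"
    moreover have "int q dvd int D" using that by auto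
    ultimately have "int q dvd int D * x\<^sup>2 - A * y\<^sup>2" by (simp add: power2_eq_square)
    then have "int q dvd 4 * a ^ 4" using eq by simp
    moreover have "prime (int q)" using prime_factors_gt_2[OF that] by simp
    ultimately have "int q dvd 4" using nda[OF that] prime_dvd_mult_iff prime_dvd_power by blast
    then have "int q dvd 2 ^ 2" by simp
    then have "int q dvd 2" using \<open>prime (int q)\<close> prime_dvd_power by blast
    then show False using prime_factors_gt_2[OF that] by (auto dest: zdvd_imp_le)
  qed
  have "quartic_symbol A D = Jacobi y D"
    unfolding quartic_symbol_def Jacobi_def
  proof (intro prod.cong refl quartic_symbol_prime_eq_Legendre[of _ _ a])
    fix q assume q: "q \<in> prime_factors D"
    show "prime q" "[q = 1] (mod 4)" "\<not> int q dvd a" "\<not> int q dvd y"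
      using nda[OF q] ndy[OF q] prime_factors_gt_2[OF q] by auto
    have "int q dvd int D * x\<^sup>2" using q by auto
    then have "int q dvd A * y\<^sup>2 + 4 * a ^ 4" using eq by (simp add: algebra_simps)
    then show "[A * y\<^sup>2 = - 4 * a ^ 4] (mod int q)" by (simp add: cong_iff_dvd_diff)
  qed
  also have "Jacobi y D = 1"
  proof (cases "D = 1")
    case True
    then show ?thesis by (simp add: Jacobi_def)
  next
    case False
    then obtain q where "q \<in> prime_factors D"
      using sqf by (metis in_prime_factors_iff not_squarefree_0 prime_factor_nat)
    then have y0: "y \<noteq> 0" using ndy by auto
    have D0: "D \<noteq> 0" using sqf by (intro notI) simp
    have odd_l: "Jacobi (int l) D = 1" if l: "prime l" "l \<noteq> 2" "int l dvd y" for l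
    proof -
      have l2: "2 < l" using l prime_ge_2_nat[of l] by auto
      have pl: "prime (int l)" using l by simp
      have lD: "\<not> l dvd D" using l ndy[of l] D0 by (auto simp: in_prime_factors_iff)
      have la: "\<not> int l dvd a" using l cop(1) pl by (meson coprime_common_divisor not_prime_unit)
      have "[int D * x\<^sup>2 = (2 * a\<^sup>2)\<^sup>2] (mod int l)"
        using l(3) eq by (auto simp: cong_iff_dvd_diff power_mult_distrib power2_eq_square power4_eq_xxxx algebra_simps elim!: dvdE)
      moreover have l2a: "\<not> int l dvd 2 * a\<^sup>2"
        using la pl l2 by (auto simp: prime_dvd_mult_iff prime_dvd_power_iff dest: zdvd_imp_le)
      have "\<not> int l dvd (2 * a\<^sup>2)\<^sup>2" using l2a pl prime_dvd_power by blast
      ultimately have "\<not> int l dvd int D * x\<^sup>2" "Legendre (int D * x\<^sup>2) (int l) = Legendre ((2 * a\<^sup>2)\<^sup>2) (int l)"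
        by (auto simp: Legendre_def QuadRes_def cong_0_iff cong_dvd_iff dest: cong_trans cong_sym)
      moreover have "\<not> int l dvd x" using calculation by (auto simp: power2_eq_square)
      ultimately have "Legendre (int D) (int l) = 1"
        using Legendre_mult[OF l(1) l2, of "int D" "x\<^sup>2"] Legendre_square[OF l(1) l2, of x]
          Legendre_square[OF l(1) l2 l2a] by simp
      then show ?thesis using Jacobi_eq_Legendre[OF l(1) l2 lD] by simp
    qed
    have D4: "[int D = 1] (mod 4)"
    proof -
      have "[\<Prod>(prime_factors D) = (\<Prod>q\<in>prime_factors D. 1)] (mod 4)"
        by (intro cong_prod) (use prime_factors_gt_2 in auto)
      then show ?thesis using cong_int_iff[of D 1 4]
        by (simp add: prod_prime_factors_squarefree sqf)
    qed
    consider "odd y" | y' where "y = 2 * 2 * y'" "odd y'" | "[D = 1] (mod 8)"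
      using two_adic_cases[OF eq _ _ \<open>odd a\<close>] D4 A cong_int_iff[of D 1 8]
      by (auto simp: cong_def)
    moreover have odd_divisor: "Jacobi z D = 1" if "odd z" "z dvd y" for z
    proof (rule Jacobi_eq_1)
      show "z \<noteq> 0" using that y0 by auto
      fix l assume l: "prime l" "int l dvd z"
      then have "l \<noteq> 2" using that(1) by auto
      then show "Jacobi (int l) D = 1" using odd_l l that(2) dvd_trans by blast
    qed
    ultimately show ?thesis
    proof cases
      case 1
      then show ?thesis using odd_divisor by simp
    next
      case 2
      have "Jacobi y' D = 1" using 2 odd_divisor by simp
      moreover have "Jacobi 2 D * Jacobi 2 D = 1"
      proof -
        have "Legendre 2 (int q) * Legendre 2 (int q) = 1" if "q \<in> prime_factors D" for q
        proof -
          note q = prime_factors_gt_2[OF that]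
          then have "\<not> int q dvd 2" by (auto dest!: zdvd_imp_le)
          then show ?thesis using Legendre_unit[of q 2] q by auto
        qed
        then show ?thesis unfolding Jacobi_def prod.distrib[symmetric] by simp
      qed
      ultimately show ?thesis unfolding 2(1) Jacobi_mult by simp
    next
      case 3
      show ?thesis
      proof (rule Jacobi_eq_1[OF y0])
        fix l assume l: "prime l" "int l dvd y"
        show "Jacobi (int l) D = 1"
          using odd_l[OF l(1) _ l(2)] Jacobi_two[OF 3] by (cases "l = 2") auto
      qed
    qed
  qed
  finally show ?thesis .
qed

end

section \<open>Counting in elementary abelian 2-groups\<close>

lemma card_F2_vectorspace:
  assumes "vectorspace F2 V" "finite (carrier V)"
  shows "card (carrier V) = 2 ^ vectorspace.dim F2 V"
proof -
  interpret vectorspace F2 V by fact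
  have "span (carrier V) = carrier V"
    using in_own_span[of "carrier V"] span_is_subset2[of "carrier V"] by auto
  then have "fin_dim" unfolding fin_dim_def using assms(2) by blast
  then obtain B where B: "finite B" "basis B" using finite_basis_exists by blast
  have BV: "B \<subseteq> carrier V" using B(2) by (simp add: basis_def)
  have "\<forall>v\<in>carrier V. \<exists>!a. a \<in> B \<rightarrow>\<^sub>E carrier F2 \<and> lincomb a B = v"
    using basis_criterion[OF B(1) BV] B(2) by blast
  moreover have "lincomb a B \<in> carrier V" if "a \<in> B \<rightarrow>\<^sub>E carrier F2" for a
    using that BV by (intro lincomb_closed) (auto simp: PiE_def)
  ultimately have "bij_betw (\<lambda>a. lincomb a B) (B \<rightarrow>\<^sub>E carrier F2) (carrier V)"
    by (intro bij_betw_imageI inj_onI) (metis, blast)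
  then have "card (carrier V) = card (B \<rightarrow>\<^sub>E carrier F2)"
    by (simp add: bij_betw_same_card)
  also have "\<dots> = 2 ^ card B"
    using B(1) by (simp add: card_PiE residue_ring_def)
  also have "card B = dim" using B dim_basis by simp
  finally show ?thesis .
qed

text \<open>
  Both sides compare with the squaring homomorphism: its image is the group divided out on the left
  and its kernel is the set on the right.
\<close>
lemma card_quotient_by_squares:
  fixes G (structure)
  assumes "comm_group G" "finite (carrier G)"
  shows "card (rcosets\<^bsub>G\<^esub> (powers G 2)) = card {x \<in> carrier G. x \<otimes>\<^bsub>G\<^esub> x = \<one>\<^bsub>G\<^esub>}"
proof -
  interpret comm_group G by fact
  let ?sq = "\<lambda>x. x [^] (2::nat)"
  interpret sq: group_hom G G ?sq
    by unfold_locales (auto simp: hom_def nat_pow_distrib)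
  have img: "subgroup (powers G 2) G"
    unfolding powers_def using sq.img_is_subgroup by simp
  interpret onto: group_hom G "G\<lparr>carrier := powers G 2\<rparr>" ?sq
    by (intro group_hom.intro group_hom_axioms.intro subgroup_imp_group img is_group)
       (auto simp: hom_def nat_pow_distrib powers_def)
  have "kernel G (G\<lparr>carrier := powers G 2\<rparr>) ?sq = kernel G G ?sq"
    by (simp add: kernel_def)
  then have "card (rcosets (kernel G G ?sq)) = card (powers G 2)"
    using onto.FactGroup_iso_set
    by (auto simp: iso_def FactGroup_def powers_def dest!: bij_betw_same_card)
  then have "card (powers G 2) * card (kernel G G ?sq) = card (rcosets\<^bsub>G\<^esub> (powers G 2)) * card (powers G 2)"
    using lagrange[OF img] lagrange[OF sq.subgroup_kernel] by simp
  moreover have "card (powers G 2) > 0"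
    using img assms(2) by (metis card_gt_0_iff subgroup.finite_imp_card_positive)
  moreover have "kernel G G ?sq = {x \<in> carrier G. x \<otimes>\<^bsub>G\<^esub> x = \<one>\<^bsub>G\<^esub>}"
    by (auto simp: kernel_def numeral_2_eq_2)
  ultimately show ?thesis by simp
qed

lemma subgroup_powers:
  fixes G (structure)
  assumes "comm_group G" shows "subgroup (powers G n) G"
proof -
  interpret comm_group G by fact
  interpret group_hom G G "\<lambda>x. x [^] n"
    by unfold_locales (auto simp: hom_def nat_pow_distrib)
  show ?thesis unfolding powers_def by (rule img_is_subgroup)
qed

text \<open>
  The eighth powers are the squares of the fourth powers, so \<open>card_quotient_by_squares\<close> applies to the
  group of fourth powers.
\<close>
lemma two_power_eight_rank:
  fixes G (structure)
  assumes "comm_group G" "finite (carrier G)"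
  shows "2 ^ eight_rank G = card {x \<in> powers G 4. x \<otimes>\<^bsub>G\<^esub> x = \<one>\<^bsub>G\<^esub>}"
proof -
  interpret comm_group G by fact
  let ?H = "G\<lparr>carrier := powers G 4\<rparr>"
  have sub4: "subgroup (powers G 4) G" by (rule subgroup_powers) fact
  have H: "comm_group ?H"
    by (intro group.group_comm_groupI subgroup_imp_group sub4)
       (use subgroup.mem_carrier[OF sub4] m_comm in auto)
  interpret H: comm_group ?H by (rule H)
  have P4: "powers G 4 \<subseteq> carrier G" by (auto simp: powers_def)
  then have fin: "finite (powers G 4)" using assms(2) finite_subset by blast
  have pow: "x [^]\<^bsub>?H\<^esub> n = x [^] n" for x and n :: nat
    by (simp add: nat_pow_def)
  have P8: "powers G 8 = powers ?H 2"
    unfolding powers_def[of ?H] pow by (auto simp: powers_def image_image nat_pow_pow intro!: image_cong)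
  have sub: "subgroup (powers ?H 2) ?H" by (rule subgroup_powers[OF H])
  let ?Q = "?H Mod powers ?H 2"
  have Q: "comm_group ?Q" by (rule H.abelian_FactGroup[OF sub])
  interpret nrm: normal "powers ?H 2" ?H by (rule H.subgroup_imp_normal[OF sub])
  have "X \<otimes>\<^bsub>?Q\<^esub> X = \<one>\<^bsub>?Q\<^esub>" if "X \<in> carrier ?Q" for X
  proof -
    from that obtain x where x: "x \<in> powers G 4" "X = powers ?H 2 #>\<^bsub>?H\<^esub> x"
      by (auto simp: FactGroup_def RCOSETS_def)
    have "X \<otimes>\<^bsub>?Q\<^esub> X = powers ?H 2 #>\<^bsub>?H\<^esub> (x \<otimes> x)"
      using nrm.rcos_sum[of x x] x by (simp add: FactGroup_def)
    also have "\<dots> = powers ?H 2"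
    proof (rule H.coset_join2[OF _ sub])
      have "x \<otimes> x = x [^]\<^bsub>?H\<^esub> (2::nat)" using x P4 by (auto simp: pow numeral_2_eq_2)
      then show "x \<otimes> x \<in> powers ?H 2" using x by (auto simp: powers_def)
      show "x \<otimes> x \<in> carrier ?H" using H.m_closed[of x x] x by simp
    qed
    finally show ?thesis by (simp add: FactGroup_def)
  qed
  then have vs: "vectorspace F2 (F2_space ?Q)" by (rule vectorspace_F2_space[OF Q])
  have "finite (carrier (F2_space ?Q))"
    using fin H.rcosets_finite by (simp add: F2_space_def FactGroup_def RCOSETS_def)
  from card_F2_vectorspace[OF vs this]
  have "2 ^ eight_rank G = card (rcosets\<^bsub>?H\<^esub> (powers ?H 2))"
    by (simp add: eight_rank_def P8 F2_space_def FactGroup_def)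
  also have "\<dots> = card {x \<in> carrier ?H. x \<otimes>\<^bsub>?H\<^esub> x = \<one>\<^bsub>?H\<^esub>}"
    by (rule card_quotient_by_squares[OF H]) (use fin in simp)
  finally show ?thesis by simp
qed

text \<open>
  Cardinalities replace dimensions, so that no bases need to be compared.
\<close>
lemma card_le_two_power_isotropy_index:
  fixes G (structure)
  assumes "comm_group G" "finite (carrier G)"
    and sq: "\<And>x. x \<in> carrier G \<Longrightarrow> x \<otimes>\<^bsub>G\<^esub> x = \<one>\<^bsub>G\<^esub>"
    and W: "subgroup W G" and Q: "\<And>x. x \<in> W \<Longrightarrow> Q x = \<zero>\<^bsub>F2\<^esub>"
  shows "card W \<le> 2 ^ isotropy_index F2 (F2_space G) Q"
proof -
  let ?V = "F2_space G"
  interpret comm_group G by fact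
  interpret V: vectorspace F2 ?V by (rule vectorspace_F2_space) (use assms sq in auto)
  interpret W: subgroup W G by fact
  have c: "carrier F2 = {0, 1}" by (auto simp: residue_ring_def)
  have sm: "submodule F2 W ?V"
    unfolding submodule_def c using V.module_axioms W.subset W.mem_carrier
    by (auto simp: F2_space_def int_pow_one)
  then have sub: "VectorSpace.subspace F2 W ?V"
    unfolding VectorSpace.subspace_def using V.vectorspace_axioms by simp
  have "card W = 2 ^ vectorspace.dim F2 (?V\<lparr>carrier := W\<rparr>)"
    using card_F2_vectorspace[OF V.subspace_is_vs[OF sub]] assms(2) W.subset finite_subset by auto
  also have "vectorspace.dim F2 (?V\<lparr>carrier := W\<rparr>) \<le> isotropy_index F2 ?V Q"
    unfolding isotropy_index_def
  proof (rule Max_ge)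
    have "{vectorspace.dim F2 (?V\<lparr>carrier := W\<rparr>) | W. VectorSpace.subspace F2 W ?V \<and> (\<forall>x\<in>W. Q x = \<zero>\<^bsub>F2\<^esub>)}
      \<subseteq> (\<lambda>W. vectorspace.dim F2 (?V\<lparr>carrier := W\<rparr>)) ` Pow (carrier G)"
      by (auto simp: VectorSpace.subspace_def submodule_def F2_space_def)
    then show "finite {vectorspace.dim F2 (?V\<lparr>carrier := W\<rparr>) | W. VectorSpace.subspace F2 W ?V \<and> (\<forall>x\<in>W. Q x = \<zero>\<^bsub>F2\<^esub>)}"
      by (rule finite_subset) (use assms(2) in simp)
  qed (use sub Q in blast)
  finally show ?thesis by simp
qed

section \<open>The ideal class group of a domain\<close>

lemma (in cring) ideal_prod_PIdl:
  assumes "a \<in> carrier R" "ideal I R"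
  shows "ideal_prod R (PIdl a) I = (\<lambda>x. a \<otimes> x) ` I"
proof
  interpret I: ideal I R by fact
  show "ideal_prod R (PIdl a) I \<subseteq> (\<lambda>x. a \<otimes> x) ` I"
  proof
    fix s assume "s \<in> ideal_prod R (PIdl a) I"
    then show "s \<in> (\<lambda>x. a \<otimes> x) ` I"
    proof (induction rule: ideal_prod.induct)
      case (prod i j)
      then obtain x where "x \<in> carrier R" "i = x \<otimes> a" by (auto simp: cgenideal_def)
      then have "i \<otimes> j = a \<otimes> (x \<otimes> j)" "x \<otimes> j \<in> I"
        using assms prod I.Icarr I.I_l_closed by (auto simp: m_ac)
      then show ?case by blast
    next
      case (sum s1 s2)
      then obtain x y where "x \<in> I" "y \<in> I" "s1 = a \<otimes> x" "s2 = a \<otimes> y" by auto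
      then have "s1 \<oplus> s2 = a \<otimes> (x \<oplus> y)" "x \<oplus> y \<in> I" using assms I.Icarr by (auto simp: r_distr)
      then show ?case by blast
    qed
  qed
  show "(\<lambda>x. a \<otimes> x) ` I \<subseteq> ideal_prod R (PIdl a) I"
    using assms(1) cgenideal_self by (auto intro: ideal_prod.prod)
qed

lemma (in cring) ideal_prod_PIdl_PIdl:
  assumes "a \<in> carrier R" "b \<in> carrier R"
  shows "ideal_prod R (PIdl a) (PIdl b) = PIdl (a \<otimes> b)"
  using assms ideal_prod_PIdl[OF assms(1) cgenideal_ideal[OF assms(2)]]
  by (auto simp: cgenideal_def image_def m_ac)

context domain
begin

lemma nonzero_ideals_carrier: "carrier R \<in> nonzero_ideals R"
proof -
  have "carrier R \<noteq> {\<zero>}" using one_closed one_not_zero by (metis singletonD)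
  then show ?thesis by (simp add: nonzero_ideals_def oneideal)
qed

lemma nonzero_ideals_PIdl: "a \<in> carrier R \<Longrightarrow> a \<noteq> \<zero> \<Longrightarrow> PIdl a \<in> nonzero_ideals R"
  using cgenideal_self[of a] by (auto simp: nonzero_ideals_def cgenideal_ideal)

lemma nonzero_ideals_imp: "I \<in> nonzero_ideals R \<Longrightarrow> ideal I R"
  by (simp add: nonzero_ideals_def)

lemma nonzero_idealsE:
  assumes "I \<in> nonzero_ideals R"
  obtains x where "x \<in> I" "x \<in> carrier R" "x \<noteq> \<zero>"
proof -
  interpret ideal I R using assms by (rule nonzero_ideals_imp)
  show ?thesis using assms that a_subset zero_closed unfolding nonzero_ideals_def by blast
qed

lemma nonzero_ideals_prod:
  assumes "I \<in> nonzero_ideals R" "J \<in> nonzero_ideals R"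
  shows "I \<cdot> J \<in> nonzero_ideals R"
proof -
  obtain x y where "x \<in> I" "x \<in> carrier R" "x \<noteq> \<zero>" "y \<in> J" "y \<in> carrier R" "y \<noteq> \<zero>"
    using assms by (metis nonzero_idealsE)
  then have "x \<otimes> y \<in> I \<cdot> J" "x \<otimes> y \<noteq> \<zero>" by (auto intro: ideal_prod.prod simp: integral_iff)
  then show ?thesis using assms by (auto simp: nonzero_ideals_def ideal_prod_is_ideal)
qed

lemma PIdl_prod_cancel:
  assumes "a \<in> carrier R" "a \<noteq> \<zero>" "ideal I R" "ideal J R" "(PIdl a) \<cdot> I = (PIdl a) \<cdot> J"
  shows "I = J"
proof -
  have "inj_on (\<lambda>x. a \<otimes> x) (carrier R)" using assms by (auto simp: inj_on_def m_lcancel)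
  then show ?thesis
    using assms(5) ideal.Icarr[OF assms(3)] ideal.Icarr[OF assms(4)]
    unfolding ideal_prod_PIdl[OF assms(1,3)] ideal_prod_PIdl[OF assms(1,4)]
    by (meson inj_on_image_eq_iff subsetI)
qed

lemma ideal_class_rel_iff:
  "(I, J) \<in> ideal_class_rel R \<longleftrightarrow> I \<in> nonzero_ideals R \<and> J \<in> nonzero_ideals R \<and>
     (\<exists>a b. a \<in> carrier R \<and> a \<noteq> \<zero> \<and> b \<in> carrier R \<and> b \<noteq> \<zero> \<and> (PIdl a) \<cdot> I = (PIdl b) \<cdot> J)"
  by (auto simp: ideal_class_rel_def)

lemma iprod_lcomm: "ideal I R \<Longrightarrow> ideal J R \<Longrightarrow> ideal K R \<Longrightarrow> I \<cdot> (J \<cdot> K) = J \<cdot> (I \<cdot> K)"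
  by (metis ideal_prod_assoc ideal_prod_commute)

lemma iprod_interchange:
  assumes "ideal A R" "ideal B R" "ideal I R" "ideal J R"
  shows "(A \<cdot> B) \<cdot> (I \<cdot> J) = (A \<cdot> I) \<cdot> (B \<cdot> J)"
  using assms by (simp add: ideal_prod_assoc ideal_prod_is_ideal iprod_lcomm[of B I J])

lemma equiv_ideal_class_rel: "equiv (nonzero_ideals R) (ideal_class_rel R)"
proof (rule equivI)
  show "ideal_class_rel R \<subseteq> nonzero_ideals R \<times> nonzero_ideals R" by (auto simp: ideal_class_rel_def)
  show "refl_on (nonzero_ideals R) (ideal_class_rel R)"
    unfolding refl_on_def ideal_class_rel_iff using one_closed one_not_zero by blast
  show "sym (ideal_class_rel R)"
    unfolding sym_def ideal_class_rel_iff by metis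
  show "trans (ideal_class_rel R)"
  proof (rule transI)
    fix I J K assume "(I, J) \<in> ideal_class_rel R" "(J, K) \<in> ideal_class_rel R"
    then obtain a b c d where *: "I \<in> nonzero_ideals R" "J \<in> nonzero_ideals R" "K \<in> nonzero_ideals R"
      "a \<in> carrier R" "a \<noteq> \<zero>" "b \<in> carrier R" "b \<noteq> \<zero>" "(PIdl a) \<cdot> I = (PIdl b) \<cdot> J"
      "c \<in> carrier R" "c \<noteq> \<zero>" "d \<in> carrier R" "d \<noteq> \<zero>" "(PIdl c) \<cdot> J = (PIdl d) \<cdot> K"
      unfolding ideal_class_rel_iff by blast
    note i = nonzero_ideals_imp[OF *(1)] nonzero_ideals_imp[OF *(2)] nonzero_ideals_imp[OF *(3)]
    note p = cgenideal_ideal[OF *(4)] cgenideal_ideal[OF *(6)] cgenideal_ideal[OF *(9)] cgenideal_ideal[OF *(11)]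
    have "(PIdl (c \<otimes> a)) \<cdot> I = (PIdl c) \<cdot> ((PIdl a) \<cdot> I)"
      using * i p by (simp add: ideal_prod_assoc flip: ideal_prod_PIdl_PIdl)
    also have "\<dots> = (PIdl b) \<cdot> ((PIdl c) \<cdot> J)" using * i p by (simp add: iprod_lcomm)
    also have "\<dots> = (PIdl (b \<otimes> d)) \<cdot> K"
      using * i p by (simp add: ideal_prod_assoc flip: ideal_prod_PIdl_PIdl)
    finally show "(I, K) \<in> ideal_class_rel R"
      unfolding ideal_class_rel_iff using * by (metis integral_iff m_closed)
  qed
qed

lemma ideal_class_eq_iff:
  assumes "I \<in> nonzero_ideals R" "J \<in> nonzero_ideals R"
  shows "ideal_class R I = ideal_class R J \<longleftrightarrow>
    (\<exists>a b. a \<in> carrier R \<and> a \<noteq> \<zero> \<and> b \<in> carrier R \<and> b \<noteq> \<zero> \<and> (PIdl a) \<cdot> I = (PIdl b) \<cdot> J)"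
  unfolding ideal_class_def eq_equiv_class_iff[OF equiv_ideal_class_rel assms]
  using assms by (simp add: ideal_class_rel_iff)

lemma class_group_carrier: "carrier (class_group R) = ideal_class R ` nonzero_ideals R"
  by (auto simp: class_group_def quotient_def ideal_class_def)

lemma class_group_one: "\<one>\<^bsub>class_group R\<^esub> = ideal_class R (carrier R)"
  by (simp add: class_group_def)

lemma class_group_mult:
  assumes I: "I \<in> nonzero_ideals R" and J: "J \<in> nonzero_ideals R"
  shows "ideal_class R I \<otimes>\<^bsub>class_group R\<^esub> ideal_class R J = ideal_class R (I \<cdot> J)"
proof -
  have eq: "ideal_class R (I' \<cdot> J') = ideal_class R (I \<cdot> J)"
    if "I' \<in> ideal_class R I" "J' \<in> ideal_class R J" for I' J'
  proof -
    from that have "(I, I') \<in> ideal_class_rel R" "(J, J') \<in> ideal_class_rel R"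
      by (auto simp: ideal_class_def)
    then obtain a b c d where *: "I' \<in> nonzero_ideals R" "J' \<in> nonzero_ideals R"
      "a \<in> carrier R" "a \<noteq> \<zero>" "b \<in> carrier R" "b \<noteq> \<zero>" "(PIdl a) \<cdot> I = (PIdl b) \<cdot> I'"
      "c \<in> carrier R" "c \<noteq> \<zero>" "d \<in> carrier R" "d \<noteq> \<zero>" "(PIdl c) \<cdot> J = (PIdl d) \<cdot> J'"
      unfolding ideal_class_rel_iff by blast
    note i = nonzero_ideals_imp[OF *(1)] nonzero_ideals_imp[OF *(2)] nonzero_ideals_imp[OF I] nonzero_ideals_imp[OF J]
    note p = cgenideal_ideal[OF *(3)] cgenideal_ideal[OF *(5)] cgenideal_ideal[OF *(8)] cgenideal_ideal[OF *(10)]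
    have eq: "(PIdl (a \<otimes> c)) \<cdot> (I \<cdot> J) = (PIdl (b \<otimes> d)) \<cdot> (I' \<cdot> J')"
      using iprod_interchange[OF p(1,3) i(3,4)] iprod_interchange[OF p(2,4) i(1,2)]
      by (simp add: * flip: ideal_prod_PIdl_PIdl)
    moreover have "a \<otimes> c \<in> carrier R" "a \<otimes> c \<noteq> \<zero>" "b \<otimes> d \<in> carrier R" "b \<otimes> d \<noteq> \<zero>"
      using * by (auto simp: integral_iff)
    ultimately show ?thesis
      by (subst eq_commute, subst ideal_class_eq_iff) (use * I J nonzero_ideals_prod in blast)+
  qed
  have "I \<in> ideal_class R I" "J \<in> ideal_class R J"
    using I J equiv_class_self[OF equiv_ideal_class_rel] by (auto simp: ideal_class_def)
  then have "(\<Union>I\<in>ideal_class R I. \<Union>J\<in>ideal_class R J. ideal_class R (I \<cdot> J)) = ideal_class R (I \<cdot> J)"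
    using eq by blast
  then show ?thesis by (simp add: class_group_def)
qed

lemma ideal_class_principal:
  assumes "a \<in> carrier R" "a \<noteq> \<zero>"
  shows "ideal_class R (PIdl a) = \<one>\<^bsub>class_group R\<^esub>"
proof -
  have "(PIdl \<one>) \<cdot> (PIdl a) = (PIdl a) \<cdot> carrier R"
    using assms by (simp add: ideal_prod_PIdl_PIdl ideal_prod_one cgenideal_ideal)
  then show ?thesis
    using assms nonzero_ideals_PIdl[OF assms] nonzero_ideals_carrier one_closed one_not_zero
    unfolding class_group_one by (subst ideal_class_eq_iff) blast+
qed

lemma ideal_class_eq_one_iff:
  assumes "I \<in> nonzero_ideals R"
  shows "ideal_class R I = \<one>\<^bsub>class_group R\<^esub> \<longleftrightarrow> (\<exists>a\<in>carrier R. a \<noteq> \<zero> \<and> I = PIdl a)"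
proof
  assume "ideal_class R I = \<one>\<^bsub>class_group R\<^esub>"
  then obtain x y where xy: "x \<in> carrier R" "x \<noteq> \<zero>" "y \<in> carrier R" "y \<noteq> \<zero>" "(PIdl x) \<cdot> I = (PIdl y) \<cdot> carrier R"
    unfolding class_group_one using ideal_class_eq_iff[OF assms nonzero_ideals_carrier] by auto
  have "(PIdl x) \<cdot> I = PIdl y" using xy by (simp add: ideal_prod_one cgenideal_ideal)
  then have "y \<in> (PIdl x) \<cdot> I" using cgenideal_self xy by blast
  then obtain a where a: "a \<in> I" "y = x \<otimes> a"
    using ideal_prod_PIdl[OF xy(1) nonzero_ideals_imp[OF assms]] by auto
  have aR: "a \<in> carrier R" by (rule ideal.Icarr[OF nonzero_ideals_imp[OF assms] a(1)])
  have "(PIdl x) \<cdot> (PIdl a) = PIdl y" unfolding a(2) by (rule ideal_prod_PIdl_PIdl[OF xy(1) aR])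
  then have "(PIdl x) \<cdot> I = (PIdl x) \<cdot> (PIdl a)" using \<open>(PIdl x) \<cdot> I = PIdl y\<close> by simp
  then have "I = PIdl a"
    by (rule PIdl_prod_cancel[OF xy(1,2) nonzero_ideals_imp[OF assms] cgenideal_ideal[OF aR]])
  moreover have "a \<noteq> \<zero>" using a(2) xy(1,4) by (metis r_null)
  ultimately show "\<exists>a\<in>carrier R. a \<noteq> \<zero> \<and> I = PIdl a" using aR by blast
qed (use ideal_class_principal in blast)

text \<open>
  The only group axiom that can fail over a general domain is the existence of inverses, which is
  supplied by the assumption.
\<close>
lemma comm_group_class_group:
  assumes inv: "\<And>I. I \<in> nonzero_ideals R \<Longrightarrow>
    \<exists>J\<in>nonzero_ideals R. \<exists>a\<in>carrier R. a \<noteq> \<zero> \<and> I \<cdot> J = PIdl a"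
  shows "comm_group (class_group R)"
proof (rule comm_groupI)
  let ?C = "class_group R"
  fix x y z assume "x \<in> carrier ?C" "y \<in> carrier ?C"
  then obtain I J where IJ: "I \<in> nonzero_ideals R" "J \<in> nonzero_ideals R" "x = ideal_class R I" "y = ideal_class R J"
    by (auto simp: class_group_carrier)
  show "x \<otimes>\<^bsub>?C\<^esub> y \<in> carrier ?C" using IJ nonzero_ideals_prod by (simp add: class_group_mult class_group_carrier)
  show "x \<otimes>\<^bsub>?C\<^esub> y = y \<otimes>\<^bsub>?C\<^esub> x"
    using IJ by (simp add: class_group_mult nonzero_ideals_imp ideal_prod_commute)
  assume "z \<in> carrier ?C"
  then obtain K where "K \<in> nonzero_ideals R" "z = ideal_class R K" by (auto simp: class_group_carrier)
  then show "x \<otimes>\<^bsub>?C\<^esub> y \<otimes>\<^bsub>?C\<^esub> z = x \<otimes>\<^bsub>?C\<^esub> (y \<otimes>\<^bsub>?C\<^esub> z)"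
    using IJ by (simp add: class_group_mult nonzero_ideals_prod ideal_prod_assoc nonzero_ideals_imp)
next
  let ?C = "class_group R"
  show "\<one>\<^bsub>?C\<^esub> \<in> carrier ?C" using nonzero_ideals_carrier by (simp add: class_group_one class_group_carrier)
  fix x assume "x \<in> carrier ?C"
  then obtain I where I: "I \<in> nonzero_ideals R" "x = ideal_class R I" by (auto simp: class_group_carrier)
  show "\<one>\<^bsub>?C\<^esub> \<otimes>\<^bsub>?C\<^esub> x = x"
    using I nonzero_ideals_carrier ideal_prod_commute[OF oneideal nonzero_ideals_imp[OF I(1)]]
    by (simp add: class_group_one class_group_mult ideal_prod_one nonzero_ideals_imp)
  obtain J a where "J \<in> nonzero_ideals R" "a \<in> carrier R" "a \<noteq> \<zero>" "I \<cdot> J = PIdl a" using inv[OF I(1)] by blast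
  then show "\<exists>y\<in>carrier ?C. y \<otimes>\<^bsub>?C\<^esub> x = \<one>\<^bsub>?C\<^esub>"
    using I ideal_prod_commute[of I J] nonzero_ideals_imp
    by (intro bexI[of _ "ideal_class R J"]) (auto simp: class_group_mult ideal_class_principal class_group_carrier)
qed

end

section \<open>Integrality and coprimality\<close>

lemma int_subgroup_principal:
  fixes S :: "int set"
  assumes diff: "\<And>x y. x \<in> S \<Longrightarrow> y \<in> S \<Longrightarrow> x - y \<in> S" and "x \<in> S" "x \<noteq> 0"
  obtains d where "d > 0" "d \<in> S" "\<And>y. y \<in> S \<Longrightarrow> d dvd y"
proof -
  have zero: "0 \<in> S" using diff[OF assms(2,2)] by simp
  have neg: "- y \<in> S" if "y \<in> S" for y using diff[OF zero that] by simp
  have add: "y + z \<in> S" if "y \<in> S" "z \<in> S" for y z using diff[OF that(1) neg[OF that(2)]] by simp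
  have muln: "int n * y \<in> S" if "y \<in> S" for n y
    by (induction n) (use zero add that in \<open>auto simp: algebra_simps\<close>)
  have mul: "k * y \<in> S" if "y \<in> S" for k y
    using muln[OF that, of "nat \<bar>k\<bar>"] neg[of "\<bar>k\<bar> * y"] by (cases "k \<ge> 0") auto
  let ?P = "\<lambda>n. n > 0 \<and> int n \<in> S"
  have "?P (nat \<bar>x\<bar>)" using assms neg by (cases "x \<ge> 0") auto
  then have L: "?P (LEAST n. ?P n)" by (rule LeastI)
  define d where "d = int (LEAST n. ?P n)"
  have d: "d > 0" "d \<in> S" using L by (auto simp: d_def)
  have "d dvd y" if "y \<in> S" for y
  proof -
    have "y mod d = y - (y div d) * d" by (simp add: minus_div_mult_eq_mod)
    then have "y mod d \<in> S" using diff[OF that mul[OF d(2)]] by simp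
    moreover have "y mod d \<ge> 0" "y mod d < d" using d by auto
    ultimately have "\<not> y mod d > 0"
      using not_less_Least[of "nat (y mod d)" ?P] d_def by (auto simp: nat_less_iff)
    then show ?thesis using \<open>y mod d \<ge> 0\<close> by (simp add: dvd_eq_mod_eq_0)
  qed
  then show ?thesis using that d by blast
qed

lemma int_coprimeI:
  fixes x y :: int
  assumes "\<And>p. prime p \<Longrightarrow> p dvd x \<Longrightarrow> p dvd y \<Longrightarrow> False" "y \<noteq> 0"
  shows "coprime x y"
proof (rule ccontr)
  assume "\<not> coprime x y"
  then have "\<not> is_unit (gcd x y)" by (simp add: coprime_iff_gcd_eq_1)
  then obtain p where "prime p" "p dvd gcd x y" using assms(2) prime_divisor_exists[of "gcd x y"] by auto
  then show False using assms(1) by auto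
qed

text \<open>
  A primitive quadratic polynomial is nonzero modulo \<open>p\<close> at \<open>0\<close>, \<open>1\<close> or \<open>2\<close> for every odd prime \<open>p\<close>,
  because it cannot have three roots; the second assumption treats \<open>p = 2\<close>. The local choices are
  combined by the Chinese remainder theorem.
\<close>
lemma coprime_quadratic_value:
  fixes a b c M :: int
  assumes prim: "\<And>p. prime p \<Longrightarrow> p dvd a \<Longrightarrow> p dvd b \<Longrightarrow> p dvd c \<Longrightarrow> False"
    and two: "odd c \<or> odd (a + b + c)" and "M \<noteq> 0"
  shows "\<exists>k. coprime (a * k\<^sup>2 + b * k + c) M"
proof -
  let ?f = "\<lambda>k. a * k\<^sup>2 + b * k + c"
  define P where "P = {p::nat. prime p \<and> int p dvd M}"
  have finP: "finite P"
  proof (rule finite_subset)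
    show "P \<subseteq> {..nat \<bar>M\<bar>}"
    proof
      fix p assume "p \<in> P"
      then have "int p dvd M" by (simp add: P_def)
      from dvd_imp_le_int[OF \<open>M \<noteq> 0\<close> this] show "p \<in> {..nat \<bar>M\<bar>}" by simp
    qed
  qed simp
  have "\<exists>k::nat. \<not> int p dvd ?f (int k)" if "p \<in> P" for p
  proof (rule ccontr)
    assume "\<nexists>k. \<not> int p dvd ?f (int k)"
    then have *: "int p dvd ?f (int k)" for k by blast
    have c: "int p dvd c" using *[of 0] by simp
    have abc: "int p dvd a + b + c" using *[of 1] by simp
    then have ab: "int p dvd a + b" using c by (metis dvd_add_left_iff)
    have "int p dvd ?f 2 - c - 2 * (a + b)" using *[of 2] c dvd_mult[OF ab, of 2] by (intro dvd_diff) simp_all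
    then have "int p dvd 2 * a" by (simp add: power2_eq_square algebra_simps)
    moreover have "prime (int p)" using that by (simp add: P_def)
    moreover have "\<not> int p dvd 2"
    proof
      assume "int p dvd 2"
      then have "p = 2" using \<open>prime (int p)\<close> primes_dvd_imp_eq[of "int p" 2] by auto
      then show False using c abc two by auto
    qed
    ultimately have a: "int p dvd a" using prime_dvd_mult_iff by blast
    then have "int p dvd b" using ab by (metis dvd_add_right_iff)
    then show False using prim[OF \<open>prime (int p)\<close> a _ c] by blast
  qed
  then obtain u where u: "\<And>p. p \<in> P \<Longrightarrow> \<not> int p dvd ?f (int (u p))" by metis
  obtain x where x: "\<And>p. p \<in> P \<Longrightarrow> [x = u p] (mod p)"
    using chinese_remainder_nat[OF finP, of "\<lambda>p. p" u] by (auto simp: P_def primes_coprime)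
  have "coprime (?f (int x)) M"
  proof (rule int_coprimeI)
    fix p assume p: "prime p" "p dvd ?f (int x)" "p dvd M"
    define q where "q = nat p"
    have q: "p = int q" "q \<in> P" using p prime_ge_0_int[of p] by (auto simp: q_def P_def)
    have "[int x = int (u q)] (mod int q)" using x[OF q(2)] by (simp add: cong_int_iff)
    then have "[?f (int x) = ?f (int (u q))] (mod int q)" by (intro cong_add cong_mult cong_pow cong_refl)
    then have "int q dvd ?f (int (u q))" using p(2) unfolding q(1) by (simp add: cong_dvd_iff)
    then show False using u[OF q(2)] by blast
  qed (use \<open>M \<noteq> 0\<close> in simp)
  then show ?thesis by blast
qed

lemma dvd_two_mult_iff: "odd D \<Longrightarrow> D dvd 2 * x \<longleftrightarrow> D dvd x" for D x :: int
  by (simp add: coprime_dvd_mult_right_iff)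

lemma rat_coprime_fraction:
  fixes r :: rat
  obtains c d :: int where "d > 0" "coprime c d" "r = of_int c / of_int d"
  by (cases r) (auto simp: Fract_of_int_quotient)

text \<open>
  A denominator \<open>d > 1\<close> would have arbitrarily high powers \<open>d ^ k\<close> dividing \<open>W\<close>.
\<close>
lemma rat_integral_if_powers_bounded:
  fixes r :: rat and W :: int
  assumes "W > 0" "\<And>k. of_int W * r ^ k \<in> \<int>"
  shows "r \<in> \<int>"
proof -
  obtain c d :: int where cd: "d > 0" "coprime c d" "r = of_int c / of_int d"
    by (rule rat_coprime_fraction)
  define k where "k = nat W"
  obtain z where "of_int W * r ^ k = of_int z" using assms(2)[of k] by (auto elim: Ints_cases)
  then have "of_int (W * c ^ k) = (of_int (z * d ^ k) :: rat)"
    using cd by (simp add: field_simps power_divide)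
  then have "W * c ^ k = z * d ^ k" by (simp only: of_int_eq_iff)
  then have "d ^ k dvd W * c ^ k" by simp
  moreover have "coprime (d ^ k) (c ^ k)" using cd(2) by (simp add: coprime_commute)
  ultimately have "d ^ k dvd W" by (simp add: coprime_dvd_mult_left_iff)
  then have "d ^ k \<le> W" using assms(1) by (rule zdvd_imp_le)
  have "d = 1"
  proof (rule ccontr)
    assume "d \<noteq> 1"
    then have "2 ^ k \<le> d ^ k" using cd(1) by (intro power_mono) auto
    moreover have "int k < 2 ^ k" using of_nat_less_two_power[of k, where 'a = int] by simp
    ultimately show False using \<open>d ^ k \<le> W\<close> assms(1) by (simp add: k_def)
  qed
  then show ?thesis using cd by simp
qed

lemma rat_integral_if_squarefree_mult_square:
  fixes r :: rat and D :: int
  assumes "squarefree D" "of_int D * r\<^sup>2 \<in> \<int>"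
  shows "r \<in> \<int>"
proof -
  obtain c d :: int where cd: "d > 0" "coprime c d" "r = of_int c / of_int d"
    by (rule rat_coprime_fraction)
  obtain z where "of_int D * r\<^sup>2 = of_int z" using assms(2) by (auto elim: Ints_cases)
  then have "of_int (D * c\<^sup>2) = (of_int (z * d\<^sup>2) :: rat)"
    using cd by (simp add: field_simps power_divide)
  then have "D * c\<^sup>2 = z * d\<^sup>2" by (simp only: of_int_eq_iff)
  then have "d\<^sup>2 dvd D * c\<^sup>2" by simp
  moreover have "coprime (d\<^sup>2) (c\<^sup>2)" using cd(2) by (simp add: coprime_commute)
  ultimately have "d\<^sup>2 dvd D" by (simp add: coprime_dvd_mult_left_iff)
  then have "d dvd 1" using assms(1) squarefreeD by blast
  then show ?thesis using cd by simp
qed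

lemma cnj_of_rat: "cnj (of_rat r) = of_rat r"
proof -
  obtain c d :: int where "r = of_int c / of_int d" by (rule rat_coprime_fraction)
  then show ?thesis by (simp add: of_rat_divide)
qed

section \<open>The ring of integers of an imaginary quadratic field\<close>

locale imaginary_quadratic =
  fixes \<Delta> :: int
  assumes neg: "\<Delta> < 0" and mod4: "\<Delta> mod 4 = 1" and sqf: "squarefree \<Delta>"
begin

abbreviation R :: "complex ring" where "R \<equiv> quad_ints \<Delta>"

text \<open>The norm of \<open>\<omega>\<close>.\<close>
definition m :: int where "m = (1 - \<Delta>) div 4"

definition \<omega> :: complex where "\<omega> = (1 + csqrt (of_int \<Delta>)) / 2"

definition E :: "int \<Rightarrow> int \<Rightarrow> complex" where "E u v = of_int u + of_int v * \<omega>"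

lemma four_m: "4 * m = 1 - \<Delta>"
  using mod4 unfolding m_def by presburger

lemma csqrt_\<Delta>: "csqrt (of_int \<Delta>) = \<i> * of_real (sqrt (of_int (- \<Delta>)))"
  using neg csqrt_of_real_nonpos[of "of_int \<Delta>"] by simp

lemma \<omega>_square: "\<omega> * \<omega> = \<omega> - of_int m"
proof -
  have "of_int (4 * m) = (of_int (1 - \<Delta>) :: complex)" by (simp only: four_m)
  then have m: "of_int m = (1 - of_int \<Delta>) / (4 :: complex)" by (simp add: eq_divide_eq mult.commute)
  have "csqrt (of_int \<Delta>) * csqrt (of_int \<Delta>) = of_int \<Delta>" by (metis power2_csqrt power2_eq_square)
  then show ?thesis unfolding \<omega>_def m by (simp add: field_simps)
qed

lemma cnj_\<omega>: "cnj \<omega> = 1 - \<omega>"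
  unfolding \<omega>_def csqrt_\<Delta> by (simp add: field_simps)

lemma Im_\<omega>: "Im \<omega> > 0"
  unfolding \<omega>_def csqrt_\<Delta> using neg by simp

lemma E_add: "E u v + E u' v' = E (u + u') (v + v')"
  by (simp add: E_def algebra_simps)

lemma E_minus: "- E u v = E (- u) (- v)"
  by (simp add: E_def)

lemma E_mult: "E u v * E u' v' = E (u * u' - m * v * v') (u * v' + v * u' + v * v')"
proof -
  have "E u v * E u' v' = of_int (u * u') + of_int (u * v' + v * u') * \<omega> + of_int (v * v') * (\<omega> * \<omega>)"
    by (simp add: E_def algebra_simps)
  also have "\<dots> = E (u * u' - m * v * v') (u * v' + v * u' + v * v')"
    unfolding \<omega>_square by (simp add: E_def algebra_simps)
  finally show ?thesis .
qed

lemma cnj_E: "cnj (E u v) = E (u + v) (- v)"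
  by (simp add: E_def cnj_\<omega> algebra_simps)

lemma E_eq_iff: "E u v = E u' v' \<longleftrightarrow> u = u' \<and> v = v'"
proof
  assume "E u v = E u' v'"
  then have "Im (E u v) = Im (E u' v')" "Re (E u v) = Re (E u' v')" by auto
  then show "u = u' \<and> v = v'" using Im_\<omega> by (auto simp: E_def)
qed auto

lemma of_int_E: "of_int n = E n 0"
  by (simp add: E_def)

lemma E_eq_0_iff: "E u v = 0 \<longleftrightarrow> u = 0 \<and> v = 0"
  using E_eq_iff[of u v 0 0] by (simp add: E_def)

lemma E_norm: "E u v * cnj (E u v) = of_int (u\<^sup>2 + u * v + m * v\<^sup>2)"
  unfolding cnj_E E_mult of_int_E by (simp add: E_eq_iff algebra_simps power2_eq_square)

lemma norm_pos:
  assumes "u \<noteq> 0 \<or> v \<noteq> 0"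
  shows "u\<^sup>2 + u * v + m * v\<^sup>2 > 0"
proof -
  have "4 * (u\<^sup>2 + u * v + m * v\<^sup>2) = (2 * u + v)\<^sup>2 + (4 * m - 1) * v\<^sup>2"
    by (simp add: power2_eq_square algebra_simps)
  also have "\<dots> = (2 * u + v)\<^sup>2 + (- \<Delta>) * v\<^sup>2" using four_m by simp
  also have "\<dots> > 0"
  proof (cases "v = 0")
    case False
    then have "(- \<Delta>) * v\<^sup>2 > 0" using neg by (intro mult_pos_pos) auto
    then show ?thesis using zero_le_power2[of "2 * u + v"] by linarith
  qed (use assms in auto)
  finally show ?thesis by simp
qed

lemma algebraic_int_E: "algebraic_int (E u v)"
proof -
  let ?p = "[: of_int (u\<^sup>2 + u * v + m * v\<^sup>2), - of_int (2 * u + v), 1 :] :: complex poly"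
  have "E u v + cnj (E u v) = of_int (2 * u + v)" unfolding cnj_E E_add by (simp add: of_int_E)
  moreover have "poly ?p (E u v) = of_int (u\<^sup>2 + u * v + m * v\<^sup>2) - E u v * of_int (2 * u + v) + E u v * E u v"
    by (simp add: algebra_simps)
  ultimately have "poly ?p (E u v) = E u v * cnj (E u v) - E u v * (E u v + cnj (E u v)) + E u v * E u v"
    by (simp only: E_norm)
  then have "poly ?p (E u v) = 0" by (simp only: algebra_simps) simp
  then show ?thesis
    by (intro algebraic_int.intros[of ?p]) (auto simp: coeff_pCons split: nat.splits)
qed

text \<open>
  The powers of an algebraic integer have a common denominator, hence so do the powers of its norm;
  a rational number with this property is an integer.
\<close>
lemma norm_integral:
  assumes "algebraic_int x" "x = of_rat a + of_rat b * csqrt (of_int \<Delta>)"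
  shows "a\<^sup>2 - of_int \<Delta> * b\<^sup>2 \<in> \<int>"
proof -
  define s where "s = csqrt (of_int \<Delta>)"
  define Z where "Z = {of_int u + of_int v * s | u v. True}"
  have s2: "s * s = of_int \<Delta>" unfolding s_def by (metis power2_csqrt power2_eq_square)
  have cnj_s: "cnj s = - s" unfolding s_def csqrt_\<Delta> by simp
  have Z_int: "of_int n \<in> Z" for n
  proof -
    have "of_int n = of_int n + of_int 0 * s" by simp
    then show ?thesis unfolding Z_def by blast
  qed
  have Z_add: "y + z \<in> Z" if yz: "y \<in> Z" "z \<in> Z" for y z
  proof -
    from yz obtain u v u' v' where "y = of_int u + of_int v * s" "z = of_int u' + of_int v' * s"
      unfolding Z_def by blast
    then have "y + z = of_int (u + u') + of_int (v + v') * s" by (simp add: algebra_simps)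
    then show ?thesis unfolding Z_def by blast
  qed
  have Z_mult: "y * z \<in> Z" if yz: "y \<in> Z" "z \<in> Z" for y z
  proof -
    from yz obtain u v u' v' where "y = of_int u + of_int v * s" "z = of_int u' + of_int v' * s"
      unfolding Z_def by blast
    then have "y * z = of_int (u * u') + of_int (u * v' + v * u') * s + of_int (v * v') * (s * s)"
      by (simp add: algebra_simps)
    also have "\<dots> = of_int (u * u' + v * v' * \<Delta>) + of_int (u * v' + v * u') * s"
      unfolding s2 by simp
    finally show ?thesis unfolding Z_def by blast
  qed
  have Z_sum: "sum f A \<in> Z" if "\<And>i. i \<in> A \<Longrightarrow> f i \<in> Z" for f :: "nat \<Rightarrow> complex" and A
    using that Z_int[of 0] by (induction A rule: infinite_finite_induct) (auto intro: Z_add)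
  have Z_power: "y ^ k \<in> Z" if "y \<in> Z" for y k
    using that Z_int[of 1] by (induction k) (auto intro: Z_mult)
  obtain w :: int where w: "w > 0" "of_int w * x \<in> Z"
  proof -
    obtain c d where a: "d > 0" "a = of_int c / of_int d" by (rule rat_coprime_fraction[of a])
    obtain c' d' where b: "d' > 0" "b = of_int c' / of_int d'" by (rule rat_coprime_fraction[of b])
    have "of_int (d * d') * x = of_int (c * d') + of_int (c' * d) * s"
      using a(1) b(1) unfolding assms(2) s_def[symmetric] a(2) b(2) by (simp add: of_rat_divide field_simps)
    then have "of_int (d * d') * x \<in> Z" unfolding Z_def by blast
    then show ?thesis using that[of "d * d'"] a b by simp
  qed
  obtain p where p: "lead_coeff p = 1" "\<And>i. Polynomial.coeff p i \<in> \<int>" "poly p x = 0"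
    using assms(1) by (auto elim: algebraic_int.cases)
  define n where "n = degree p"
  \<comment> \<open>\<open>w ^ n\<close> clears the denominators of \<open>x ^ k\<close> for \<open>k \<le> n\<close>; higher powers are reduced with the monic equation.\<close>
  have bound: "of_int (w ^ n) * x ^ k \<in> Z" for k
  proof (induction k rule: less_induct)
    case (less k)
    show ?case
    proof (cases "k \<le> n")
      case True
      then have "of_int (w ^ n) * x ^ k = of_int (w ^ (n - k)) * (of_int w * x) ^ k"
        by (simp add: power_mult_distrib flip: power_add mult.assoc)
      then show ?thesis using Z_mult[OF Z_int Z_power[OF w(2)]] by metis
    next
      case False
      have "0 = (\<Sum>i\<le>n. Polynomial.coeff p i * x ^ i)" using p(3) by (simp add: poly_altdef n_def)
      also have "\<dots> = (\<Sum>i<n. Polynomial.coeff p i * x ^ i) + x ^ n"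
        using p(1) by (simp add: n_def flip: lessThan_Suc_atMost)
      finally have "x ^ n = - (\<Sum>i<n. Polynomial.coeff p i * x ^ i)" by (simp add: eq_neg_iff_add_eq_0 add.commute)
      moreover have "x ^ k = x ^ n * x ^ (k - n)" using False by (simp flip: power_add)
      ultimately have "of_int (w ^ n) * x ^ k = (\<Sum>i<n. - Polynomial.coeff p i * (of_int (w ^ n) * x ^ (i + (k - n))))"
        by (simp add: sum_distrib_left sum_distrib_right sum_negf power_add mult_ac)
      also have "\<dots> \<in> Z"
      proof (rule Z_sum)
        fix i assume "i \<in> {..<n}"
        then have "i + (k - n) < k" using False by auto
        from less.IH[OF this] show "- Polynomial.coeff p i * (of_int (w ^ n) * x ^ (i + (k - n))) \<in> Z"
          using p(2)[of i] by (elim Ints_cases) (metis Z_int Z_mult of_int_minus)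
      qed
      finally show ?thesis .
    qed
  qed
  define r where "r = a\<^sup>2 - of_int \<Delta> * b\<^sup>2"
  have xx: "x * cnj x = of_rat r"
  proof -
    have "x * cnj x = of_rat (a\<^sup>2) - of_rat (b\<^sup>2) * (s * s)"
      unfolding assms(2) s_def[symmetric] by (simp add: cnj_s cnj_of_rat of_rat_mult power2_eq_square algebra_simps)
    then show ?thesis unfolding r_def s2 by (simp add: of_rat_diff of_rat_mult)
  qed
  have "of_int (w ^ n * w ^ n) * r ^ k \<in> \<int>" for k
  proof -
    obtain u v where uv: "of_int (w ^ n) * x ^ k = of_int u + of_int v * s" using bound[of k] by (auto simp: Z_def)
    have "of_int (w ^ n * w ^ n) * (x * cnj x) ^ k = (of_int (w ^ n) * x ^ k) * cnj (of_int (w ^ n) * x ^ k)"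
      by (simp add: power_mult_distrib)
    also have "\<dots> = of_int (u * u) - of_int (v * v) * (s * s)"
      unfolding uv by (simp add: cnj_s algebra_simps)
    also have "\<dots> = of_int (u * u - v * v * \<Delta>)" unfolding s2 by simp
    finally have "of_rat (of_int (w ^ n * w ^ n) * r ^ k) = (of_rat (of_int (u * u - v * v * \<Delta>)) :: complex)"
      unfolding xx by (simp add: of_rat_mult of_rat_power of_rat_diff)
    then have "of_int (w ^ n * w ^ n) * r ^ k = of_int (u * u - v * v * \<Delta>)" by (simp only: of_rat_eq_iff)
    then show ?thesis by simp
  qed
  moreover have "w ^ n * w ^ n > 0" using w(1) by simp
  ultimately have "r \<in> \<int>" by (rule rat_integral_if_powers_bounded[rotated])
  then show ?thesis by (simp add: r_def)
qed

text \<open>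
  An element is integral iff its norm and trace are. The integrality of the trace follows from that of
  the norms of \<open>x\<close> and \<open>x + 1\<close>. The discriminant is squarefree and \<open>1\<close> modulo \<open>4\<close>, so such elements are
  integral combinations of \<open>1\<close> and \<open>\<omega>\<close>.
\<close>
lemma carrier_R: "carrier R = {E u v | u v. True}"
proof (intro equalityI subsetI)
  fix x assume "x \<in> {E u v | u v. True}"
  then obtain u v where x: "x = E u v" by blast
  have "E u v = of_rat (of_int u + of_int v / 2) + of_rat (of_int v / 2) * csqrt (of_int \<Delta>)"
    unfolding E_def \<omega>_def by (simp add: of_rat_add of_rat_mult of_rat_divide field_simps)
  then have "E u v \<in> quadratic_field \<Delta>" unfolding quadratic_field_def by blast
  then show "x \<in> carrier R" using x algebraic_int_E by (simp add: ring_of_integers_def)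
next
  fix x assume "x \<in> carrier R"
  then have alg: "algebraic_int x" and "x \<in> quadratic_field \<Delta>" by (auto simp: ring_of_integers_def)
  then obtain a b where x: "x = of_rat a + of_rat b * csqrt (of_int \<Delta>)" unfolding quadratic_field_def by blast
  define N where "N = a\<^sup>2 - of_int \<Delta> * b\<^sup>2"
  have N: "N \<in> \<int>" using norm_integral[OF alg x] by (simp add: N_def)
  have "algebraic_int (x + 1)"
    by (rule algebraic_int_root[OF alg, of "[:-1, 1:]"]) (auto simp: coeff_pCons split: nat.splits)
  moreover have "x + 1 = of_rat (a + 1) + of_rat b * csqrt (of_int \<Delta>)" unfolding x by (simp add: of_rat_add)
  ultimately have "(a + 1)\<^sup>2 - of_int \<Delta> * b\<^sup>2 \<in> \<int>" by (rule norm_integral)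
  then have "(a + 1)\<^sup>2 - of_int \<Delta> * b\<^sup>2 - N - 1 \<in> \<int>" using N by auto
  moreover have "(a + 1)\<^sup>2 - of_int \<Delta> * b\<^sup>2 - N - 1 = 2 * a" by (simp add: N_def power2_eq_square algebra_simps)
  ultimately obtain T where T: "2 * a = of_int T" by (metis Ints_cases)
  have "of_int \<Delta> * (2 * b)\<^sup>2 = (2 * a)\<^sup>2 - 4 * N" by (simp add: N_def power2_eq_square algebra_simps)
  then have "of_int \<Delta> * (2 * b)\<^sup>2 \<in> \<int>" using N unfolding T by simp
  then have "2 * b \<in> \<int>" by (rule rat_integral_if_squarefree_mult_square[OF sqf])
  then obtain B where B: "2 * b = of_int B" by (metis Ints_cases)
  obtain N' where "N = of_int N'" using N by (metis Ints_cases)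
  have "of_int (T\<^sup>2 - \<Delta> * B\<^sup>2) = (of_int (4 * N') :: rat)"
    using \<open>of_int \<Delta> * (2 * b)\<^sup>2 = (2 * a)\<^sup>2 - 4 * N\<close> unfolding T B \<open>N = of_int N'\<close> by simp
  then have *: "T\<^sup>2 - \<Delta> * B\<^sup>2 = 4 * N'" by (simp only: of_int_eq_iff)
  have "odd \<Delta>" using mod4 by presburger
  have "even (T\<^sup>2 - \<Delta> * B\<^sup>2)" unfolding * by simp
  then have "even (T - B)" using \<open>odd \<Delta>\<close> by simp
  then obtain u where u: "T = B + 2 * u" by (metis add.commute diff_add_cancel evenE)
  have ab: "a = of_int u + of_int B / 2" "b = of_int B / 2" using T B u by simp_all
  then have "x = E u B" unfolding x ab E_def \<omega>_def by (simp add: of_rat_add of_rat_mult of_rat_divide field_simps)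
  then show "x \<in> {E u v | u v. True}" by blast
qed

lemma R_simps [simp]: "\<zero>\<^bsub>R\<^esub> = 0" "\<one>\<^bsub>R\<^esub> = 1" "x \<oplus>\<^bsub>R\<^esub> y = x + y" "x \<otimes>\<^bsub>R\<^esub> y = x * y"
  by (simp_all add: ring_of_integers_def)

lemma E_in_R [simp, intro]: "E u v \<in> carrier R"
  by (auto simp: carrier_R)

lemma in_RE:
  assumes "x \<in> carrier R" obtains u v where "x = E u v"
  using assms by (auto simp: carrier_R)

lemma of_int_in_R [simp, intro]: "of_int n \<in> carrier R"
  by (simp add: of_int_E)

lemma E_diff: "E u v - E u' v' = E (u - u') (v - v')"
  by (simp add: E_def algebra_simps)

lemma R_closed [intro]:
  assumes "x \<in> carrier R" "y \<in> carrier R"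
  shows "x + y \<in> carrier R" "x * y \<in> carrier R" "- x \<in> carrier R" "x - y \<in> carrier R" "cnj x \<in> carrier R"
proof -
  obtain u v u' v' where "x = E u v" "y = E u' v'" using assms by (metis in_RE)
  then show "x + y \<in> carrier R" "x * y \<in> carrier R" "- x \<in> carrier R" "x - y \<in> carrier R" "cnj x \<in> carrier R"
    by (simp_all only: E_add E_mult E_minus E_diff cnj_E E_in_R)
qed

lemma consts_in_R [simp, intro]: "0 \<in> carrier R" "1 \<in> carrier R" "- 1 \<in> carrier R"
  using of_int_in_R[of 0] of_int_in_R[of 1] of_int_in_R[of "-1"] by simp_all

sublocale R: domain R
proof (intro domain.intro domain_axioms.intro cringI)
  show "abelian_group R"
  proof (rule abelian_groupI)
    fix x assume "x \<in> carrier R"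
    then show "\<exists>y\<in>carrier R. y \<oplus>\<^bsub>R\<^esub> x = \<zero>\<^bsub>R\<^esub>" by (intro bexI[of _ "- x"]) auto
  qed (auto simp: algebra_simps)
  show "comm_monoid R"
    by (rule comm_monoidI) (auto simp: algebra_simps)
qed (auto simp: algebra_simps)

lemma R_a_inv [simp]: "x \<in> carrier R \<Longrightarrow> \<ominus>\<^bsub>R\<^esub> x = - x"
  by (rule R.minus_equality) auto

lemma ideal_RI:
  assumes "I \<subseteq> carrier R" "0 \<in> I" "\<And>x y. x \<in> I \<Longrightarrow> y \<in> I \<Longrightarrow> x + y \<in> I"
    and "\<And>x z. x \<in> I \<Longrightarrow> z \<in> carrier R \<Longrightarrow> z * x \<in> I"
  shows "ideal I R"
proof (rule idealI[OF R.ring_axioms])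
  have "- x \<in> I" if "x \<in> I" for x
    using assms(4)[OF that, of "- 1"] by simp
  then show "subgroup I (add_monoid R)"
    using assms by (intro R.add.subgroupI) (auto simp flip: a_inv_def)
qed (use assms in \<open>auto simp: mult.commute\<close>)

lemma ideal_RD:
  assumes "ideal I R"
  shows "0 \<in> I" "\<And>x y. x \<in> I \<Longrightarrow> y \<in> I \<Longrightarrow> x + y \<in> I"
    "\<And>x z. x \<in> I \<Longrightarrow> z \<in> carrier R \<Longrightarrow> z * x \<in> I" "\<And>x y. x \<in> I \<Longrightarrow> y \<in> I \<Longrightarrow> x - y \<in> I"
    "\<And>x. x \<in> I \<Longrightarrow> x \<in> carrier R"
proof -
  interpret ideal I R by fact
  show zero: "0 \<in> I" and add: "\<And>x y. x \<in> I \<Longrightarrow> y \<in> I \<Longrightarrow> x + y \<in> I"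
    and mul: "\<And>x z. x \<in> I \<Longrightarrow> z \<in> carrier R \<Longrightarrow> z * x \<in> I" and "\<And>x. x \<in> I \<Longrightarrow> x \<in> carrier R"
    using additive_subgroup.zero_closed[OF additive_subgroup_axioms]
      additive_subgroup.a_closed[OF additive_subgroup_axioms] I_l_closed Icarr by auto
  fix x y assume "x \<in> I" "y \<in> I"
  then show "x - y \<in> I" using add[of x "- 1 * y"] mul[of y "- 1"] by simp
qed

lemma PIdl_R: "PIdl\<^bsub>R\<^esub> x = (\<lambda>z. x * z) ` carrier R"
  by (auto simp: cgenideal_def mult.commute image_def)

lemma PIdl_prod: "x \<in> carrier R \<Longrightarrow> ideal I R \<Longrightarrow> (PIdl\<^bsub>R\<^esub> x) \<cdot>\<^bsub>R\<^esub> I = (\<lambda>z. x * z) ` I"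
  using R.ideal_prod_PIdl by simp

lemma ideal_prod_subset:
  assumes "ideal K R" "\<And>x y. x \<in> I \<Longrightarrow> y \<in> J \<Longrightarrow> x * y \<in> K"
  shows "I \<cdot>\<^bsub>R\<^esub> J \<subseteq> K"
proof
  fix z assume "z \<in> I \<cdot>\<^bsub>R\<^esub> J"
  then show "z \<in> K"
    by (induction rule: ideal_prod.induct) (use assms ideal_RD(2)[OF assms(1)] in auto)
qed

lemma ideal_prod_memI: "x \<in> I \<Longrightarrow> y \<in> J \<Longrightarrow> x * y \<in> I \<cdot>\<^bsub>R\<^esub> J"
  using ideal_prod.prod[of x I y J R] by simp

lemma cnj_image_invol [simp]: "cnj ` cnj ` I = I"
  by (simp add: image_image)

lemma ideal_cnj: assumes "ideal I R" shows "ideal (cnj ` I) R"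
proof (rule ideal_RI)
  fix x z assume "x \<in> cnj ` I" "z \<in> carrier R"
  then obtain y where y: "x = cnj y" "y \<in> I" by blast
  have "cnj z * y \<in> I" by (rule ideal_RD(3)[OF assms y(2)]) (use \<open>z \<in> carrier R\<close> in blast)
  moreover have "z * x = cnj (cnj z * y)" by (simp add: y)
  ultimately show "z * x \<in> cnj ` I" by blast
next
  fix x y assume "x \<in> cnj ` I" "y \<in> cnj ` I"
  then show "x + y \<in> cnj ` I" using ideal_RD(2)[OF assms] by (auto simp flip: complex_cnj_add)
qed (use ideal_RD[OF assms] in \<open>auto intro: image_eqI[of _ _ 0]\<close>)

lemma cnj_ideal_prod:
  assumes "ideal I R" "ideal J R"
  shows "cnj ` (I \<cdot>\<^bsub>R\<^esub> J) = (cnj ` I) \<cdot>\<^bsub>R\<^esub> (cnj ` J)"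
proof -
  have sub: "cnj ` (I \<cdot>\<^bsub>R\<^esub> J) \<subseteq> (cnj ` I) \<cdot>\<^bsub>R\<^esub> (cnj ` J)" if "ideal I R" "ideal J R" for I J
  proof -
    have "ideal (cnj ` ((cnj ` I) \<cdot>\<^bsub>R\<^esub> (cnj ` J))) R"
      using that by (intro ideal_cnj R.ideal_prod_is_ideal)
    then have "I \<cdot>\<^bsub>R\<^esub> J \<subseteq> cnj ` ((cnj ` I) \<cdot>\<^bsub>R\<^esub> (cnj ` J))"
    proof (rule ideal_prod_subset)
      fix x y assume "x \<in> I" "y \<in> J"
      then have "cnj x * cnj y \<in> (cnj ` I) \<cdot>\<^bsub>R\<^esub> (cnj ` J)" by (intro ideal_prod_memI) auto
      then show "x * y \<in> cnj ` ((cnj ` I) \<cdot>\<^bsub>R\<^esub> (cnj ` J))" by (intro image_eqI[of _ _ "cnj x * cnj y"]) auto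
    qed
    then have "cnj ` (I \<cdot>\<^bsub>R\<^esub> J) \<subseteq> cnj ` cnj ` ((cnj ` I) \<cdot>\<^bsub>R\<^esub> (cnj ` J))" by (rule image_mono)
    then show ?thesis by simp
  qed
  have "cnj ` ((cnj ` I) \<cdot>\<^bsub>R\<^esub> (cnj ` J)) \<subseteq> I \<cdot>\<^bsub>R\<^esub> J"
    using sub[OF ideal_cnj[OF assms(1)] ideal_cnj[OF assms(2)]] by simp
  then have "cnj ` cnj ` ((cnj ` I) \<cdot>\<^bsub>R\<^esub> (cnj ` J)) \<subseteq> cnj ` (I \<cdot>\<^bsub>R\<^esub> J)" by (rule image_mono)
  then show ?thesis using sub[OF assms] by auto
qed

lemma nonzero_ideal_cnj:
  assumes "I \<in> nonzero_ideals R" shows "cnj ` I \<in> nonzero_ideals R"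
proof -
  have "cnj ` I \<noteq> {0}"
  proof
    assume "cnj ` I = {0}"
    then have "cnj ` cnj ` I = {0}" by simp
    then show False using assms by (simp add: nonzero_ideals_def)
  qed
  then show ?thesis using assms ideal_cnj by (simp add: nonzero_ideals_def)
qed

lemma PIdl_of_int_inject:
  assumes "PIdl\<^bsub>R\<^esub> (of_int n) = PIdl\<^bsub>R\<^esub> (of_int k)" "n > 0" "k > 0"
  shows "n = k"
proof -
  have dvd: "k dvd n" if "PIdl\<^bsub>R\<^esub> (of_int n) = PIdl\<^bsub>R\<^esub> (of_int k)" for n k
  proof -
    have "(of_int n :: complex) \<in> PIdl\<^bsub>R\<^esub> (of_int k)"
      using that R.cgenideal_self[of "of_int n"] by auto
    then obtain z where z: "of_int n = of_int k * z" "z \<in> carrier R" unfolding PIdl_R by blast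
    obtain u v where "z = E u v" using z(2) by (rule in_RE)
    with z(1) have "of_int n = of_int k * E u v" by simp
    then have "n = k * u" unfolding of_int_E E_mult E_eq_iff by simp
    then show ?thesis by simp
  qed
  show ?thesis using dvd[OF assms(1)] dvd[OF assms(1)[symmetric]] assms(2,3) by (simp add: zdvd_antisym_nonneg)
qed

lemma PIdl_cnj: "cnj ` (PIdl\<^bsub>R\<^esub> x) = PIdl\<^bsub>R\<^esub> (cnj x)"
proof -
  have "cnj ` carrier R = carrier R"
  proof
    show "cnj ` carrier R \<subseteq> carrier R" by blast
    then have "cnj ` cnj ` carrier R \<subseteq> cnj ` carrier R" by (rule image_mono)
    then show "carrier R \<subseteq> cnj ` carrier R" by simp
  qed
  moreover have "cnj ` (PIdl\<^bsub>R\<^esub> x) = (\<lambda>z. cnj x * z) ` cnj ` carrier R"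
    unfolding PIdl_R image_image by simp
  ultimately show ?thesis by (simp add: PIdl_R)
qed

section \<open>Ideals in standard form\<close>

text \<open>
  For \<open>a\<close> dividing the norm \<open>r\<^sup>2 + r + m\<close> of \<open>r + \<omega>\<close>, this is the ideal \<open>\<int>a + \<int>(r + \<omega>)\<close>, the kernel of
  the ring homomorphism to \<open>\<int>/a\<close> with \<open>\<omega> \<mapsto> -r\<close>.
\<close>
definition L :: "int \<Rightarrow> int \<Rightarrow> complex set" where
  "L a r = {E u v | u v. a dvd u - r * v}"

lemma E_in_L: "E u v \<in> L a r \<longleftrightarrow> a dvd u - r * v"
  by (auto simp: L_def E_eq_iff)

lemma L_cong:
  assumes "a dvd r - r'" shows "L a r = L a r'"
proof -
  have "a dvd u - r * v \<longleftrightarrow> a dvd u - r' * v" for u v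
  proof -
    have "u - r * v = (u - r' * v) - (r - r') * v" by (simp add: algebra_simps)
    then show ?thesis using assms by (metis dvd_diff_commute dvd_mult2 dvd_diff_right_iff dvd_diff_left_iff)
  qed
  then show ?thesis by (simp add: L_def)
qed

lemma ideal_L:
  assumes "a dvd r\<^sup>2 + r + m" shows "ideal (L a r) R"
proof (rule ideal_RI)
  show "L a r \<subseteq> carrier R" by (auto simp: L_def)
  show "0 \<in> L a r" using E_in_L[of 0 0 a r] by (simp add: E_def)
  fix x assume "x \<in> L a r"
  then obtain u v where x: "x = E u v" "a dvd u - r * v" by (auto simp: L_def)
  {
    fix y assume "y \<in> L a r"
    then obtain u' v' where y: "y = E u' v'" "a dvd u' - r * v'" by (auto simp: L_def)
    have "a dvd (u - r * v) + (u' - r * v')" using x y by simp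
    then show "x + y \<in> L a r" unfolding x y E_add E_in_L by (simp add: algebra_simps)
  next
    fix z assume "z \<in> carrier R"
    then obtain s w where z: "z = E s w" by (rule in_RE)
    have "s * u - m * w * v - r * (s * v + w * u + w * v) = (s - r * w) * (u - r * v) - (r\<^sup>2 + r + m) * (w * v)"
      by (simp add: power2_eq_square algebra_simps)
    also have "a dvd \<dots>" by (intro dvd_diff dvd_mult[OF x(2)] dvd_mult2[OF assms])
    finally show "z * x \<in> L a r" unfolding x z E_mult E_in_L .
  }
qed

lemma L_nonzero:
  assumes "a \<noteq> 0" "a dvd r\<^sup>2 + r + m" shows "L a r \<in> nonzero_ideals R"
proof -
  have "E a 0 \<in> L a r" "E a 0 \<noteq> 0" using assms by (auto simp: E_in_L E_eq_0_iff)
  then show ?thesis using ideal_L[OF assms(2)] by (auto simp: nonzero_ideals_def)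
qed

lemma conj_root_dvd: "a dvd r\<^sup>2 + r + m \<Longrightarrow> a dvd (- r - 1)\<^sup>2 + (- r - 1) + m" for a :: int
  by (simp add: power2_eq_square algebra_simps)

lemma cnj_L: "cnj ` L a r = L a (- r - 1)"
proof -
  have sub: "cnj ` L a r \<subseteq> L a (- r - 1)" for r
  proof
    fix x assume "x \<in> cnj ` L a r"
    then obtain u v where "x = E (u + v) (- v)" "a dvd u - r * v" by (auto simp: L_def cnj_E)
    then show "x \<in> L a (- r - 1)" by (simp add: E_in_L algebra_simps)
  qed
  have "cnj ` cnj ` L a (- r - 1) \<subseteq> cnj ` L a r" using sub[of "- r - 1"] by (intro image_mono) simp
  then show ?thesis using sub[of r] by auto
qed

text \<open>
  The lattice \<open>I\<close> is described by the positive generator \<open>n\<close> of \<open>I \<inter> \<int>\<close> and by an element \<open>s + d\<omega>\<close> with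
  the least positive coefficient \<open>d\<close> of \<open>\<omega>\<close>. Multiplication by \<open>\<omega>\<close> shows that \<open>d\<close> divides both \<open>n\<close> and \<open>s\<close>.
\<close>
lemma nonzero_ideal_form:
  assumes "I \<in> nonzero_ideals R"
  obtains d a r where "d > 0" "a > 0" "a dvd r\<^sup>2 + r + m" "I = (\<lambda>z. of_int d * z) ` L a r"
proof -
  have I: "ideal I R" using assms by (simp add: nonzero_ideals_def)
  note ID = ideal_RD[OF I]
  obtain u0 v0 where E0: "E u0 v0 \<in> I" "E u0 v0 \<noteq> 0" using R.nonzero_idealsE[OF assms] by (metis R_simps(1) in_RE)
  define N where "N = u0\<^sup>2 + u0 * v0 + m * v0\<^sup>2"
  have N: "N \<noteq> 0" using norm_pos[of u0 v0] E0(2) by (auto simp: N_def E_eq_0_iff)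
  have NI: "E N 0 \<in> I"
  proof -
    have "cnj (E u0 v0) * E u0 v0 \<in> I" by (rule ID(3)[OF E0(1)]) auto
    then show ?thesis unfolding N_def of_int_E[symmetric] E_norm[symmetric] by (simp add: mult.commute)
  qed
  have wI: "E 0 u \<in> I" if "E u 0 \<in> I" for u using ID(3)[OF that, of "E 0 1"] by (simp add: E_mult)
  have diffE: "E (u - u') (v - v') \<in> I" if "E u v \<in> I" "E u' v' \<in> I" for u v u' v'
    using ID(4)[OF that] E_add[of u v "-u'" "-v'"] by (simp flip: E_minus)
  have mulE: "E (k * u) (k * v) \<in> I" if "E u v \<in> I" for k u v using ID(3)[OF that, of "E k 0"] by (simp add: E_mult)
  obtain n where n: "n > 0" "E n 0 \<in> I" "\<And>y. E y 0 \<in> I \<Longrightarrow> n dvd y"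
    using int_subgroup_principal[of "{u. E u 0 \<in> I}" N] diffE[of _ 0 _ 0] N NI by auto
  obtain d where d: "d > 0" "\<exists>s. E s d \<in> I" "\<And>y s. E s y \<in> I \<Longrightarrow> d dvd y"
  proof (rule int_subgroup_principal[of "{v. \<exists>u. E u v \<in> I}" N])
    show "x - y \<in> {v. \<exists>u. E u v \<in> I}" if "x \<in> {v. \<exists>u. E u v \<in> I}" "y \<in> {v. \<exists>u. E u v \<in> I}" for x y
      using that diffE by blast
    show "N \<in> {v. \<exists>u. E u v \<in> I}" using wI[OF NI] by blast
  qed (use N in auto)
  obtain s where s: "E s d \<in> I" using d(2) by blast
  have "E (- m * d) (s + d) \<in> I" using ID(3)[OF s, of "E 0 1"] by (simp add: E_mult)
  then have "d dvd s + d" by (rule d(3))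
  then obtain r where r: "s = d * r" by (auto simp: dvd_add_left_iff)
  have "d dvd n" by (rule d(3)[OF wI[OF n(2)]])
  then obtain a where a: "n = d * a" by blast
  have "E (r + 1) (- 1) * E s d \<in> I" by (rule ID(3)[OF s]) auto
  also have "E (r + 1) (- 1) * E s d = E (d * (r\<^sup>2 + r + m)) 0"
    by (simp add: E_mult r E_eq_iff power2_eq_square algebra_simps)
  finally have "n dvd d * (r\<^sup>2 + r + m)" by (rule n(3))
  then have dv: "a dvd r\<^sup>2 + r + m" using a d(1) by simp
  have mem: "E u v \<in> I \<longleftrightarrow> (\<exists>u' v'. u = d * u' \<and> v = d * v' \<and> a dvd u' - r * v')" for u v
  proof
    assume uv: "E u v \<in> I"
    then obtain v' where v': "v = d * v'" using d(3) by blast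
    have "E (u - v' * s) (v - v' * d) \<in> I" by (rule diffE[OF uv mulE[OF s]])
    then have "n dvd u - v' * s" using v' n(3) by (simp add: mult.commute)
    then obtain k where "u - v' * s = d * a * k" unfolding a by blast
    then have "u = d * (r * v' + a * k)" using r by (simp add: algebra_simps)
    then show "\<exists>u' v'. u = d * u' \<and> v = d * v' \<and> a dvd u' - r * v'" using v' by fastforce
  next
    assume "\<exists>u' v'. u = d * u' \<and> v = d * v' \<and> a dvd u' - r * v'"
    then obtain u' v' k where *: "u = d * u'" "v = d * v'" "u' - r * v' = a * k" by blast
    have "E (k * n) (k * 0) + E (v' * s) (v' * d) \<in> I" by (intro ID(2) mulE n s)
    moreover have "E (k * n) (k * 0) + E (v' * s) (v' * d) = E u v"
      unfolding E_add E_eq_iff using * a r by (auto simp: algebra_simps)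
    ultimately show "E u v \<in> I" by simp
  qed
  have "I = (\<lambda>z. of_int d * z) ` L a r"
  proof (intro equalityI subsetI)
    fix x assume "x \<in> I"
    then obtain u v where x: "x = E u v" using ID(5) in_RE by blast
    then obtain u' v' where *: "u = d * u'" "v = d * v'" "a dvd u' - r * v'" using \<open>x \<in> I\<close> mem by blast
    then have "x = of_int d * E u' v'" by (simp add: x of_int_E E_mult)
    then show "x \<in> (\<lambda>z. of_int d * z) ` L a r" using * E_in_L by blast
  next
    fix x assume "x \<in> (\<lambda>z. of_int d * z) ` L a r"
    then obtain u v where "x = of_int d * E u v" "a dvd u - r * v" by (auto simp: L_def)
    then show "x \<in> I" by (auto simp: of_int_E E_mult mem)
  qed
  moreover have "a > 0" using n(1) a d(1) by (simp add: zero_less_mult_iff)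
  ultimately show ?thesis using that d(1) dv by blast
qed

lemma form_discriminant: "(2 * r + 1)\<^sup>2 - \<Delta> = 4 * (r\<^sup>2 + r + m)" for r :: int
  using four_m by (simp add: power2_eq_square algebra_simps)

text \<open>
  A common divisor \<open>g\<close> would satisfy \<open>g\<^sup>2 dvd \<Delta>\<close>, since \<open>(2 * r + 1)\<^sup>2 - 4 * a * c = \<Delta>\<close>.
\<close>
lemma form_primitive:
  fixes r :: int
  assumes "r\<^sup>2 + r + m = a * c" "g dvd a" "g dvd 2 * r + 1" "g dvd c"
  shows "is_unit g"
proof -
  have "\<Delta> = (2 * r + 1)\<^sup>2 - 4 * (a * c)" using form_discriminant[of r] assms(1) by simp
  moreover have "g\<^sup>2 dvd (2 * r + 1)\<^sup>2" using assms(3) by simp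
  moreover have "g\<^sup>2 dvd 4 * (a * c)" using assms(2,4) by (simp add: power2_eq_square mult_dvd_mono)
  ultimately have "g\<^sup>2 dvd \<Delta>" by simp
  then show ?thesis using sqf squarefreeD by blast
qed

text \<open>
  The product is generated by \<open>a\<^sup>2\<close>, \<open>a (r + \<omega>)\<close>, its conjugate and \<open>a c\<close>, all divisible by \<open>a\<close>. It contains
  \<open>a\<close> times \<open>a\<close>, \<open>2 * r + 1\<close> and \<open>c\<close>, which are coprime by \<open>form_primitive\<close>.
\<close>
lemma L_times_cnj_L:
  assumes "a dvd r\<^sup>2 + r + m"
  shows "L a r \<cdot>\<^bsub>R\<^esub> L a (- r - 1) = PIdl\<^bsub>R\<^esub> (of_int a)"
proof
  obtain c where c: "r\<^sup>2 + r + m = a * c" using assms by blast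
  have idP: "ideal (PIdl\<^bsub>R\<^esub> (of_int a)) R" by (rule R.cgenideal_ideal) auto
  then show "L a r \<cdot>\<^bsub>R\<^esub> L a (- r - 1) \<subseteq> PIdl\<^bsub>R\<^esub> (of_int a)"
  proof (rule ideal_prod_subset)
    fix x y assume "x \<in> L a r" "y \<in> L a (- r - 1)"
    then obtain u v u' v' where uv: "x = E u v" "y = E u' v'" "a dvd u - r * v" "a dvd u' - (- r - 1) * v'"
      unfolding L_def by blast
    from uv(3,4) obtain s s' where "u - r * v = a * s" "u' - (- r - 1) * v' = a * s'" unfolding dvd_def by blast
    then have xy: "x = E (a * s + r * v) v" "y = E (a * s' - (r + 1) * v') v'"
      unfolding uv by (simp_all add: E_eq_iff algebra_simps)
    have "x * y = E (a * (s * a * s' - s * (r + 1) * v' + r * v * s' - v * v' * c)) (a * (s * v' + v * s'))"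
      unfolding xy E_mult E_eq_iff
    proof
      have "(a * s + r * v) * (a * s' - (r + 1) * v') - m * v * v'
        = a * (s * a * s' - s * (r + 1) * v' + r * v * s') - v * v' * (r\<^sup>2 + r + m)"
        by (simp add: power2_eq_square algebra_simps)
      then show "(a * s + r * v) * (a * s' - (r + 1) * v') - m * v * v'
        = a * (s * a * s' - s * (r + 1) * v' + r * v * s' - v * v' * c)"
        unfolding c by (simp add: algebra_simps)
    qed (simp add: algebra_simps)
    also have "\<dots> = of_int a * E (s * a * s' - s * (r + 1) * v' + r * v * s' - v * v' * c) (s * v' + v * s')"
      by (simp add: of_int_E E_mult)
    finally show "x * y \<in> PIdl\<^bsub>R\<^esub> (of_int a)" unfolding PIdl_R by blast
  qed
  let ?P = "L a r \<cdot>\<^bsub>R\<^esub> L a (- r - 1)"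
  have idL: "ideal ?P R" by (intro R.ideal_prod_is_ideal ideal_L conj_root_dvd assms)
  note P = ideal_RD[OF idL]
  have "E a 0 * E a 0 \<in> ?P" by (rule ideal_prod_memI) (auto simp: E_in_L)
  then have 1: "E (a * a) 0 \<in> ?P" by (simp add: E_mult)
  have "E r 1 * E (r + 1) (- 1) \<in> ?P" by (rule ideal_prod_memI) (auto simp: E_in_L)
  moreover have "E r 1 * E (r + 1) (- 1) = E (a * c) 0"
    unfolding c[symmetric] by (simp add: E_mult power2_eq_square algebra_simps)
  ultimately have 2: "E (a * c) 0 \<in> ?P" by simp
  have "E a 0 * E (r + 1) (- 1) + E r 1 * E a 0 \<in> ?P" by (intro P(2) ideal_prod_memI) (auto simp: E_in_L)
  then have 3: "E (a * (2 * r + 1)) 0 \<in> ?P" by (simp add: E_mult E_add algebra_simps)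
  have "gcd a (gcd (2 * r + 1) c) = 1"
    using form_primitive[OF c, of "gcd a (gcd (2 * r + 1) c)"] by (meson dvd_trans gcd_dvd1 gcd_dvd2 is_unit_gcd_iff)
  moreover obtain i j where "i * (2 * r + 1) + j * c = gcd (2 * r + 1) c" using bezout_int by blast
  moreover obtain k l where "k * a + l * gcd (2 * r + 1) c = gcd a (gcd (2 * r + 1) c)" using bezout_int by blast
  ultimately have bez: "k * a + l * (i * (2 * r + 1) + j * c) = 1" by simp
  have "E k 0 * E (a * a) 0 + (E (l * i) 0 * E (a * (2 * r + 1)) 0 + E (l * j) 0 * E (a * c) 0) \<in> ?P"
    by (intro P(2) P(3) 1 2 3) auto
  also have "E k 0 * E (a * a) 0 + (E (l * i) 0 * E (a * (2 * r + 1)) 0 + E (l * j) 0 * E (a * c) 0)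
    = E (a * (k * a + l * (i * (2 * r + 1) + j * c))) 0"
    by (simp add: E_mult E_add algebra_simps)
  finally have "of_int a \<in> ?P" unfolding bez by (simp add: of_int_E)
  then show "PIdl\<^bsub>R\<^esub> (of_int a) \<subseteq> ?P" unfolding PIdl_R using P(3)[of "of_int a"] by (metis image_subsetI mult.commute)
qed

section \<open>The class group of an imaginary quadratic field\<close>

abbreviation cl :: "complex set \<Rightarrow> complex set set" where "cl \<equiv> ideal_class R"

abbreviation G :: "complex set set monoid" where "G \<equiv> class_group R"

abbreviation pideal :: "complex \<Rightarrow> complex set" where "pideal x \<equiv> PIdl\<^bsub>R\<^esub> x"

lemma ideal_pideal [intro]: "x \<in> carrier R \<Longrightarrow> ideal (pideal x) R"
  by (rule R.cgenideal_ideal)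

lemma pideal_nonzero: "x \<in> carrier R \<Longrightarrow> x \<noteq> 0 \<Longrightarrow> pideal x \<in> nonzero_ideals R"
  using R.nonzero_ideals_PIdl[of x] by simp

lemma pideal_mult: "x \<in> carrier R \<Longrightarrow> y \<in> carrier R \<Longrightarrow> pideal x \<cdot>\<^bsub>R\<^esub> pideal y = pideal (x * y)"
  using R.ideal_prod_PIdl_PIdl[of x y] by simp

lemma pideal_cancel:
  assumes "x \<in> carrier R" "x \<noteq> 0" "ideal I R" "ideal J R" "pideal x \<cdot>\<^bsub>R\<^esub> I = pideal x \<cdot>\<^bsub>R\<^esub> J"
  shows "I = J"
  using R.PIdl_prod_cancel[of x I J] assms by simp

lemma nonzero_ideal_form':
  assumes "I \<in> nonzero_ideals R"
  obtains d a r where "d > 0" "a > 0" "a dvd r\<^sup>2 + r + m" "I = pideal (of_int d) \<cdot>\<^bsub>R\<^esub> L a r"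
  using nonzero_ideal_form[OF assms] PIdl_prod ideal_L by (metis of_int_in_R)

lemma ideal_times_cnj:
  assumes "I \<in> nonzero_ideals R"
  obtains n where "n > 0" "I \<cdot>\<^bsub>R\<^esub> (cnj ` I) = pideal (of_int n)"
proof -
  obtain d a r where *: "d > 0" "a > 0" "a dvd r\<^sup>2 + r + m" "I = pideal (of_int d) \<cdot>\<^bsub>R\<^esub> L a r"
    using assms by (rule nonzero_ideal_form')
  have iL: "ideal (L a r) R" "ideal (L a (- r - 1)) R" using * by (intro ideal_L conj_root_dvd; simp)+
  have id: "ideal (pideal (of_int d)) R" by (intro ideal_pideal) simp
  have "cnj ` I = pideal (of_int d) \<cdot>\<^bsub>R\<^esub> L a (- r - 1)"
    unfolding *(4) by (simp add: cnj_ideal_prod[OF id iL(1)] PIdl_cnj cnj_L)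
  then have "I \<cdot>\<^bsub>R\<^esub> (cnj ` I) = (pideal (of_int d) \<cdot>\<^bsub>R\<^esub> pideal (of_int d)) \<cdot>\<^bsub>R\<^esub> (L a r \<cdot>\<^bsub>R\<^esub> L a (- r - 1))"
    unfolding *(4) by (simp add: R.iprod_interchange[OF id iL(1) id iL(2)])
  also have "\<dots> = pideal (of_int (d * d * a))"
    unfolding L_times_cnj_L[OF *(3)] by (simp add: pideal_mult R_closed)
  finally show ?thesis using that[of "d * d * a"] * by simp
qed

sublocale G: comm_group G
proof (rule R.comm_group_class_group)
  fix I assume I: "I \<in> nonzero_ideals R"
  obtain n where "n > 0" "I \<cdot>\<^bsub>R\<^esub> (cnj ` I) = pideal (of_int n)" using I by (rule ideal_times_cnj)
  then show "\<exists>J\<in>nonzero_ideals R. \<exists>a\<in>carrier R. a \<noteq> \<zero>\<^bsub>R\<^esub> \<and> I \<cdot>\<^bsub>R\<^esub> J = PIdl\<^bsub>R\<^esub> a"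
    using nonzero_ideal_cnj[OF I] by (intro bexI[of _ "cnj ` I"] bexI[of _ "of_int n"]) auto
qed

lemma cl_closed [intro]: "I \<in> nonzero_ideals R \<Longrightarrow> cl I \<in> carrier G"
  by (simp add: R.class_group_carrier)

lemma cl_mult: "I \<in> nonzero_ideals R \<Longrightarrow> J \<in> nonzero_ideals R \<Longrightarrow> cl (I \<cdot>\<^bsub>R\<^esub> J) = cl I \<otimes>\<^bsub>G\<^esub> cl J"
  by (simp add: R.class_group_mult)

lemma cl_pideal: "x \<in> carrier R \<Longrightarrow> x \<noteq> 0 \<Longrightarrow> cl (pideal x) = \<one>\<^bsub>G\<^esub>"
  using R.ideal_class_principal[of x] by simp

lemma cl_scale:
  assumes "x \<in> carrier R" "x \<noteq> 0" "I \<in> nonzero_ideals R"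
  shows "cl (pideal x \<cdot>\<^bsub>R\<^esub> I) = cl I"
  using cl_mult[OF pideal_nonzero[OF assms(1,2)] assms(3)] cl_pideal[OF assms(1,2)] cl_closed[OF assms(3)] by simp

text \<open>
  With \<open>\<beta> = r + \<omega>\<close> and conjugate \<open>\<beta>'\<close>, the ideal on the left is \<open>\<int>a\<beta>' + \<int>\<beta>\<beta>'\<close> and \<open>\<beta>\<beta>' = a c\<close>. On quadratic
  forms this is the exchange of the outer coefficients.
\<close>
lemma L_swap:
  assumes "r\<^sup>2 + r + m = a * c"
  shows "pideal (E (r + 1) (- 1)) \<cdot>\<^bsub>R\<^esub> L a r = pideal (of_int a) \<cdot>\<^bsub>R\<^esub> L c (- r - 1)"
proof -
  have ids: "ideal (L a r) R" "ideal (L c (- r - 1)) R"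
    using assms by (intro ideal_L conj_root_dvd; simp)+
  have 1: "E (r + 1) (- 1) * E (a * s + r * v) v = of_int a * E (c * v - (r + 1) * (- s)) (- s)" for s v
  proof -
    have "(r + 1) * (a * s + r * v) - m * - 1 * v = (r\<^sup>2 + r + m) * v + a * s * (r + 1)"
      by (simp add: power2_eq_square algebra_simps)
    then show ?thesis unfolding of_int_E E_mult E_eq_iff assms by (simp add: algebra_simps)
  qed
  have "L a r = {E (a * s + r * v) v | s v. True}"
    unfolding L_def dvd_def by (auto simp: E_eq_iff algebra_simps)
  then have l: "L a r = (\<lambda>(s, v). E (a * s + r * v) v) ` UNIV" by auto
  have "L c (- r - 1) = {E (c * v - (r + 1) * (- s)) (- s) | s v. True}"
  proof (intro equalityI subsetI)
    fix x assume "x \<in> L c (- r - 1)"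
    then obtain u w k where "x = E u w" "u - (- r - 1) * w = c * k" unfolding L_def dvd_def by blast
    then have "x = E (c * k - (r + 1) * (- (- w))) (- (- w))" by (simp add: E_eq_iff algebra_simps)
    then show "x \<in> {E (c * v - (r + 1) * (- s)) (- s) | s v. True}" by blast
  qed (auto simp: E_in_L algebra_simps)
  then have l': "L c (- r - 1) = (\<lambda>(s, v). E (c * v - (r + 1) * (- s)) (- s)) ` UNIV" by auto
  show ?thesis unfolding PIdl_prod[OF E_in_R ids(1)] PIdl_prod[OF of_int_in_R ids(2)]
    unfolding l l' image_image
    by (simp add: 1 case_prod_unfold)
qed

lemma cl_L_swap:
  assumes "r\<^sup>2 + r + m = a * c" "a > 0"
  shows "c > 0" "cl (L a r) = cl (L c (- r - 1))"
proof -
  have "a * c > 0" using norm_pos[of r 1] assms(1) by simp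
  then show c: "c > 0" using assms(2) by (simp add: zero_less_mult_iff)
  have "a dvd r\<^sup>2 + r + m" "c dvd (- r - 1)\<^sup>2 + (- r - 1) + m"
    using assms(1) conj_root_dvd[of c r] by simp_all
  then have nz: "L a r \<in> nonzero_ideals R" "L c (- r - 1) \<in> nonzero_ideals R"
    using assms(2) c by (auto intro!: L_nonzero)
  have "cl (L a r) = cl (pideal (E (r + 1) (- 1)) \<cdot>\<^bsub>R\<^esub> L a r)"
    using nz by (intro cl_scale[symmetric]) (auto simp: E_eq_0_iff)
  also have "\<dots> = cl (L c (- r - 1))" unfolding L_swap[OF assms(1)]
    using nz assms(2) by (intro cl_scale) auto
  finally show "cl (L a r) = cl (L c (- r - 1))" .
qed

lemma form_cong: "a dvd r - r' \<Longrightarrow> a dvd r\<^sup>2 + r + m \<longleftrightarrow> a dvd r'\<^sup>2 + r' + m" for a :: int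
proof -
  assume "a dvd r - r'"
  then have "a dvd (r - r') * (r + r' + 1)" by simp
  also have "(r - r') * (r + r' + 1) = (r\<^sup>2 + r + m) - (r'\<^sup>2 + r' + m)" by (simp add: power2_eq_square algebra_simps)
  finally show ?thesis by (metis diff_add_cancel dvd_add_right_iff dvd_add_left_iff)
qed

lemma class_representative:
  assumes "x \<in> carrier G"
  obtains a r where "a > 0" "a dvd r\<^sup>2 + r + m" "x = cl (L a r)"
proof -
  obtain I where I: "I \<in> nonzero_ideals R" "x = cl I" using assms by (auto simp: R.class_group_carrier)
  obtain d a r where *: "d > 0" "a > 0" "a dvd r\<^sup>2 + r + m" "I = pideal (of_int d) \<cdot>\<^bsub>R\<^esub> L a r"
    using I(1) by (rule nonzero_ideal_form')
  have "x = cl (L a r)" unfolding I(2) *(4) using * by (intro cl_scale L_nonzero) auto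
  then show ?thesis using that * by blast
qed

text \<open>
  Gauss reduction. While \<open>a\<close> exceeds \<open>-\<Delta>\<close>, \<open>r\<close> is moved into an interval of length \<open>a\<close> around \<open>-1/2\<close>
  and \<open>a\<close> is exchanged with \<open>c\<close>. This makes it smaller: \<open>a \<le> c\<close> would give \<open>4 a\<^sup>2 \<le> 4 a c \<le> a\<^sup>2 - \<Delta>\<close>.
\<close>
lemma reduced_representative:
  assumes "a > 0" "a dvd r\<^sup>2 + r + m"
  shows "\<exists>a' r'. 0 < a' \<and> a' \<le> - \<Delta> \<and> 0 \<le> r' \<and> r' < a' \<and> cl (L a r) = cl (L a' r')"
  using assms
proof (induction "nat a" arbitrary: a r rule: less_induct)
  case less
  show ?case
  proof (cases "a \<le> - \<Delta>")
    case True
    have "L a r = L a (r mod a)" by (rule L_cong) (simp add: minus_mod_eq_mult_div)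
    then show ?thesis using True less.prems by (intro exI[of _ a] exI[of _ "r mod a"]) auto
  next
    case False
    define k where "k = a div 2"
    define r1 where "r1 = (r + k) mod a - k"
    have bounds: "0 \<le> (r + k) mod a" "(r + k) mod a < a" using less.prems by auto
    have "\<bar>2 * r1 + 1\<bar> \<le> a"
    proof -
      have "2 * k \<le> a" "a \<le> 2 * k + 1" unfolding k_def by presburger+
      moreover define q where "q = (r + k) mod a"
      ultimately have "\<bar>2 * (q - k) + 1\<bar> \<le> a" using bounds by (simp add: abs_le_iff)
      then show ?thesis unfolding r1_def q_def .
    qed
    then have sq: "(2 * r1 + 1)\<^sup>2 \<le> a\<^sup>2" by (metis abs_le_square_iff abs_of_pos less.prems(1))
    have dv: "a dvd r - r1"
    proof -
      have "r - r1 = (r + k) - (r + k) mod a" by (simp add: r1_def)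
      then show ?thesis by (simp add: minus_mod_eq_mult_div)
    qed
    obtain c where c: "r1\<^sup>2 + r1 + m = a * c" using form_cong[OF dv] less.prems(2) by blast
    note sw = cl_L_swap[OF c less.prems(1)]
    have "c < a"
    proof (rule ccontr)
      assume "\<not> c < a"
      then have "a * a \<le> a * c" using less.prems(1) by (intro mult_left_mono) auto
      moreover have "4 * (a * c) = (2 * r1 + 1)\<^sup>2 - \<Delta>" using form_discriminant[of r1] c by simp
      ultimately have "3 * (a * a) \<le> - \<Delta>" using sq by (simp add: power2_eq_square)
      moreover have "a * 1 \<le> a * a" using less.prems(1) by (intro mult_left_mono) auto
      ultimately show False using False less.prems(1) by linarith
    qed
    then have "\<exists>a' r'. 0 < a' \<and> a' \<le> - \<Delta> \<and> 0 \<le> r' \<and> r' < a' \<and> cl (L c (- r1 - 1)) = cl (L a' r')"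
      using sw(1) less.prems(1) c by (intro less.hyps conj_root_dvd) auto
    moreover have "cl (L a r) = cl (L c (- r1 - 1))" using L_cong[OF dv] sw(2) by simp
    ultimately show ?thesis by simp
  qed
qed

lemma finite_class_group: "finite (carrier G)"
proof -
  have "carrier G \<subseteq> (\<lambda>(a, r). cl (L a r)) ` ({0..- \<Delta>} \<times> {0..- \<Delta>})"
  proof
    fix x assume "x \<in> carrier G"
    then obtain a r where "a > 0" "a dvd r\<^sup>2 + r + m" "x = cl (L a r)" by (rule class_representative)
    then obtain a' r' where "0 < a'" "a' \<le> - \<Delta>" "0 \<le> r'" "r' < a'" "x = cl (L a' r')"
      using reduced_representative by blast
    then show "x \<in> (\<lambda>(a, r). cl (L a r)) ` ({0..- \<Delta>} \<times> {0..- \<Delta>})"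
      by (intro image_eqI[of _ _ "(a', r')"]) auto
  qed
  then show ?thesis by (rule finite_subset) auto
qed

text \<open>
  Replacing \<open>r\<close> by \<open>r + a k\<close> and then swapping replaces \<open>a\<close> by the value at \<open>k\<close> of the primitive quadratic
  polynomial \<open>a k\<^sup>2 + (2 r + 1) k + c\<close>. It takes odd values unless \<open>a\<close> is odd and \<open>c\<close> even, in which case
  \<open>a\<close> and \<open>c\<close> are swapped beforehand.
\<close>
lemma coprime_representative:
  assumes "x \<in> carrier G"
  obtains a r where "a > 0" "a dvd r\<^sup>2 + r + m" "coprime a (2 * \<Delta>)" "x = cl (L a r)"
proof -
  have main: "\<exists>a' r'. a' > 0 \<and> a' dvd r'\<^sup>2 + r' + m \<and> coprime a' (2 * \<Delta>) \<and> cl (L a r) = cl (L a' r')"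
    if ac: "a > 0" "r\<^sup>2 + r + m = a * c" "even a \<or> odd c" for a r c
  proof -
    have "\<exists>k. coprime (a * k\<^sup>2 + (2 * r + 1) * k + c) (2 * \<Delta>)"
    proof (rule coprime_quadratic_value)
      fix p :: int assume "prime p" "p dvd a" "p dvd 2 * r + 1" "p dvd c"
      then show False using form_primitive[OF ac(2)] not_prime_unit by blast
    qed (use ac(3) neg in auto)
    then obtain k where k: "coprime (a * k\<^sup>2 + (2 * r + 1) * k + c) (2 * \<Delta>)" by blast
    let ?c = "a * k\<^sup>2 + (2 * r + 1) * k + c" and ?r = "r + a * k"
    have r: "?r\<^sup>2 + ?r + m = a * ?c"
    proof -
      have "?r\<^sup>2 + ?r + m = (r\<^sup>2 + r + m) + a * (a * k\<^sup>2 + (2 * r + 1) * k)"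
        by (simp add: power2_eq_square algebra_simps)
      then show ?thesis unfolding ac(2) by (simp add: algebra_simps)
    qed
    note sw = cl_L_swap[OF r ac(1)]
    have "L a r = L a ?r" by (rule L_cong) simp
    moreover have "?c dvd (- ?r - 1)\<^sup>2 + (- ?r - 1) + m" by (rule conj_root_dvd) (simp only: r dvd_triv_right)
    ultimately show ?thesis using sw k by metis
  qed
  obtain a r where ar: "a > 0" "a dvd r\<^sup>2 + r + m" "x = cl (L a r)" using assms by (rule class_representative)
  obtain c where c: "r\<^sup>2 + r + m = a * c" using ar(2) by blast
  have "\<exists>a' r'. a' > 0 \<and> a' dvd r'\<^sup>2 + r' + m \<and> coprime a' (2 * \<Delta>) \<and> x = cl (L a' r')"
  proof (cases "even a \<or> odd c")
    case True
    then show ?thesis using main[OF ar(1) c] ar(3) by simp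
  next
    case False
    have "(- r - 1)\<^sup>2 + (- r - 1) + m = c * a" using c by (simp add: power2_eq_square algebra_simps)
    from main[OF cl_L_swap(1)[OF c ar(1)] this] show ?thesis
      using False cl_L_swap(2)[OF c ar(1)] ar(3) by auto
  qed
  then show ?thesis using that by blast
qed

section \<open>Ambiguous ideals and two-torsion\<close>

text \<open>
  The elements whose trace is divisible by \<open>D\<close>. For \<open>D\<close> dividing \<open>\<Delta>\<close> this is the product of the prime
  ideals above the prime factors of \<open>D\<close>, by \<open>ramified_prime_eq_J\<close> and \<open>J_mult\<close>.
\<close>
definition J :: "int \<Rightarrow> complex set" where
  "J D = {E u v | u v. D dvd 2 * u + v}"

lemma E_in_J: "E u v \<in> J D \<longleftrightarrow> D dvd 2 * u + v"
  by (auto simp: J_def E_eq_iff)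

lemma odd_\<Delta>: "odd \<Delta>"
  using mod4 by presburger

lemma odd_dvd_\<Delta>: "D dvd \<Delta> \<Longrightarrow> odd D"
  using odd_\<Delta> by auto

lemma J_eq_L_iff:
  assumes "odd D" "D dvd 2 * r + 1" shows "J D = L D r"
proof -
  have "D dvd 2 * u + v \<longleftrightarrow> D dvd u - r * v" for u v
  proof -
    have "2 * u + v = 2 * (u - r * v) + (2 * r + 1) * v" by (simp add: algebra_simps)
    then have "D dvd 2 * u + v \<longleftrightarrow> D dvd 2 * (u - r * v)"
      using assms(2) by (metis dvd_add_left_iff dvd_mult2)
    then show ?thesis using dvd_two_mult_iff[OF assms(1), of "u - r * v"] by blast
  qed
  then show ?thesis by (simp add: J_def L_def)
qed

lemma root_of_divisor:
  assumes "D dvd \<Delta>"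
  obtains r where "2 * r + 1 = D" "D dvd r\<^sup>2 + r + m" "J D = L D r" "J D = L D (- r - 1)"
proof -
  have odd: "odd D" using assms by (rule odd_dvd_\<Delta>)
  then obtain r where r: "D = 2 * r + 1" by (rule oddE)
  have "D dvd (2 * r + 1)\<^sup>2 - \<Delta>" using assms r by (simp add: power2_eq_square)
  then have "D dvd 2 * (2 * (r\<^sup>2 + r + m))" unfolding form_discriminant by simp
  then have "D dvd r\<^sup>2 + r + m" by (simp only: dvd_two_mult_iff[OF odd])
  moreover have "D dvd 2 * (- r - 1) + 1"
  proof -
    have "2 * (- r - 1) + 1 = - D" using r by simp
    then show ?thesis by simp
  qed
  ultimately show ?thesis using that[of r] J_eq_L_iff[OF odd, of r] J_eq_L_iff[OF odd, of "- r - 1"] r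
    by simp
qed

lemma ideal_J: assumes "D dvd \<Delta>" shows "ideal (J D) R"
proof -
  obtain r where "D dvd r\<^sup>2 + r + m" "J D = L D r" using assms by (rule root_of_divisor)
  then show ?thesis using ideal_L by simp
qed

lemma dvd_\<Delta>_nonzero: "D dvd \<Delta> \<Longrightarrow> D \<noteq> 0"
  using neg by auto

lemma J_nonzero: assumes "D dvd \<Delta>" shows "J D \<in> nonzero_ideals R"
proof -
  obtain r where "D dvd r\<^sup>2 + r + m" "J D = L D r" using assms by (rule root_of_divisor)
  then show ?thesis using L_nonzero dvd_\<Delta>_nonzero[OF assms] by simp
qed

text \<open>
  The ideal equals its conjugate, so this is the formula for an ideal times its conjugate.
\<close>
lemma J_square: assumes "D dvd \<Delta>" shows "J D \<cdot>\<^bsub>R\<^esub> J D = pideal (of_int D)"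
proof -
  obtain r where r: "D dvd r\<^sup>2 + r + m" "J D = L D r" "J D = L D (- r - 1)" using assms by (rule root_of_divisor)
  show ?thesis using L_times_cnj_L[OF r(1)] r(2,3) by simp
qed

lemma J_one: "J 1 = carrier R"
  by (simp add: J_def carrier_R)

lemma J_mult:
  assumes "D dvd \<Delta>" "D' dvd \<Delta>" "coprime D D'"
  shows "J D \<cdot>\<^bsub>R\<^esub> J D' = J (D * D')"
proof
  have sub: "J D \<cdot>\<^bsub>R\<^esub> J D' \<subseteq> J D \<inter> J D'" by (intro R.ideal_prod_inter ideal_J assms)
  show "J D \<cdot>\<^bsub>R\<^esub> J D' \<subseteq> J (D * D')"
  proof
    fix x assume "x \<in> J D \<cdot>\<^bsub>R\<^esub> J D'"
    then have x: "x \<in> J D" "x \<in> J D'" using sub by auto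
    then obtain u v where "x = E u v" by (auto simp: J_def)
    then show "x \<in> J (D * D')" using x assms(3) by (simp add: E_in_J divides_mult)
  qed
  obtain k l where "k * D + l * D' = 1" using assms(3) bezout_int[of D D'] by (metis coprime_iff_gcd_eq_1)
  note id = ideal_RD[OF R.ideal_prod_is_ideal[OF ideal_J[OF assms(1)] ideal_J[OF assms(2)]]]
  show "J (D * D') \<subseteq> J D \<cdot>\<^bsub>R\<^esub> J D'"
  proof
    fix x assume "x \<in> J (D * D')"
    then obtain u v where x: "x = E u v" "D * D' dvd 2 * u + v" by (auto simp: J_def)
    have dv: "D dvd 2 * u + v" "D' dvd 2 * u + v" using x(2) by (auto dest: dvd_mult_left dvd_mult_right)
    have "E k 0 * (E D 0 * E u v) + E l 0 * (E u v * E D' 0) \<in> J D \<cdot>\<^bsub>R\<^esub> J D'"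
      by (intro id(2) id(3) ideal_prod_memI) (auto simp: E_in_J dv)
    also have "E k 0 * (E D 0 * E u v) + E l 0 * (E u v * E D' 0) = E ((k * D + l * D') * u) ((k * D + l * D') * v)"
      by (simp add: E_mult E_add algebra_simps)
    finally show "x \<in> J D \<cdot>\<^bsub>R\<^esub> J D'" unfolding \<open>k * D + l * D' = 1\<close> x by simp
  qed
qed

lemma J_\<Delta>: "J \<Delta> = pideal (E (- 1) 2)"
proof -
  have *: "E (- 1) 2 * E x y = E (- x - 2 * m * y) (2 * x + y)" for x y
    unfolding E_mult E_eq_iff by simp
  have "J \<Delta> = (\<lambda>z. E (- 1) 2 * z) ` carrier R"
  proof (intro equalityI subsetI)
    fix z assume "z \<in> J \<Delta>"
    then obtain u v where z: "z = E u v" "\<Delta> dvd 2 * u + v" by (auto simp: J_def)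
    then obtain y where y: "2 * u + v = \<Delta> * y" by blast
    have "even (v - y)"
    proof -
      have "even (2 * u + v - v)" by simp
      then have "even (\<Delta> * y - v)" using y by simp
      then show ?thesis using odd_\<Delta> by auto
    qed
    then obtain x where x: "v = y + 2 * x" by (metis add.commute diff_add_cancel evenE)
    have "\<Delta> * y = (1 - 4 * m) * y" using four_m by simp
    then have "u = - x - 2 * m * y" using y x by (simp add: algebra_simps)
    then have "z = E (- 1) 2 * E x y" unfolding * using z x by (simp add: add.commute)
    then show "z \<in> (\<lambda>z. E (- 1) 2 * z) ` carrier R" by blast
  next
    fix z assume "z \<in> (\<lambda>z. E (- 1) 2 * z) ` carrier R"
    then obtain x y where "z = E (- x - 2 * m * y) (2 * x + y)" using * by (auto elim!: in_RE)
    moreover have "2 * (- x - 2 * m * y) + (2 * x + y) = \<Delta> * y"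
    proof -
      have "2 * (- x - 2 * m * y) + (2 * x + y) = (1 - 4 * m) * y" by (simp add: algebra_simps)
      then show ?thesis using four_m by simp
    qed
    ultimately show "z \<in> J \<Delta>" by (metis E_in_J dvd_triv_left)
  qed
  then show ?thesis by (simp add: PIdl_R)
qed

lemma cl_J_square: assumes "D dvd \<Delta>" shows "cl (J D) \<otimes>\<^bsub>G\<^esub> cl (J D) = \<one>\<^bsub>G\<^esub>"
  using cl_mult[OF J_nonzero[OF assms] J_nonzero[OF assms]] J_square[OF assms]
    cl_pideal[of "of_int D"] dvd_\<Delta>_nonzero[OF assms] by simp

lemma J_minus: "J (- D) = J D"
  by (simp add: J_def)

text \<open>
  The product of both ideals is generated by \<open>\<surd>\<Delta>\<close>, and each has a principal square.
\<close>
lemma cl_J_complement: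
  assumes "\<Delta> = - (D * D')" shows "cl (J D) = cl (J D')"
proof -
  have dv: "D dvd \<Delta>" "D' dvd \<Delta>" using assms by auto
  have cop: "coprime D D'"
  proof (rule int_coprimeI)
    fix p assume "prime p" "p dvd D" "p dvd D'"
    then have "p\<^sup>2 dvd \<Delta>" using assms by (simp add: power2_eq_square mult_dvd_mono)
    then show False using squarefreeD[OF sqf] \<open>prime p\<close> not_prime_unit by blast
  qed (use dvd_\<Delta>_nonzero[OF dv(2)] in simp)
  have "J D \<cdot>\<^bsub>R\<^esub> J D' = J \<Delta>" using J_mult[OF dv cop] assms J_minus by metis
  then have "cl (J D) \<otimes>\<^bsub>G\<^esub> cl (J D') = \<one>\<^bsub>G\<^esub>"
    using cl_mult[OF J_nonzero[OF dv(1)] J_nonzero[OF dv(2)]] cl_pideal[of "E (- 1) 2"]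
    by (simp add: J_\<Delta> E_eq_0_iff)
  also have "\<dots> = cl (J D) \<otimes>\<^bsub>G\<^esub> cl (J D)" using cl_J_square[OF dv(1)] by simp
  finally show ?thesis using cl_closed[OF J_nonzero[OF dv(1)]] cl_closed[OF J_nonzero[OF dv(2)]] by simp
qed

lemma primeideal_J:
  assumes "prime q" "q dvd \<Delta>" shows "primeideal (J q) R"
proof (rule primeidealI[OF ideal_J[OF assms(2)] R.is_cring])
  have "\<not> q dvd 2" using assms odd_dvd_\<Delta>[OF assms(2)] primes_dvd_imp_eq[of q 2] by auto
  then have "E 1 0 \<notin> J q" by (simp add: E_in_J)
  then show "carrier R \<noteq> J q" by blast
  fix x y assume xy: "x \<in> carrier R" "y \<in> carrier R" "x \<otimes>\<^bsub>R\<^esub> y \<in> J q"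
  obtain u v u' v' where *: "x = E u v" "y = E u' v'" using xy(1,2) by (metis in_RE)
  have "(2 * u + v) * (2 * u' + v') = 2 * (2 * (u * u' - m * v * v') + (u * v' + v * u' + v * v')) - (1 - 4 * m) * (v * v')"
    by (simp add: algebra_simps)
  also have "1 - 4 * m = \<Delta>" using four_m by simp
  also have "q dvd 2 * (2 * (u * u' - m * v * v') + (u * v' + v * u' + v * v')) - \<Delta> * (v * v')"
    using xy(3) assms(2) unfolding * R_simps E_mult E_in_J by (intro dvd_diff dvd_mult dvd_mult2)
  finally show "x \<in> J q \<or> y \<in> J q" using assms(1) by (simp add: * E_in_J prime_dvd_mult_iff)
qed

text \<open>
  A prime ideal with the same square contains \<open>J q\<close> and is contained in it, as both are prime.
\<close>
lemma ramified_prime_eq_J: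
  assumes "prime q" "int q dvd \<Delta>" shows "ramified_prime \<Delta> q = J (int q)"
  unfolding ramified_prime_def
proof (rule the_equality)
  have pq: "primeideal (J (int q)) R" by (rule primeideal_J) (use assms in auto)
  have sq: "J (int q) \<cdot>\<^bsub>R\<^esub> J (int q) = pideal (of_nat q)" using J_square[OF assms(2)] by simp
  show "primeideal (J (int q)) R \<and> J (int q) \<cdot>\<^bsub>R\<^esub> J (int q) = pideal (of_nat q)" using pq sq by blast
  fix P assume P: "primeideal P R \<and> P \<cdot>\<^bsub>R\<^esub> P = pideal (of_nat q)"
  have iP: "ideal P R" using P by (simp add: primeideal_def)
  show "P = J (int q)"
    using R.primeideal_divides_ideal_prod[OF pq iP iP]
      R.primeideal_divides_ideal_prod[of P, OF _ ideal_J[OF assms(2)] ideal_J[OF assms(2)]]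
      R.ideal_prod_inter[OF iP iP] R.ideal_prod_inter[OF ideal_J[OF assms(2)] ideal_J[OF assms(2)]] P sq
    by blast
qed

lemma pideal_minus: "pideal (- x) = pideal x"
proof -
  have "pideal (- y) \<subseteq> pideal y" for y
  proof
    fix z assume "z \<in> pideal (- y)"
    then obtain w where "w \<in> carrier R" "z = y * (- w)" unfolding PIdl_R by auto
    then show "z \<in> pideal y" unfolding PIdl_R using R_closed(3) by blast
  qed
  from this[of x] this[of "- x"] show ?thesis by auto
qed

text \<open>
  In standard form, invariance under conjugation puts the trace of \<open>r + \<omega>\<close> into the ideal, so
  \<open>a dvd 2 * r + 1\<close>, and then \<open>a dvd \<Delta>\<close>.
\<close>
lemma ambiguous_ideal_class:
  assumes "K \<in> nonzero_ideals R" "cnj ` K = K"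
  obtains D where "D > 0" "D dvd \<Delta>" "cl K = cl (J D)"
proof -
  obtain d a r where *: "d > 0" "a > 0" "a dvd r\<^sup>2 + r + m" "K = pideal (of_int d) \<cdot>\<^bsub>R\<^esub> L a r"
    using assms(1) by (rule nonzero_ideal_form')
  have id: "ideal (pideal (of_int d)) R" and iL: "ideal (L a r) R" using * ideal_L by auto
  have "pideal (of_int d) \<cdot>\<^bsub>R\<^esub> (cnj ` L a r) = pideal (of_int d) \<cdot>\<^bsub>R\<^esub> L a r"
    using assms(2) unfolding *(4) cnj_ideal_prod[OF id iL] PIdl_cnj by simp
  then have inv: "cnj ` L a r = L a r"
    using *(1) pideal_cancel[OF of_int_in_R _ ideal_cnj[OF iL] iL, of d] by simp
  have "cnj (E r 1) \<in> cnj ` L a r" by (simp add: E_in_L)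
  then have "E (r + 1) (- 1) \<in> L a r" by (simp add: inv cnj_E)
  then have a: "a dvd 2 * r + 1" by (simp add: E_in_L algebra_simps)
  have "a dvd (2 * r + 1)\<^sup>2 - 4 * (r\<^sup>2 + r + m)"
    using a *(3) by (intro dvd_diff dvd_mult) (auto simp: power2_eq_square)
  also have "(2 * r + 1)\<^sup>2 - 4 * (r\<^sup>2 + r + m) = \<Delta>" using form_discriminant[of r] by simp
  finally have "a dvd \<Delta>" .
  moreover have "cl K = cl (L a r)" unfolding *(4) using * by (intro cl_scale L_nonzero) auto
  moreover have "L a r = J a" using J_eq_L_iff[OF odd_dvd_\<Delta>[OF \<open>a dvd \<Delta>\<close>] a] by simp
  ultimately show ?thesis using that[of a] *(2) by simp
qed

text \<open>
  This is Hilbert 90 made explicit. If \<open>I\<^sup>2 = (g)\<close> and \<open>I\<close> has norm \<open>a\<close>, then \<open>g\<close> has norm \<open>a\<^sup>2\<close>, and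
  \<open>\<mu> = g + a\<close> satisfies \<open>cnj \<mu> * g = a * \<mu>\<close>. Hence the ideal \<open>(cnj \<mu>) I\<close> is invariant under conjugation.
  If \<open>\<mu> = 0\<close>, then \<open>I\<close> itself is invariant.
\<close>
lemma two_torsion_representative:
  assumes "x \<in> carrier G" "x \<otimes>\<^bsub>G\<^esub> x = \<one>\<^bsub>G\<^esub>"
  obtains D where "D > 0" "D dvd \<Delta>" "x = cl (J D)"
proof -
  obtain a r where ar: "a > 0" "a dvd r\<^sup>2 + r + m" "x = cl (L a r)" using assms(1) by (rule class_representative)
  define I I' where "I = L a r" and "I' = L a (- r - 1)"
  have nz: "I \<in> nonzero_ideals R" unfolding I_def using ar by (intro L_nonzero) auto
  have id: "ideal I R" "ideal I' R" unfolding I_def I'_def using ar(2) by (intro ideal_L conj_root_dvd; assumption)+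
  have cnjI: "cnj ` I = I'" by (simp add: I_def I'_def cnj_L)
  have II': "I \<cdot>\<^bsub>R\<^esub> I' = pideal (of_int a)" unfolding I_def I'_def by (rule L_times_cnj_L[OF ar(2)])
  have "cl (I \<cdot>\<^bsub>R\<^esub> I) = \<one>\<^bsub>G\<^esub>" using cl_mult[OF nz nz] ar(3) assms(2) by (simp add: I_def)
  then obtain g where g: "g \<in> carrier R" "g \<noteq> 0" "I \<cdot>\<^bsub>R\<^esub> I = pideal g"
    using R.ideal_class_eq_one_iff[OF R.nonzero_ideals_prod[OF nz nz]] by auto
  obtain u v where uv: "g = E u v" using g(1) by (rule in_RE)
  define n where "n = u\<^sup>2 + u * v + m * v\<^sup>2"
  have gn: "g * cnj g = of_int n" by (simp add: uv E_norm n_def)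
  have "pideal (of_int n) = pideal g \<cdot>\<^bsub>R\<^esub> pideal (cnj g)" using g(1) by (simp add: pideal_mult R_closed gn)
  also have "\<dots> = (I \<cdot>\<^bsub>R\<^esub> I) \<cdot>\<^bsub>R\<^esub> (I' \<cdot>\<^bsub>R\<^esub> I')"
    using cnj_ideal_prod[OF id(1) id(1)] by (simp add: g(3) PIdl_cnj cnjI)
  also have "\<dots> = pideal (of_int (a * a))"
    unfolding R.iprod_interchange[OF id(1) id(1) id(2) id(2)] II' by (simp add: pideal_mult)
  finally have "n = a * a"
    using norm_pos[of u v] g(2) ar(1) by (intro PIdl_of_int_inject) (auto simp: n_def uv E_eq_0_iff)
  then have norm: "g * cnj g = of_int a * of_int a" using gn by simp
  have aR: "of_int a \<in> carrier R" "(of_int a :: complex) \<noteq> 0" using ar(1) by auto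
  have ia: "ideal (pideal (of_int a)) R" using aR by blast
  obtain K where K: "K \<in> nonzero_ideals R" "cnj ` K = K" "cl K = x"
  proof (cases "g + of_int a = 0")
    case True
    then have "g = - of_int a" by (simp add: eq_neg_iff_add_eq_0)
    then have "I \<cdot>\<^bsub>R\<^esub> I = I \<cdot>\<^bsub>R\<^esub> I'" using g(3) II' pideal_minus by simp
    then have "I' \<cdot>\<^bsub>R\<^esub> (I \<cdot>\<^bsub>R\<^esub> I) = I' \<cdot>\<^bsub>R\<^esub> (I \<cdot>\<^bsub>R\<^esub> I')" by simp
    then have "pideal (of_int a) \<cdot>\<^bsub>R\<^esub> I = pideal (of_int a) \<cdot>\<^bsub>R\<^esub> I'"
      using R.ideal_prod_commute[OF id(2) id(1)] R.ideal_prod_commute[OF id(2) ia] II' by (simp add: id flip: R.ideal_prod_assoc)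
    then have "I = I'" by (rule pideal_cancel[OF aR id])
    then show ?thesis using that[of I] nz cnjI ar(3) by (simp add: I_def)
  next
    case False
    define \<mu> where "\<mu> = g + of_int a"
    have \<mu>: "\<mu> \<in> carrier R" "\<mu> \<noteq> 0" "cnj \<mu> \<in> carrier R" "cnj \<mu> \<noteq> 0"
      using False g(1) aR by (auto simp: \<mu>_def complex_cnj_zero_iff simp del: complex_cnj_add)
    have i\<mu>: "ideal (pideal \<mu>) R" "ideal (pideal (cnj \<mu>)) R" using \<mu> by auto
    have key: "cnj \<mu> * g = of_int a * \<mu>" using norm by (simp add: \<mu>_def algebra_simps)
    have "pideal (of_int a) \<cdot>\<^bsub>R\<^esub> (pideal \<mu> \<cdot>\<^bsub>R\<^esub> I') = pideal (cnj \<mu> * g) \<cdot>\<^bsub>R\<^esub> I'"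
      using aR \<mu> ia i\<mu> id by (simp add: key pideal_mult flip: R.ideal_prod_assoc)
    also have "\<dots> = pideal (cnj \<mu>) \<cdot>\<^bsub>R\<^esub> ((I \<cdot>\<^bsub>R\<^esub> I) \<cdot>\<^bsub>R\<^esub> I')"
      using \<mu> g(1) i\<mu> id ideal_pideal[OF g(1)] by (simp add: g(3) R.ideal_prod_assoc flip: pideal_mult)
    also have "\<dots> = pideal (cnj \<mu>) \<cdot>\<^bsub>R\<^esub> (I \<cdot>\<^bsub>R\<^esub> pideal (of_int a))"
      using id by (simp add: R.ideal_prod_assoc II')
    also have "\<dots> = pideal (of_int a) \<cdot>\<^bsub>R\<^esub> (pideal (cnj \<mu>) \<cdot>\<^bsub>R\<^esub> I)"
      using id i\<mu> ia by (metis R.ideal_prod_commute R.iprod_lcomm)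
    finally have eq: "pideal \<mu> \<cdot>\<^bsub>R\<^esub> I' = pideal (cnj \<mu>) \<cdot>\<^bsub>R\<^esub> I"
      by (rule pideal_cancel[OF aR R.ideal_prod_is_ideal[OF i\<mu>(1) id(2)] R.ideal_prod_is_ideal[OF i\<mu>(2) id(1)]])
    have "cnj ` (pideal (cnj \<mu>) \<cdot>\<^bsub>R\<^esub> I) = pideal (cnj \<mu>) \<cdot>\<^bsub>R\<^esub> I"
      unfolding cnj_ideal_prod[OF i\<mu>(2) id(1)] by (simp add: PIdl_cnj cnjI eq)
    moreover have "pideal (cnj \<mu>) \<cdot>\<^bsub>R\<^esub> I \<in> nonzero_ideals R"
      using \<mu> nz by (intro R.nonzero_ideals_prod pideal_nonzero)
    moreover have "cl (pideal (cnj \<mu>) \<cdot>\<^bsub>R\<^esub> I) = x" using cl_scale[OF \<mu>(3,4) nz] ar(3) by (simp add: I_def)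
    ultimately show ?thesis using that by blast
  qed
  obtain D where "D > 0" "D dvd \<Delta>" "cl K = cl (J D)" using ambiguous_ideal_class[OF K(1,2)] .
  then show ?thesis using that K(3) by simp
qed

text \<open>
  Evaluation at \<open>\<omega> \<mapsto> r + 1\<close>, which is a ring homomorphism to \<open>\<int>/a\<close>, sends \<open>r + \<omega>\<close> to \<open>2 * r + 1\<close>.
\<close>
lemma eval_mult_root:
  assumes "a dvd r\<^sup>2 + r + m" "E u v * E r 1 = E u' v'"
  shows "[u' + (r + 1) * v' = (2 * r + 1) * (u + (r + 1) * v)] (mod a)"
proof -
  have "u' = u * r - m * v" "v' = u + v * r + v" using assms(2) by (simp_all add: E_mult E_eq_iff)
  then have "(u' + (r + 1) * v') - (2 * r + 1) * (u + (r + 1) * v) = - (r\<^sup>2 + r + m) * v"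
    by (simp add: power2_eq_square algebra_simps)
  moreover have "a dvd - (r\<^sup>2 + r + m) * v" using assms(1) by (intro dvd_mult2) (simp only: dvd_minus_iff)
  ultimately show ?thesis by (simp only: cong_iff_dvd_diff)
qed

text \<open>
  The class of \<open>I = L a r\<close> is chosen inverse to \<open>x\<close>, with \<open>a\<close> prime to \<open>2 * \<Delta>\<close>. A generator \<open>g\<close> of the
  product of \<open>J D\<close> and the fourth power of \<open>I\<close> has norm \<open>D * a ^ 4\<close>, and its trace is
  divisible by \<open>D\<close> since \<open>g \<in> J D\<close>; \<open>Y\<close> is the coefficient of \<open>\<omega>\<close> in \<open>g\<close>. A prime \<open>l\<close> dividing both \<open>a\<close> and \<open>Y\<close> would divide \<open>g\<close>, hence
  every element of the principal ideal, in particular \<open>D * (r + \<omega>) ^ 4\<close>; evaluation at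
  \<open>\<omega> \<mapsto> r + 1\<close> shows that this is impossible for \<open>l\<close> prime to \<open>\<Delta>\<close>.
\<close>
lemma fourth_power_class_representation:
  assumes D: "D > 0" "D dvd \<Delta>" and x: "x \<in> carrier G" "cl (J D) = x [^]\<^bsub>G\<^esub> (4::nat)"
  obtains X Y a where "D * X\<^sup>2 - (\<Delta> div D) * Y\<^sup>2 = 4 * a ^ 4" "odd a" "coprime Y a" "coprime D a"
proof -
  have "inv\<^bsub>G\<^esub> x \<in> carrier G" using x(1) by simp
  then obtain a r where ar: "a > 0" "a dvd r\<^sup>2 + r + m" "coprime a (2 * \<Delta>)" "inv\<^bsub>G\<^esub> x = cl (L a r)"
    by (rule coprime_representative)
  define I I' where "I = L a r" and "I' = L a (- r - 1)"
  have nz: "I \<in> nonzero_ideals R" unfolding I_def using ar by (intro L_nonzero) auto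
  have id: "ideal I R" "ideal I' R" unfolding I_def I'_def using ar(2) by (intro ideal_L conj_root_dvd; assumption)+
  have cnjI: "cnj ` I = I'" by (simp add: I_def I'_def cnj_L)
  have II': "I \<cdot>\<^bsub>R\<^esub> I' = pideal (of_int a)" unfolding I_def I'_def by (rule L_times_cnj_L[OF ar(2)])
  define I2 I2' where "I2 = I \<cdot>\<^bsub>R\<^esub> I" and "I2' = I' \<cdot>\<^bsub>R\<^esub> I'"
  define I4 I4' where "I4 = I2 \<cdot>\<^bsub>R\<^esub> I2" and "I4' = I2' \<cdot>\<^bsub>R\<^esub> I2'"
  have id2: "ideal I2 R" "ideal I2' R" unfolding I2_def I2'_def using id by (auto intro: R.ideal_prod_is_ideal)
  have id4: "ideal I4 R" "ideal I4' R" unfolding I4_def I4'_def using id2 by (auto intro: R.ideal_prod_is_ideal)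
  have nz2: "I2 \<in> nonzero_ideals R" unfolding I2_def using nz by (intro R.nonzero_ideals_prod)
  then have nz4: "I4 \<in> nonzero_ideals R" unfolding I4_def by (intro R.nonzero_ideals_prod)
  have "cnj ` I2 = I2'" by (simp add: I2_def I2'_def cnj_ideal_prod[OF id(1) id(1)] cnjI)
  then have cnj4: "cnj ` I4 = I4'" by (simp add: I4_def I4'_def cnj_ideal_prod[OF id2(1) id2(1)])
  have II2: "I2 \<cdot>\<^bsub>R\<^esub> I2' = pideal (of_int (a * a))"
    unfolding I2_def I2'_def R.iprod_interchange[OF id(1) id(1) id(2) id(2)] II' by (simp add: pideal_mult)
  have II4: "I4 \<cdot>\<^bsub>R\<^esub> I4' = pideal (of_int (a * a * (a * a)))"
    unfolding I4_def I4'_def R.iprod_interchange[OF id2(1) id2(1) id2(2) id2(2)] II2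
    by (simp add: pideal_mult R_closed)
  note JD = J_nonzero[OF D(2)] ideal_J[OF D(2)]
  have "cl (J D \<cdot>\<^bsub>R\<^esub> I4) = x [^]\<^bsub>G\<^esub> (4::nat) \<otimes>\<^bsub>G\<^esub> (inv\<^bsub>G\<^esub> x) [^]\<^bsub>G\<^esub> (4::nat)"
  proof -
    have "cl I4 = (inv\<^bsub>G\<^esub> x \<otimes>\<^bsub>G\<^esub> inv\<^bsub>G\<^esub> x) \<otimes>\<^bsub>G\<^esub> (inv\<^bsub>G\<^esub> x \<otimes>\<^bsub>G\<^esub> inv\<^bsub>G\<^esub> x)"
      using cl_mult[OF nz2 nz2] cl_mult[OF nz nz] ar(4) by (simp add: I4_def I2_def I_def)
    also have "\<dots> = (inv\<^bsub>G\<^esub> x) [^]\<^bsub>G\<^esub> (4::nat)"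
      using x(1) by (simp add: numeral_eq_Suc G.m_assoc)
    finally show ?thesis using cl_mult[OF JD(1) nz4] x(2) by simp
  qed
  also have "\<dots> = \<one>\<^bsub>G\<^esub>" using x(1) by (simp add: G.nat_pow_inv)
  finally obtain g where g: "g \<in> carrier R" "g \<noteq> 0" "J D \<cdot>\<^bsub>R\<^esub> I4 = pideal g"
    using R.ideal_class_eq_one_iff[OF R.nonzero_ideals_prod[OF JD(1) nz4]] by auto
  obtain u v where uv: "g = E u v" using g(1) by (rule in_RE)
  define n where "n = u\<^sup>2 + u * v + m * v\<^sup>2"
  have gn: "g * cnj g = of_int n" by (simp add: uv E_norm n_def)
  have cnjJ: "cnj ` J D = J D"
  proof -
    obtain s where "J D = L D s" "J D = L D (- s - 1)" using D(2) by (rule root_of_divisor)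
    then show ?thesis using cnj_L by metis
  qed
  have "pideal (of_int n) = pideal g \<cdot>\<^bsub>R\<^esub> pideal (cnj g)" using g(1) by (simp add: pideal_mult R_closed gn)
  also have "\<dots> = (J D \<cdot>\<^bsub>R\<^esub> I4) \<cdot>\<^bsub>R\<^esub> (J D \<cdot>\<^bsub>R\<^esub> I4')"
    using cnj_ideal_prod[OF JD(2) id4(1)] by (simp add: g(3) PIdl_cnj cnj4 cnjJ)
  also have "\<dots> = pideal (of_int (D * (a * a * (a * a))))"
    unfolding R.iprod_interchange[OF JD(2) id4(1) JD(2) id4(2)] II4 J_square[OF D(2)]
    by (simp add: pideal_mult R_closed)
  finally have n: "n = D * (a * a * (a * a))"
    using norm_pos[of u v] g(2) ar(1) D(1) by (intro PIdl_of_int_inject) (auto simp: n_def uv E_eq_0_iff)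
  have "g \<in> J D" using g(3) R.cgenideal_self[OF g(1)] R.ideal_prod_inter[OF JD(2) id4(1)] by auto
  then obtain X where X: "2 * u + v = D * X" unfolding uv E_in_J by blast
  obtain D' where D': "\<Delta> = D * D'" using D(2) by blast
  have "D * (D * X\<^sup>2 - D' * v\<^sup>2) = (2 * u + v)\<^sup>2 - \<Delta> * v\<^sup>2"
    unfolding X D' by (simp add: power2_eq_square algebra_simps)
  also have "\<dots> = 4 * n + (1 - 4 * m - \<Delta>) * v\<^sup>2" by (simp add: n_def power2_eq_square algebra_simps)
  also have "\<dots> = D * (4 * a ^ 4)" using four_m by (simp add: n power4_eq_xxxx)
  finally have eq: "D * X\<^sup>2 - D' * v\<^sup>2 = 4 * a ^ 4" using D(1) by simp
  have odd: "odd a" and cop: "coprime a \<Delta>" using ar(3) by simp_all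
  have "coprime v a"
  proof (rule int_coprimeI)
    fix l assume l: "prime l" "l dvd v" "l dvd a"
    have l\<Delta>: "\<not> l dvd \<Delta>" using cop l(1,3) by (meson coprime_common_divisor not_prime_unit)
    have lD: "\<not> l dvd D" using l\<Delta> D(2) dvd_trans by blast
    have oddl: "odd l" using l(3) odd by auto
    have "l dvd 4 * a ^ 4 + D' * v\<^sup>2" using l(2,3) by (simp add: power2_eq_square power4_eq_xxxx)
    then have "l dvd D * X\<^sup>2" using eq by (metis add_diff_cancel_right' diff_add_cancel)
    then have "l dvd X" using lD l(1) prime_dvd_mult_iff prime_dvd_power by blast
    then have "l dvd 2 * u + v" using X by simp
    then have "l dvd 2 * u" using l(2) by (simp add: dvd_add_left_iff)
    then have lu: "l dvd u" using dvd_two_mult_iff[OF oddl] by simp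
    have "E r 1 \<in> I" by (simp add: I_def E_in_L)
    then have "(E r 1 * E r 1) * (E r 1 * E r 1) \<in> I4"
      unfolding I4_def I2_def by (intro ideal_prod_memI)
    then have "E D 0 * ((E r 1 * E r 1) * (E r 1 * E r 1)) \<in> pideal g"
      unfolding g(3)[symmetric] by (intro ideal_prod_memI) (auto simp: E_in_J)
    then obtain z where z: "z \<in> carrier R" "E D 0 * ((E r 1 * E r 1) * (E r 1 * E r 1)) = E u v * z"
      unfolding PIdl_R uv by blast
    obtain s w where sw: "z = E s w" using z(1) by (rule in_RE)
    have prod: "E D 0 * E r 1 * E r 1 * E r 1 * E r 1 = E u v * z" using z(2) by (simp add: mult.assoc)
    have lr: "l dvd r\<^sup>2 + r + m" using l(3) ar(2) dvd_trans by blast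
    obtain u1 v1 where 1: "E D 0 * E r 1 = E u1 v1" by (simp add: E_mult)
    obtain u2 v2 where 2: "E u1 v1 * E r 1 = E u2 v2" by (simp add: E_mult)
    obtain u3 v3 where 3: "E u2 v2 * E r 1 = E u3 v3" by (simp add: E_mult)
    obtain u4 v4 where 4: "E u3 v3 * E r 1 = E u4 v4" by (simp add: E_mult)
    let ?t = "2 * r + 1"
    have "E u4 v4 = E u v * E s w" using prod unfolding 1 2 3 4 sw .
    then have "l dvd u4" "l dvd v4" using lu l(2) unfolding E_mult E_eq_iff by auto
    then have "l dvd u4 + (r + 1) * v4" by simp
    note e = eval_mult_root[OF lr 1] eval_mult_root[OF lr 2] eval_mult_root[OF lr 3] eval_mult_root[OF lr 4]
    have "[u4 + (r + 1) * v4 = ?t * (?t * (?t * (?t * (D + (r + 1) * 0))))] (mod l)"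
      using e by (meson cong_scalar_left cong_trans)
    then have "l dvd ?t * (?t * (?t * (?t * D)))" using \<open>l dvd u4 + (r + 1) * v4\<close> by (simp add: cong_dvd_iff)
    then have "l dvd ?t" using l(1) lD by (auto simp: prime_dvd_mult_iff)
    then have "l dvd ?t\<^sup>2 - 4 * (r\<^sup>2 + r + m)" using lr by (intro dvd_diff dvd_mult) (auto simp: power2_eq_square)
    moreover have "?t\<^sup>2 - 4 * (r\<^sup>2 + r + m) = \<Delta>" using form_discriminant[of r] by simp
    ultimately show False using l\<Delta> by simp
  qed (use ar(1) in simp)
  moreover have "coprime D a" using cop D(2) by (metis coprime_commute coprime_divisors dvd_refl)
  moreover have "\<Delta> div D = D'" using D' D(1) by simp
  ultimately show ?thesis using that eq odd by blast
qed

end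

section \<open>The group of divisors and the main inequality\<close>

lemma divisor_group_simps [simp]:
  "carrier (divisor_group n) = {D. D dvd n}" "\<one>\<^bsub>divisor_group n\<^esub> = 1"
  "D \<otimes>\<^bsub>divisor_group n\<^esub> D' = D * D' div (gcd D D')\<^sup>2"
  by (simp_all add: divisor_group_def)

text \<open>
  Squarefreeness splits \<open>D\<close> and \<open>D'\<close> into their common part \<open>g\<close> and coprime cofactors, and the sum in the
  group of divisors is the product of the cofactors.
\<close>
lemma divisor_group_decomp:
  fixes D D' :: nat
  assumes "squarefree n" "D dvd n" "D' dvd n"
  obtains g d e where "D = g * d" "D' = g * e" "coprime g d" "coprime g e" "coprime d e"
    "D * D' div (gcd D D')\<^sup>2 = d * e" "d * e dvd n" "g * d * e dvd n"
proof -
  have n0: "n \<noteq> 0" using assms(1) by (intro notI) simp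
  define g where "g = gcd D D'"
  have g0: "g \<noteq> 0" using n0 assms(2) by (auto simp: g_def)
  obtain d e where de: "D = g * d" "D' = g * e" "coprime d e"
    using gcd_coprime_exists[of D D'] g0 unfolding g_def by (metis mult.commute)
  have sq: "coprime x y" if "squarefree (x * y)" for x y :: nat
  proof (rule coprimeI)
    fix c assume "c dvd x" "c dvd y"
    then have "c\<^sup>2 dvd x * y" by (simp add: power2_eq_square mult_dvd_mono)
    then show "is_unit c" using that squarefreeD by blast
  qed
  have gd: "coprime g d" and ge: "coprime g e"
    using sq squarefree_mono[OF assms(2,1)] squarefree_mono[OF assms(3,1)] by (auto simp: de(1,2))
  have "D * D' div (gcd D D')\<^sup>2 = d * e"
  proof -
    have "D * D' = d * e * g\<^sup>2" by (simp add: de(1,2) power2_eq_square mult_ac)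
    then show ?thesis using g0 by (simp flip: g_def)
  qed
  moreover have "g * d * e dvd n"
    using assms(2,3) de gd ge by (metis coprime_mult_left_iff divides_mult dvd_mult_right mult.commute)
  moreover then have "d * e dvd n" by (metis dvd_mult_right mult.assoc)
  ultimately show ?thesis using that[of g d e] de gd ge by blast
qed

text \<open>
  On sets of prime factors the operation is the symmetric difference, which makes its associativity
  visible.
\<close>
lemma prime_dvd_divisor_group_mult:
  fixes q :: nat
  assumes "squarefree n" "D dvd n" "D' dvd n" "prime q"
  shows "q dvd D \<otimes>\<^bsub>divisor_group n\<^esub> D' \<longleftrightarrow> (q dvd D) \<noteq> (q dvd D')"
proof -
  obtain g d e where *: "D = g * d" "D' = g * e" "coprime g d" "coprime g e" "coprime d e"
    "D * D' div (gcd D D')\<^sup>2 = d * e" "d * e dvd n" "g * d * e dvd n"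
    using assms(1-3) by (rule divisor_group_decomp)
  have "\<not> (q dvd x \<and> q dvd y)" if "coprime x y" for x y
    using that assms(4) by (meson coprime_common_divisor_nat not_prime_unit coprime_common_divisor)
  then have "q dvd d * e \<longleftrightarrow> (q dvd g * d) \<noteq> (q dvd g * e)"
    using *(3-5) assms(4) by (auto simp: prime_dvd_mult_iff)
  then show ?thesis unfolding divisor_group_simps *(6) unfolding *(1,2) .
qed

lemma squarefree_nat_eqI:
  fixes D D' :: nat
  assumes "squarefree D" "squarefree D'" "\<And>q. prime q \<Longrightarrow> q dvd D \<longleftrightarrow> q dvd D'"
  shows "D = D'"
proof -
  have "D \<noteq> 0" "D' \<noteq> 0" using assms(1,2) not_squarefree_0 by metis+
  then have "prime_factors D = prime_factors D'" using assms(3) by (auto simp: in_prime_factors_iff)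
  then show ?thesis using prod_prime_factors_squarefree assms(1,2) by metis
qed

lemma comm_group_divisor_group:
  assumes n: "squarefree n" shows "comm_group (divisor_group n)"
proof (rule comm_groupI)
  let ?G = "divisor_group n"
  have closed: "D \<otimes>\<^bsub>?G\<^esub> D' dvd n" if "D dvd n" "D' dvd n" for D D'
    using n that by (rule divisor_group_decomp) simp
  show "D \<otimes>\<^bsub>?G\<^esub> D' \<in> carrier ?G" if "D \<in> carrier ?G" "D' \<in> carrier ?G" for D D'
    using closed that by simp
  note prm = prime_dvd_divisor_group_mult[OF n]
  show "D \<otimes>\<^bsub>?G\<^esub> D' \<otimes>\<^bsub>?G\<^esub> D'' = D \<otimes>\<^bsub>?G\<^esub> (D' \<otimes>\<^bsub>?G\<^esub> D'')"
    if "D \<in> carrier ?G" "D' \<in> carrier ?G" "D'' \<in> carrier ?G" for D D' D''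
  proof (rule squarefree_nat_eqI)
    have d: "D dvd n" "D' dvd n" "D'' dvd n" using that by auto
    show "squarefree (D \<otimes>\<^bsub>?G\<^esub> D' \<otimes>\<^bsub>?G\<^esub> D'')" "squarefree (D \<otimes>\<^bsub>?G\<^esub> (D' \<otimes>\<^bsub>?G\<^esub> D''))"
      using closed d squarefree_mono[OF _ n] by meson+
    fix q :: nat assume q: "prime q"
    show "q dvd D \<otimes>\<^bsub>?G\<^esub> D' \<otimes>\<^bsub>?G\<^esub> D'' \<longleftrightarrow> q dvd D \<otimes>\<^bsub>?G\<^esub> (D' \<otimes>\<^bsub>?G\<^esub> D'')"
      unfolding prm[OF closed[OF d(1,2)] d(3) q] prm[OF d(1) closed[OF d(2,3)] q]
        prm[OF d(1,2) q] prm[OF d(2,3) q] by blast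
  qed
  show "\<exists>D'\<in>carrier ?G. D' \<otimes>\<^bsub>?G\<^esub> D = \<one>\<^bsub>?G\<^esub>" if "D \<in> carrier ?G" for D
  proof
    have "n \<noteq> 0" using n by (intro notI) simp
    then have "D \<noteq> 0" using that by auto
    then show "D \<otimes>\<^bsub>?G\<^esub> D = \<one>\<^bsub>?G\<^esub>" by (simp add: power2_eq_square)
  qed fact
qed (auto simp: mult.commute gcd.commute)

lemma divisor_group_square:
  assumes "squarefree n" "D dvd n" shows "D \<otimes>\<^bsub>divisor_group n\<^esub> D = 1"
proof -
  have "n \<noteq> 0" using assms(1) by (intro notI) simp
  then have "D \<noteq> 0" using assms(2) by auto
  then show ?thesis by (simp add: power2_eq_square)
qed

context imaginary_quadratic
begin

text \<open>
  Common prime factors of \<open>D\<close> and \<open>D'\<close> contribute a principal square and may be dropped.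
\<close>
lemma cl_J_hom:
  assumes n: "int n dvd \<Delta>" and D: "D dvd n" "D' dvd n"
  shows "cl (J (int (D \<otimes>\<^bsub>divisor_group n\<^esub> D'))) = cl (J (int D)) \<otimes>\<^bsub>G\<^esub> cl (J (int D'))"
proof -
  have "squarefree (int n)" using squarefree_mono[OF n sqf] .
  then have sqn: "squarefree n"
    by (intro squarefreeI) (metis int_dvd_int_iff of_nat_power squarefreeD of_nat_1)
  obtain g d e where *: "D = g * d" "D' = g * e" "coprime g d" "coprime g e" "coprime d e"
    "D * D' div (gcd D D')\<^sup>2 = d * e" "d * e dvd n" "g * d * e dvd n"
    using sqn D by (rule divisor_group_decomp)
  have dv: "int x dvd \<Delta>" if "x dvd n" for x using that n by (meson dvd_trans of_nat_dvd_iff)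
  have dvs: "int g dvd \<Delta>" "int d dvd \<Delta>" "int e dvd \<Delta>"
    using *(8) by (auto intro!: dv elim: dvd_mult_left dvd_mult_right dest: dvd_mult_left dvd_mult_right)
  have J: "J (int (x * y)) = J (int x) \<cdot>\<^bsub>R\<^esub> J (int y)" if "int x dvd \<Delta>" "int y dvd \<Delta>" "coprime x y" for x y
    using J_mult[OF that(1,2)] that(3) by simp
  note nz = J_nonzero[OF dvs(1)] J_nonzero[OF dvs(2)] J_nonzero[OF dvs(3)]
  note cc = cl_closed[OF nz(1)] cl_closed[OF nz(2)] cl_closed[OF nz(3)]
  have "cl (J (int D)) \<otimes>\<^bsub>G\<^esub> cl (J (int D')) =
    (cl (J (int g)) \<otimes>\<^bsub>G\<^esub> cl (J (int d))) \<otimes>\<^bsub>G\<^esub> (cl (J (int g)) \<otimes>\<^bsub>G\<^esub> cl (J (int e)))"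
    unfolding *(1,2) J[OF dvs(1,2) *(3)] J[OF dvs(1,3) *(4)] using nz by (simp add: cl_mult)
  also have "\<dots> = (cl (J (int g)) \<otimes>\<^bsub>G\<^esub> cl (J (int g))) \<otimes>\<^bsub>G\<^esub> (cl (J (int d)) \<otimes>\<^bsub>G\<^esub> cl (J (int e)))"
    using cc by (simp add: G.m_ac)
  also have "\<dots> = cl (J (int d)) \<otimes>\<^bsub>G\<^esub> cl (J (int e))" using cl_J_square[OF dvs(1)] cc by simp
  also have "\<dots> = cl (J (int (d * e)))" unfolding J[OF dvs(2,3) *(5)] using nz by (simp add: cl_mult)
  finally show ?thesis using *(6) by simp
qed

lemma finprod_ramified_primes:
  assumes "finite S" "inj_on p S" "\<And>i. i \<in> S \<Longrightarrow> prime (p i)" "int (\<Prod>i\<in>S. p i) dvd \<Delta>"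
  shows "finprod (ideals_set R) (\<lambda>i. ramified_prime \<Delta> (p i)) S = J (int (\<Prod>i\<in>S. p i))"
  using assms
proof (induction S)
  case empty
  interpret M: comm_monoid "ideals_set R" by (rule R.ideals_set_is_comm_monoid)
  show ?case by (simp add: J_one) (simp add: ideals_set_def)
next
  case (insert j S)
  interpret M: comm_monoid "ideals_set R" by (rule R.ideals_set_is_comm_monoid)
  have dv: "int (p i) dvd \<Delta>" if "i \<in> insert j S" for i
    using that insert.prems(3) insert.hyps(1) by (meson dvd_prodI dvd_trans finite_insert of_nat_dvd_iff)
  have eq: "ramified_prime \<Delta> (p i) = J (int (p i))" if "i \<in> insert j S" for i
    using that insert.prems(2) dv by (intro ramified_prime_eq_J) auto
  have closed: "ramified_prime \<Delta> (p i) \<in> carrier (ideals_set R)" if "i \<in> insert j S" for i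
    using eq[OF that] ideal_J[OF dv[OF that]] by (simp add: ideals_set_def)
  have prodS: "int (\<Prod>i\<in>S. p i) dvd \<Delta>" using insert.prems(3) insert.hyps by (simp add: dvd_mult_right)
  have cop: "coprime (int (p j)) (int (\<Prod>i\<in>S. p i))"
  proof -
    have "coprime (p j) (p i)" if "i \<in> S" for i
      using insert that by (intro primes_coprime) (auto simp: inj_on_def)
    then have "coprime (p j) (\<Prod>i\<in>S. p i)" by (rule prod_coprime_right)
    then show ?thesis by (simp only: coprime_int_iff)
  qed
  have "finprod (ideals_set R) (\<lambda>i. ramified_prime \<Delta> (p i)) (insert j S)
    = ramified_prime \<Delta> (p j) \<otimes>\<^bsub>ideals_set R\<^esub> finprod (ideals_set R) (\<lambda>i. ramified_prime \<Delta> (p i)) S"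
    using insert.hyps closed by (intro M.finprod_insert) auto
  also have "finprod (ideals_set R) (\<lambda>i. ramified_prime \<Delta> (p i)) S = J (int (\<Prod>i\<in>S. p i))"
    using insert.prems prodS by (intro insert.IH) auto
  also have "ramified_prime \<Delta> (p j) \<otimes>\<^bsub>ideals_set R\<^esub> J (int (\<Prod>i\<in>S. p i)) = J (int (p j)) \<cdot>\<^bsub>R\<^esub> J (int (\<Prod>i\<in>S. p i))"
    using eq[of j] by (simp add: ideals_set_def)
  also have "\<dots> = J (int (p j) * int (\<Prod>i\<in>S. p i))" by (rule J_mult[OF dv prodS cop]) simp
  finally show ?case using insert.hyps by simp
qed

end

theorem corollary4p3:
  fixes t :: nat and p :: "nat \<Rightarrow> nat" and \<Delta> :: int
  assumes "t \<ge> 1"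
    and "inj_on p {1..t}"
    and "\<And>i. i \<in> {1..t} \<Longrightarrow> prime (p i)"
    and "\<And>i. i \<in> {1..t - 1} \<Longrightarrow> [p i = 1] (mod 4)"
    and "[p t = 3] (mod 4)"
    and "\<Delta> = - (\<Prod>i=1..t. int (p i))"
  shows "eight_rank (class_group (quad_ints \<Delta>)) \<le> isotropy_index F2 (V0 \<Delta> p t) (Q_B \<Delta>)"
proof -
  define P where "P = (\<Prod>i=1..t - 1. p i)"
  have \<Delta>_P: "\<Delta> = - (int P * int (p t))"
  proof -
    have "{1..t} = insert t {1..t - 1}" using assms(1) by auto
    then have "(\<Prod>i=1..t. int (p i)) = int (p t) * (\<Prod>i=1..t - 1. int (p i))" using assms(1) by simp
    then show ?thesis by (simp add: assms(6) P_def mult.commute)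
  qed
  have P4: "[P = 1] (mod 4)"
    unfolding P_def using cong_prod[of "{1..t - 1}" p "\<lambda>_. 1" 4] assms(4) by simp
  have sqf_all: "squarefree (\<Prod>i=1..t. p i)"
  proof (rule squarefree_prod_coprime)
    fix i j assume ij: "i \<in> {1..t}" "j \<in> {1..t}" "i \<noteq> j"
    then have "p i \<noteq> p j" using assms(2) by (meson inj_onD)
    then show "coprime (p i) (p j)" using assms(3) ij by (intro primes_coprime) auto
  qed (use assms(3) in \<open>intro squarefree_prime\<close>)
  have all: "(\<Prod>i=1..t. int (p i)) = int (\<Prod>i=1..t. p i)" by simp
  interpret imaginary_quadratic \<Delta>
  proof
    have "(\<Prod>i=1..t. p i) > 0" using assms(3) by (intro prod_pos) (auto simp: prime_gt_0_nat)
    then show "\<Delta> < 0" unfolding assms(6) all by (simp only: neg_less_0_iff_less of_nat_0_less_iff)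
    have "[int P * int (p t) = 1 * 3] (mod 4)"
      using P4 assms(5) cong_int_iff[of P 1 4] cong_int_iff[of "p t" 3 4] by (intro cong_mult) auto
    then have "(int P * int (p t)) mod 4 = 3" by (simp add: cong_def)
    then show "\<Delta> mod 4 = 1" unfolding \<Delta>_P by presburger
    show "squarefree \<Delta>" unfolding assms(6) all squarefree_minus
    proof (rule squarefreeI)
      fix x :: int assume "x\<^sup>2 dvd int (\<Prod>i=1..t. p i)"
      then have "nat \<bar>x\<bar> ^ 2 dvd (\<Prod>i=1..t. p i)" by (simp add: nat_abs_dvd_iff nat_power_eq flip: int_dvd_int_iff)
      then have "is_unit (nat \<bar>x\<bar>)" using sqf_all squarefreeD by blast
      then show "is_unit x" by (simp add: nat_abs_dvd_iff)
    qed
  qed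
  have Pdvd: "int P dvd \<Delta>" unfolding \<Delta>_P by simp
  have sqfP: "squarefree P"
    using sqf_all by (rule squarefree_mono[rotated]) (auto simp: P_def intro!: prod_dvd_prod_subset)
  let ?V' = "V' p t"
  have V': "?V' = divisor_group P" by (simp add: V'_def P_def)
  interpret V': comm_group ?V' unfolding V' by (rule comm_group_divisor_group[OF sqfP])
  have dvd_\<Delta>: "int D dvd \<Delta>" if "D dvd P" for D using that Pdvd by (meson dvd_trans of_nat_dvd_iff)
  have divisor_primes: "\<exists>i\<in>{1..t - 1}. q = p i" if q: "prime q" "q dvd P" for q
  proof -
    obtain i where i: "i \<in> {1..t - 1}" "q dvd p i"
      using q(2) prime_dvd_prod_iff[of "{1..t - 1}" q p] q(1) unfolding P_def by blast
    have "prime (p i)" using i(1) by (intro assms(3)) auto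
    then have "q = p i" using q(1) i(2) primes_dvd_imp_eq by blast
    then show ?thesis using i(1) by blast
  qed
  \<comment> \<open>The two descriptions of the ideal attached to a divisor agree.\<close>
  have ideal_eq: "divisor_ideal \<Delta> p t D = J (int D)" if D: "D dvd P" for D
  proof -
    let ?S = "{i \<in> {1..t - 1}. p i dvd D}"
    have "prime_factors D = p ` ?S"
    proof (intro equalityI subsetI)
      fix q assume "q \<in> prime_factors D"
      then have q: "prime q" "q dvd D" by auto
      then obtain i where "i \<in> {1..t - 1}" "q = p i" using divisor_primes[OF q(1) dvd_trans[OF q(2) D]] by blast
      then show "q \<in> p ` ?S" using q(2) by blast
    next
      have "D \<noteq> 0" using D sqfP by (intro notI) auto
      fix q assume "q \<in> p ` ?S"
      then show "q \<in> prime_factors D" using \<open>D \<noteq> 0\<close> assms(3) by (auto simp: in_prime_factors_iff)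
    qed
    moreover have inj: "inj_on p ?S" using assms(2) by (rule inj_on_subset) auto
    ultimately have D_prod: "(\<Prod>i\<in>?S. p i) = D"
      using prod_prime_factors_squarefree[OF squarefree_mono[OF D sqfP]] by (simp add: prod.reindex)
    show ?thesis unfolding divisor_ideal_def
      by (subst finprod_ramified_primes) (use inj assms(3) dvd_\<Delta>[OF D] D_prod in auto)
  qed
  define \<phi> where "\<phi> D = cl (J (int D))" for D
  have \<phi>_closed: "\<phi> D \<in> carrier G" if "D dvd P" for D
    unfolding \<phi>_def using that dvd_\<Delta> by (intro cl_closed J_nonzero)
  have "\<phi> \<in> hom ?V' G"
    unfolding V' hom_def using \<phi>_closed cl_J_hom[OF Pdvd] by (auto simp: \<phi>_def simp del: divisor_group_simps(3))
  then interpret \<phi>: group_hom ?V' G \<phi>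
    by (intro group_hom.intro group_hom_axioms.intro V'.is_group G.is_group)
  define A where "A n = {D \<in> carrier ?V'. \<phi> D \<in> powers G n}" for n
  have A_subgroup: "subgroup (A n) ?V'" for n
  proof -
    interpret H: subgroup "powers G n" G by (rule subgroup_powers) (rule G.comm_group_axioms)
    show ?thesis
      by (rule V'.subgroupI) (auto simp: A_def intro: exI[of _ "\<one>\<^bsub>?V'\<^esub>"])
  qed
  have powers_4_2: "powers G 4 \<subseteq> powers G 2"
  proof
    fix y assume "y \<in> powers G 4"
    then obtain x where x: "x \<in> carrier G" "y = x [^]\<^bsub>G\<^esub> (4::nat)" by (auto simp: powers_def)
    then have "y = (x [^]\<^bsub>G\<^esub> (2::nat)) [^]\<^bsub>G\<^esub> (2::nat)" by (simp add: G.nat_pow_pow)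
    then show "y \<in> powers G 2" using x by (auto simp: powers_def)
  qed
  let ?H = "?V'\<lparr>carrier := A 2\<rparr>"
  have V0: "V0 \<Delta> p t = F2_space ?H"
  proof -
    have "{D \<in> carrier ?V'. cl (divisor_ideal \<Delta> p t D) \<in> powers G 2} = A 2"
      unfolding A_def \<phi>_def V' using ideal_eq by auto
    then show ?thesis by (simp add: V0_def)
  qed
  have H: "comm_group ?H"
    by (intro group.group_comm_groupI V'.subgroup_imp_group A_subgroup)
       (use V'.m_comm in \<open>auto simp: A_def\<close>)
  have A4_sub: "subgroup (A 4) ?H"
    using A_subgroup[of 4] A_subgroup[of 2] powers_4_2
    by (intro V'.subgroup_incl) (auto simp: A_def)
  have "P \<noteq> 0" using sqfP by (intro notI) simp
  then have finP: "finite {D. D dvd P}" by (rule finite_divisors_nat[OF neq0_conv[THEN iffD1]])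
  \<comment> \<open>Classes of order two that are fourth powers all come from divisors of \<open>P\<close>.\<close>
  have onto: "{x \<in> powers G 4. x \<otimes>\<^bsub>G\<^esub> x = \<one>\<^bsub>G\<^esub>} \<subseteq> \<phi> ` A 4"
  proof
    fix x assume "x \<in> {x \<in> powers G 4. x \<otimes>\<^bsub>G\<^esub> x = \<one>\<^bsub>G\<^esub>}"
    then have x: "x \<in> powers G 4" "x \<in> carrier G" "x \<otimes>\<^bsub>G\<^esub> x = \<one>\<^bsub>G\<^esub>" by (auto simp: powers_def)
    obtain D where D: "D > 0" "D dvd \<Delta>" "x = cl (J D)" using x(2,3) by (rule two_torsion_representative)
    have "\<exists>D'. D' dvd P \<and> x = \<phi> D'"
    proof (cases "int (p t) dvd D")
      case False
      have "prime (int (p t))" using assms(1,3) by simp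
      then have "coprime D (int (p t))" using False prime_imp_coprime coprime_commute by blast
      moreover have "D dvd int P * int (p t)" using D(2) unfolding \<Delta>_P by simp
      ultimately have "D dvd int P" by (simp add: coprime_dvd_mult_left_iff)
      then show ?thesis using D by (intro exI[of _ "nat D"]) (auto simp: \<phi>_def nat_dvd_iff)
    next
      case True
      \<comment> \<open>The complementary divisor of \<open>\<Delta>\<close> gives the same class and is prime to \<open>p t\<close>.\<close>
      then obtain k where k: "D = int (p t) * k" by blast
      have "p t > 0" using assms(1,3) by (simp add: prime_gt_0_nat)
      have "k dvd int P"
        using D(2) \<open>p t > 0\<close> unfolding \<Delta>_P k by (simp add: mult.commute)
      then obtain l where l: "int P = k * l" by blast
      have "\<Delta> = - (D * l)" unfolding \<Delta>_P k l by (simp add: mult_ac)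
      then have "x = cl (J l)" using D(3) cl_J_complement by metis
      moreover have "l > 0"
        using l k D(1) \<open>p t > 0\<close> \<open>P \<noteq> 0\<close> by (metis of_nat_0_less_iff zero_less_mult_pos bot_nat_0.not_eq_extremum)
      moreover have "l dvd int P" using l by simp
      ultimately show ?thesis by (intro exI[of _ "nat l"]) (auto simp: \<phi>_def nat_dvd_iff)
    qed
    then show "x \<in> \<phi> ` A 4" using x(1) by (auto simp: A_def V')
  qed
  \<comment> \<open>The form vanishes on them.\<close>
  have isotropic: "Q_B \<Delta> D = \<zero>\<^bsub>F2\<^esub>" if "D \<in> A 4" for D
  proof -
    have D: "D dvd P" and "\<phi> D \<in> powers G 4" using that by (auto simp: A_def V')
    then obtain x where x: "x \<in> carrier G" "cl (J (int D)) = x [^]\<^bsub>G\<^esub> (4::nat)" by (auto simp: powers_def \<phi>_def)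
    have D0: "int D > 0" using D \<open>P \<noteq> 0\<close> by (auto intro!: Nat.gr0I)
    obtain X Y a where eq: "int D * X\<^sup>2 - (\<Delta> div int D) * Y\<^sup>2 = 4 * a ^ 4" "odd a" "coprime Y a" "coprime (int D) a"
      using fourth_power_class_representation[OF D0 dvd_\<Delta>[OF D] x] .
    have one4: "[q = 1] (mod 4)" if "prime q" "q dvd D" for q
      using divisor_primes[OF that(1) dvd_trans[OF that(2) D]] assms(4) by auto
    have sqfD: "squarefree D" using squarefree_mono[OF D sqfP] .
    have "[\<Delta> div int D = 1] (mod 4)"
    proof -
      have "[D = 1] (mod 4)"
      proof -
        have "[\<Prod>(prime_factors D) = (\<Prod>q\<in>prime_factors D. 1)] (mod 4)"
          by (intro cong_prod) (use one4 in auto)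
        then show ?thesis using prod_prime_factors_squarefree[OF sqfD] by simp
      qed
      then have "[1 * (\<Delta> div int D) = int D * (\<Delta> div int D)] (mod 4)"
        using cong_int_iff[of D 1 4] by (intro cong_scalar_right) (simp add: cong_sym)
      moreover have "int D * (\<Delta> div int D) = \<Delta>" using dvd_\<Delta>[OF D] by simp
      ultimately show ?thesis using mod4 by (simp add: cong_def)
    qed
    then have "quartic_symbol (\<Delta> div int D) D = 1"
      using quartic_symbol_eq_1[OF sqfD one4 eq(1) _ eq(2-4)] by blast
    then show ?thesis by (simp add: Q_B_def xi_def)
  qed
  have "2 ^ eight_rank G = card {x \<in> powers G 4. x \<otimes>\<^bsub>G\<^esub> x = \<one>\<^bsub>G\<^esub>}"
    by (rule two_power_eight_rank[OF G.comm_group_axioms finite_class_group])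
  also have "\<dots> \<le> card (\<phi> ` A 4)"
    using onto finP by (intro card_mono finite_imageI) (auto simp: A_def V')
  also have "\<dots> \<le> card (A 4)"
    using finP by (intro card_image_le) (auto simp: A_def V')
  also have "\<dots> \<le> 2 ^ isotropy_index F2 (V0 \<Delta> p t) (Q_B \<Delta>)"
    unfolding V0
  proof (rule card_le_two_power_isotropy_index[OF H _ _ A4_sub isotropic])
    show "finite (carrier ?H)" using finP by (auto simp: A_def V')
    show "D \<otimes>\<^bsub>?H\<^esub> D = \<one>\<^bsub>?H\<^esub>" if "D \<in> carrier ?H" for D
      using that divisor_group_square[OF sqfP, of D] by (simp add: A_def V' del: divisor_group_simps(3))
  qed
  finally show ?thesis by simp
qed

end
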